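(* Let $G$ be a finite group. Then $G$ is $\mathrm{w}$-supersoluble if and only if every Sylow subgroup of $G$ is strongly permuteral in $G$.
   Context: All groups are finite. For a subgroup $H$ of a group $G$, the permutizer of $H$ in $G$ is the subgroup $P_G(H)=\langle x\in G \mid \langle x\rangle H=H\langle x\rangle\rangle$ (generated by all $x\in G$ such that the cyclic subgroup $\langle x\rangle$ permutes with $H$). A subgroup $H$ of $G$ is strongly permuteral in $G$ if $P_U(H)=U$ for every subgroup $U$ with $H\leq U\leq G$. A subgroup $H$ of $G$ is $\mathbb{P}$-subnormal in $G$ if either $H=G$ or there is a chain of subgroups $H=H_0<H_1<\cdots<H_{n-1}<H_n=G$ such that $|H_{i+1}:H_i|$ is a prime for every $i=0,1,\ldots,n-1$. A group $G$ is $\mathrm{w}$-supersoluble if every Sylow subgroup of $G$ is $\mathbb{P}$-subnormal in $G$. *)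

theory Defs
  imports "HOL-Algebra.Generated_Groups" "HOL-Algebra.Sylow"
begin

definition subgroup_index :: "('a, 'b) monoid_scheme \<Rightarrow> 'a set \<Rightarrow> 'a set \<Rightarrow> nat" where
  "subgroup_index G K H = card (rcosets\<^bsub>G\<lparr>carrier := K\<rparr>\<^esub> H)"

definition permutizer :: "('a, 'b) monoid_scheme \<Rightarrow> 'a set \<Rightarrow> 'a set" where
  "permutizer G H =
     generate G {x \<in> carrier G. generate G {x} <#>\<^bsub>G\<^esub> H = H <#>\<^bsub>G\<^esub> generate G {x}}"

definition strongly_permuteral :: "'a set \<Rightarrow> ('a, 'b) monoid_scheme \<Rightarrow> bool" where
  "strongly_permuteral H G \<longleftrightarrow> subgroup H G \<and>
     (\<forall>U. subgroup U G \<and> H \<subseteq> U \<longrightarrow> permutizer (G\<lparr>carrier := U\<rparr>) H = U)"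

definition P_subnormal :: "'a set \<Rightarrow> ('a, 'b) monoid_scheme \<Rightarrow> bool" where
  "P_subnormal H G \<longleftrightarrow> H = carrier G \<or>
     (\<exists>(n::nat) (C :: nat \<Rightarrow> 'a set). C 0 = H \<and> C n = carrier G \<and>
        (\<forall>i\<le>n. subgroup (C i) G) \<and>
        (\<forall>i<n. C i \<subset> C (Suc i) \<and> prime (subgroup_index G (C (Suc i)) (C i))))"

(* The prime p need not divide the order of G: for other primes the Sylow p-subgroup is
   the trivial subgroup. *)
definition sylow_subgroup :: "'a set \<Rightarrow> ('a, 'b) monoid_scheme \<Rightarrow> bool" where
  "sylow_subgroup H G \<longleftrightarrow> subgroup H G \<and>
     (\<exists>p::nat. prime p \<and> card H = p ^ multiplicity p (order G))"

definition w_supersoluble :: "('a, 'b) monoid_scheme \<Rightarrow> bool" where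
  "w_supersoluble G \<longleftrightarrow> (\<forall>H. sylow_subgroup H G \<longrightarrow> P_subnormal H G)"

end

theory Submission
  imports Defs "HOL-Number_Theory.Residues"
begin

text \<open>The crux is that \<open>N <#> P\<close> is normal. In the permuteral case a complement
  to work with comes from x itself: a power of x generates a cyclic group with all its primes below
  p. If z in it has prime order q, an element u of the other factor that conjugates z to a power of
  z must centralise z, because the automorphisms of a group of order q number q - 1, and all primes
  of the other factor exceed q. This makes the transfer nontrivial on z. In the subnormal case a
  conjugate of P meets the lower group of a step in index at most s < p; this index is a power of p,
  so it is 1. For an overgroup U of P the Frattini argument gives U = (N \<inter> U) P N_U(P). The
  factor N \<inter> U has order prime to p, so it has a P-invariant Sylow r-subgroup for each prime
  r, and these decide whether a subgroup contains it. In the converse, strong permuterality is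
  applied to overgroups S P of P with S normalised by P. The part of the chain above N_p P, where P
  is already absorbed, comes from the same construction with the trivial group instead of P.\<close>

text \<open>
  Both conditions give normal Hall subgroups $N_m$ for the primes larger than $m$, for every $m$.
  Given $N = N_p$ and a Sylow $p$-subgroup $P$, one has to see that $NP$ is normal.
  If $P$ is $\mathbb{P}$-subnormal, walk up the chain from $P$ to $G$: above $NP$ the indices are primes
  $s < p$, so all conjugates of $P$ stay in the lower group. If $P$ is permuteral, then for each $x$ permuting with $P$
  the group $\langle x\rangle P$ is the product of a part with primes at least $p$ and a cyclic group with
  smaller primes, and the transfer into the cyclic factor shows that the former is normal.

  The rest is local. Let $R$ be a $P$-invariant $r$-subgroup, $r > p$. If $P$ is $\mathbb{P}$-subnormal,
  $R$ has a chain of $P$-invariant subgroups of index $r$, and a fixed point count gives a $P$-invariant cyclic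
  subgroup outside each member but the last, so the permutizer contains $R$; a Frattini argument does
  the rest. Conversely, elements permuting with $P$ produce such cyclic subgroups, which build a
  $P$-invariant chain in $R$, and these chains concatenate along the $N_m P$.
\<close>

subsection \<open>Products and normalisers of subgroups\<close>

locale finite_group = group +
  assumes finite_carrier: "finite (carrier G)"
begin

text \<open>An inclusion suffices, since conjugation is injective and all subgroups are finite (see
  \<open>normalizes_inv\<close>). \<open>A\<close> may be any set, so
  \<open>normalizes {x} H\<close> expresses that a single element normalises
  \<open>H\<close>.\<close>

definition normalizes :: "'a set \<Rightarrow> 'a set \<Rightarrow> bool" where
  "normalizes A H \<longleftrightarrow> (\<forall>a\<in>A. \<forall>h\<in>H. a \<otimes> h \<otimes> inv a \<in> H)"

lemma subgroup_finite: "subgroup H G \<Longrightarrow> finite H"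
  using finite_carrier finite_subset subgroup.subset by blast

lemma subgroup_card_pos: "subgroup H G \<Longrightarrow> card H > 0"
  using finite_carrier subgroup.finite_imp_card_positive by blast

lemma subgroup_card_dvd:
  assumes "subgroup H G" "subgroup K G" "H \<subseteq> K"
  shows "card H dvd card K"
proof -
  interpret K: group "G\<lparr>carrier := K\<rparr>"
    by (rule subgroup_imp_group[OF assms(2)])
  have "subgroup H (G\<lparr>carrier := K\<rparr>)" by (rule subgroup_incl[OF assms])
  from K.lagrange[OF this] show ?thesis unfolding order_def by simp (metis dvd_triv_right)
qed

lemma subgroup_card_dvd_order: "subgroup H G \<Longrightarrow> card H dvd order G"
  using subgroup_card_dvd[OF _ subgroup_self] subgroup.subset unfolding order_def by blast

lemma subgroup_index_mult:
  assumes "subgroup H G" "subgroup K G" "H \<subseteq> K"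
  shows "subgroup_index G K H * card H = card K"
proof -
  interpret K: group "G\<lparr>carrier := K\<rparr>"
    by (rule subgroup_imp_group[OF assms(2)])
  have "subgroup H (G\<lparr>carrier := K\<rparr>)" by (rule subgroup_incl[OF assms])
  from K.lagrange[OF this] show ?thesis unfolding order_def subgroup_index_def by simp
qed

lemma set_multI: "h \<in> H \<Longrightarrow> k \<in> K \<Longrightarrow> h \<otimes> k \<in> H <#> K"
  unfolding set_mult_def by blast

lemma set_multE:
  assumes "x \<in> H <#> K" obtains h k where "h \<in> H" "k \<in> K" "x = h \<otimes> k"
  using assms unfolding set_mult_def by blast

lemma set_mult_mono: "H \<subseteq> H' \<Longrightarrow> K \<subseteq> K' \<Longrightarrow> H <#> K \<subseteq> H' <#> K'"
  unfolding set_mult_def by blast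

lemma subset_set_mult_left: "H \<subseteq> carrier G \<Longrightarrow> subgroup K G \<Longrightarrow> H \<subseteq> H <#> K"
  using set_multI[of _ H "\<one>" K] by (auto dest: subgroup.one_closed) (metis r_one subsetD subgroup.one_closed)

lemma subset_set_mult_right: "subgroup H G \<Longrightarrow> K \<subseteq> carrier G \<Longrightarrow> K \<subseteq> H <#> K"
  using set_multI[of "\<one>" H _ K] by (metis l_one subsetD subsetI subgroup.one_closed)

lemma set_mult_subset: "subgroup X G \<Longrightarrow> H \<subseteq> X \<Longrightarrow> K \<subseteq> X \<Longrightarrow> H <#> K \<subseteq> X"
  by (auto elim!: set_multE intro: subgroup.m_closed)

text \<open>Two pairs have the same product exactly if they are (h, k) and (h d, d^-1 k) for some d
  in the intersection. The count is also applied to products that are not known to be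
  subgroups.\<close>

lemma card_set_mult:
  assumes H: "subgroup H G" and K: "subgroup K G"
  shows "card (H <#> K) * card (H \<inter> K) = card H * card K"
proof -
  note hc = subgroup.mem_carrier[OF H] and kc = subgroup.mem_carrier[OF K]
  define f where "f = (\<lambda>(h, k). h \<otimes> k)"
  have fin: "finite (H \<times> K)" using subgroup_finite H K by simp
  have img: "f ` (H \<times> K) = H <#> K"
    unfolding f_def set_mult_def by auto
  have fib: "card {z \<in> H \<times> K. f z = y} = card (H \<inter> K)" if y: "y \<in> H <#> K" for y
  proof -
    obtain h k where hk: "h \<in> H" "k \<in> K" "y = h \<otimes> k" using y by (rule set_multE)
    have "bij_betw (\<lambda>d. (h \<otimes> d, inv d \<otimes> k)) (H \<inter> K) {z \<in> H \<times> K. f z = y}"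
    proof (rule bij_betwI[where g = "\<lambda>(a,b). inv h \<otimes> a"])
      show "(\<lambda>d. (h \<otimes> d, inv d \<otimes> k)) \<in> H \<inter> K \<rightarrow> {z \<in> H \<times> K. f z = y}"
      proof
        fix d assume d: "d \<in> H \<inter> K"
        have "h \<otimes> d \<otimes> (inv d \<otimes> k) = h \<otimes> k"
          using hk d hc kc by (metis IntE inv_closed inv_solve_left m_assoc m_closed)
        then show "(h \<otimes> d, inv d \<otimes> k) \<in> {z \<in> H \<times> K. f z = y}"
          using hk d H K by (auto simp: f_def subgroup.m_closed subgroup.m_inv_closed)
      qed
      show "(\<lambda>(a, b). inv h \<otimes> a) \<in> {z \<in> H \<times> K. f z = y} \<rightarrow> H \<inter> K"
      proof
        fix z assume "z \<in> {z \<in> H \<times> K. f z = y}"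
        then obtain a b where z: "z = (a, b)" "a \<in> H" "b \<in> K" "a \<otimes> b = h \<otimes> k"
          using hk unfolding f_def by auto
        have "inv h \<otimes> a = k \<otimes> inv b"
          using z hk hc kc by (metis inv_closed inv_solve_left inv_solve_right m_assoc m_closed)
        then show "(case z of (a, b) \<Rightarrow> inv h \<otimes> a) \<in> H \<inter> K"
          using z hk H K by (auto simp: subgroup.m_closed subgroup.m_inv_closed) 
             (metis subgroup.m_closed subgroup.m_inv_closed)
      qed
      show "(case (h \<otimes> d, inv d \<otimes> k) of (a, b) \<Rightarrow> inv h \<otimes> a) = d" if "d \<in> H \<inter> K" for d
        using that hk hc by (simp add: m_assoc[symmetric])
      fix z assume "z \<in> {z \<in> H \<times> K. f z = y}"
      then obtain a b where z: "z = (a, b)" "a \<in> H" "b \<in> K" "a \<otimes> b = h \<otimes> k"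
        using hk unfolding f_def by auto
      have "inv (inv h \<otimes> a) \<otimes> k = inv a \<otimes> (h \<otimes> k)"
        using z hk hc kc by (simp add: inv_mult_group m_assoc)
      also have "\<dots> = b" using z hc kc hk by (metis inv_solve_left m_closed)
      finally have "inv (inv h \<otimes> a) \<otimes> k = b" .
      moreover have "h \<otimes> (inv h \<otimes> a) = a" using z hk hc by (simp add: m_assoc[symmetric])
      ultimately show "(\<lambda>d. (h \<otimes> d, inv d \<otimes> k)) (case z of (a, b) \<Rightarrow> inv h \<otimes> a) = z"
        using z by simp
    qed
    then show ?thesis by (simp add: bij_betw_same_card)
  qed
  have "card H * card K = (\<Sum>z\<in>H \<times> K. 1)" by (simp add: card_cartesian_product)
  also have "\<dots> = (\<Sum>y\<in>f ` (H \<times> K). \<Sum>z\<in>{z \<in> H \<times> K. f z = y}. 1)"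
    by (rule sum.image_gen[OF fin])
  also have "\<dots> = (\<Sum>y\<in>H <#> K. card {z \<in> H \<times> K. f z = y})" unfolding img by simp
  also have "\<dots> = (\<Sum>y\<in>H <#> K. card (H \<inter> K))" using fib by (rule sum.cong[OF refl])
  finally show ?thesis by simp
qed

lemma set_mult_subgroup_if_commute:
  assumes H: "subgroup H G" and K: "subgroup K G" and eq: "H <#> K = K <#> H"
  shows "subgroup (H <#> K) G"
proof (rule subgroupI)
  note hc = subgroup.mem_carrier[OF H] and kc = subgroup.mem_carrier[OF K]
  show "H <#> K \<subseteq> carrier G" using H K by (simp add: set_mult_subset subgroup.subset subgroup_self)
  show "H <#> K \<noteq> {}" using H K set_multI subgroup.one_closed by blast
  show "inv a \<in> H <#> K" if "a \<in> H <#> K" for a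
  proof -
    obtain h k where *: "h \<in> H" "k \<in> K" "a = h \<otimes> k" using \<open>a \<in> _\<close> by (rule set_multE)
    then have "inv a = inv k \<otimes> inv h" using hc kc by (simp add: inv_mult_group)
    then show ?thesis unfolding eq using * H K by (simp add: set_multI subgroup.m_inv_closed)
  qed
  show "a \<otimes> b \<in> H <#> K" if a: "a \<in> H <#> K" and b: "b \<in> H <#> K" for a b
  proof -
    obtain h k where *: "h \<in> H" "k \<in> K" "a = h \<otimes> k" using a by (rule set_multE)
    obtain h' k' where **: "h' \<in> H" "k' \<in> K" "b = h' \<otimes> k'" using b by (rule set_multE)
    have "k \<otimes> h' \<in> H <#> K" unfolding eq using * ** by (simp add: set_multI)
    then obtain h'' k'' where 3: "h'' \<in> H" "k'' \<in> K" "k \<otimes> h' = h'' \<otimes> k''" by (rule set_multE)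
    have "a \<otimes> b = h \<otimes> (k \<otimes> h') \<otimes> k'" using * ** hc kc by (simp add: m_assoc)
    also have "\<dots> = (h \<otimes> h'') \<otimes> (k'' \<otimes> k')" unfolding 3 using * ** 3 hc kc by (simp add: m_assoc)
    finally show ?thesis using * ** 3 H K by (simp add: set_multI subgroup.m_closed)
  qed
qed

lemma normalizes_commute:
  assumes H: "subgroup H G" and K: "subgroup K G" and n: "normalizes K H"
  shows "H <#> K = K <#> H"
proof
  note hc = subgroup.mem_carrier[OF H] and kc = subgroup.mem_carrier[OF K]
  show "H <#> K \<subseteq> K <#> H"
  proof
    fix x assume "x \<in> H <#> K"
    then obtain h k where *: "h \<in> H" "k \<in> K" "x = h \<otimes> k" by (rule set_multE)
    have "inv k \<in> K" using * K by (simp add: subgroup.m_inv_closed)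
    then have "inv k \<otimes> h \<otimes> k \<in> H" using n * unfolding normalizes_def
      by (metis inv_inv kc)
    moreover have "x = k \<otimes> (inv k \<otimes> h \<otimes> k)" using * hc kc by (simp add: m_assoc[symmetric])
    ultimately show "x \<in> K <#> H" using *(2) set_multI by metis
  qed
  show "K <#> H \<subseteq> H <#> K"
  proof
    fix x assume "x \<in> K <#> H"
    then obtain k h where *: "k \<in> K" "h \<in> H" "x = k \<otimes> h" by (rule set_multE)
    then have "k \<otimes> h \<otimes> inv k \<in> H" using n unfolding normalizes_def by blast
    moreover have "x = (k \<otimes> h \<otimes> inv k) \<otimes> k" using * hc kc by (simp add: m_assoc)
    ultimately show "x \<in> H <#> K" using *(1) set_multI by metis
  qed
qed

lemma set_mult_subgroup:
  "subgroup H G \<Longrightarrow> subgroup K G \<Longrightarrow> normalizes K H \<Longrightarrow> subgroup (H <#> K) G"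
  by (rule set_mult_subgroup_if_commute[OF _ _ normalizes_commute])

lemma dedekind_law:
  assumes "subgroup X G" "subgroup H G" "K \<subseteq> X"
  shows "(H <#> K) \<inter> X = (H \<inter> X) <#> K"
proof
  note xc = subgroup.mem_carrier[OF assms(1)] and hc = subgroup.mem_carrier[OF assms(2)]
  show "(H <#> K) \<inter> X \<subseteq> (H \<inter> X) <#> K"
  proof
    fix x assume x: "x \<in> (H <#> K) \<inter> X"
    then obtain h k where *: "h \<in> H" "k \<in> K" "x = h \<otimes> k" by (auto elim: set_multE)
    have kX: "k \<in> X" using * assms(3) by blast
    have "h = x \<otimes> inv k" using * hc xc kX by (simp add: m_assoc)
    then have "h \<in> X" using x kX assms(1) by (simp add: subgroup.m_closed subgroup.m_inv_closed)
    then show "x \<in> (H \<inter> X) <#> K" using * set_multI by blast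
  qed
  show "(H \<inter> X) <#> K \<subseteq> (H <#> K) \<inter> X"
    using assms by (auto elim!: set_multE simp: set_multI intro: subgroup.m_closed)
qed

text \<open>Conjugation by x maps the finite set H injectively into itself, hence onto
  itself.\<close>

lemma normalizes_inv:
  assumes "subgroup H G" "x \<in> carrier G" "normalizes {x} H" "h \<in> H"
  shows "inv x \<otimes> h \<otimes> x \<in> H"
proof -
  note hc = subgroup.mem_carrier[OF assms(1)]
  have sub: "(\<lambda>h. x \<otimes> h \<otimes> inv x) ` H \<subseteq> H"
    using assms(3) unfolding normalizes_def by auto
  have "inj_on (\<lambda>h. x \<otimes> h \<otimes> inv x) H"
    by (rule inj_onI) (use hc assms(2) in \<open>simp add: m_assoc\<close>)
  then have "(\<lambda>h. x \<otimes> h \<otimes> inv x) ` H = H"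
    using sub subgroup_finite[OF assms(1)] by (simp add: endo_inj_surj)
  then obtain h' where "h' \<in> H" "h = x \<otimes> h' \<otimes> inv x" using assms(4) by blast
  then have "inv x \<otimes> h \<otimes> x = h'" using assms(2) hc
    by (simp add: m_assoc) (simp add: m_assoc[symmetric])
  then show ?thesis using \<open>h' \<in> H\<close> by simp
qed

lemma subgroup_normalizer_in:
  assumes "subgroup H G" "subgroup U G"
  shows "subgroup {x \<in> U. normalizes {x} H} G"
proof (rule subgroupI)
  note hc = subgroup.mem_carrier[OF assms(1)] and uc = subgroup.mem_carrier[OF assms(2)]
  show "{x \<in> U. normalizes {x} H} \<subseteq> carrier G" using uc by auto
  show "{x \<in> U. normalizes {x} H} \<noteq> {}"
    using assms(2) hc by (auto simp: normalizes_def intro!: exI[of _ \<one>] subgroup.one_closed)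
  show "inv a \<in> {x \<in> U. normalizes {x} H}" if a: "a \<in> {x \<in> U. normalizes {x} H}" for a
    using a assms normalizes_inv[OF assms(1), of a] uc
    by (auto simp: normalizes_def subgroup.m_inv_closed)
  show "a \<otimes> b \<in> {x \<in> U. normalizes {x} H}"
    if a: "a \<in> {x \<in> U. normalizes {x} H}" and b: "b \<in> {x \<in> U. normalizes {x} H}" for a b
  proof -
    have "a \<otimes> b \<otimes> h \<otimes> inv (a \<otimes> b) = a \<otimes> (b \<otimes> h \<otimes> inv b) \<otimes> inv a" if "h \<in> H" for h
      using a b that uc hc by (simp add: inv_mult_group m_assoc)
    then show ?thesis using a b assms(2) unfolding normalizes_def
      by (auto simp: subgroup.m_closed)
  qed
qed

lemma conj_subgroup:
  assumes "subgroup H G" "x \<in> carrier G"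
  shows "subgroup ((\<lambda>h. x \<otimes> h \<otimes> inv x) ` H) G"
proof (rule subgroupI)
  note hc = subgroup.mem_carrier[OF assms(1)]
  show "(\<lambda>h. x \<otimes> h \<otimes> inv x) ` H \<subseteq> carrier G" using hc assms(2) by auto
  show "(\<lambda>h. x \<otimes> h \<otimes> inv x) ` H \<noteq> {}" using subgroup.one_closed[OF assms(1)] by blast
  show "inv a \<in> (\<lambda>h. x \<otimes> h \<otimes> inv x) ` H" if "a \<in> (\<lambda>h. x \<otimes> h \<otimes> inv x) ` H" for a
  proof -
    obtain h where h: "h \<in> H" "a = x \<otimes> h \<otimes> inv x" using \<open>a \<in> _\<close> by blast
    then have "inv a = x \<otimes> inv h \<otimes> inv x" using hc assms(2) by (simp add: inv_mult_group m_assoc)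
    then show ?thesis using h subgroup.m_inv_closed[OF assms(1)] by blast
  qed
  show "a \<otimes> b \<in> (\<lambda>h. x \<otimes> h \<otimes> inv x) ` H"
    if a: "a \<in> (\<lambda>h. x \<otimes> h \<otimes> inv x) ` H" and b: "b \<in> (\<lambda>h. x \<otimes> h \<otimes> inv x) ` H" for a b
  proof -
    obtain h where h: "h \<in> H" "a = x \<otimes> h \<otimes> inv x" using a by blast
    obtain h' where h': "h' \<in> H" "b = x \<otimes> h' \<otimes> inv x" using b by blast
    have "a \<otimes> b = x \<otimes> (h \<otimes> h') \<otimes> inv x" using h h' hc assms(2)
      by (simp add: m_assoc) (simp add: m_assoc[symmetric])
    then show ?thesis using h h' subgroup.m_closed[OF assms(1)] by blast
  qed
qed

lemma conj_card:
  assumes "H \<subseteq> carrier G" "x \<in> carrier G"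
  shows "card ((\<lambda>h. x \<otimes> h \<otimes> inv x) ` H) = card H"
  by (rule card_image, rule inj_onI) (use assms in \<open>auto simp: m_assoc subset_iff\<close>)

lemma sylow_in:
  assumes "subgroup U G" "prime (p::nat)" "p ^ n dvd card U"
  shows "\<exists>R. subgroup R G \<and> R \<subseteq> U \<and> card R = p ^ n"
proof -
  interpret U: group "G\<lparr>carrier := U\<rparr>" by (rule subgroup_imp_group[OF assms(1)])
  obtain m where "card U = p ^ n * m" using assms(3) by (auto elim: dvdE)
  then obtain R where R: "subgroup R (G\<lparr>carrier := U\<rparr>)" "card R = p ^ n"
    using sylow_thm[OF assms(2) U.group_axioms, of n m] subgroup_finite[OF assms(1)]
    unfolding order_def by auto
  then show ?thesis using incl_subgroup[OF assms(1) R(1)] subgroup.subset[OF R(1)] by auto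
qed

text \<open>T Q is a subgroup, and its index over T divides \<open>card Q\<close> as well as the
  index of T in W. This replaces an argument in the quotient W / T, which need not be a group: only
  Q is supposed to normalise T.\<close>

lemma coprime_index_subset:
  assumes Q: "subgroup Q G" and T: "subgroup T G" and W: "subgroup W G"
    and QW: "Q \<subseteq> W" and TW: "T \<subseteq> W" and n: "normalizes Q T"
    and cop: "coprime (card Q) (card W div card T)"
  shows "Q \<subseteq> T"
proof -
  have TQ: "subgroup (T <#> Q) G" using set_mult_subgroup[OF T Q n] .
  have TTQ: "T \<subseteq> T <#> Q" using subset_set_mult_left[OF subgroup.subset[OF T] Q] .
  obtain k where k: "card (T <#> Q) = card T * k"
    using subgroup_card_dvd[OF T TQ TTQ] by blast
  have Tpos: "card T > 0" using subgroup_card_pos[OF T] .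
  have "card (T <#> Q) dvd card W" by (rule subgroup_card_dvd[OF TQ W]) (simp add: set_mult_subset W QW TW)
  then have 1: "k dvd card W div card T"
    unfolding k using Tpos by (metis dvd_mult_imp_div mult.commute)
  have "card T * (k * card (T \<inter> Q)) = card T * card Q"
    using card_set_mult[OF T Q] unfolding k by (simp only: mult.assoc)
  then have "k * card (T \<inter> Q) = card Q" using Tpos by simp
  then have 2: "k dvd card Q" by (metis dvd_triv_left)
  have "k = 1" using 1 2 cop by (metis coprime_common_divisor_nat nat_dvd_1_iff_1 coprime_common_divisor)
  then have "T <#> Q = T" using TTQ k subgroup_finite[OF TQ] by (metis card_subset_eq mult.right_neutral)
  then show ?thesis using subset_set_mult_right[OF T subgroup.subset[OF Q]] by blast
qed

end

subsection \<open>Actions of p-groups and Sylow subgroups\<close>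

text \<open>Without a fixed point every orbit length would be a power of p other than 1, so p would
  divide \<open>card W\<close>. The action is an arbitrary function with laws restricted to
  \<open>P\<close> and \<open>W\<close>; it is later used on cosets and on pairs of a subgroup and a
  number.\<close>

lemma (in finite_group) p_group_fixed_point:
  fixes act :: "'a \<Rightarrow> 'c \<Rightarrow> 'c"
  assumes P: "subgroup P G" and pr: "prime (p::nat)" and cP: "card P = p ^ n"
    and fin: "finite W" and nd: "\<not> p dvd card W"
    and cl: "\<And>x w. x \<in> P \<Longrightarrow> w \<in> W \<Longrightarrow> act x w \<in> W"
    and one: "\<And>w. w \<in> W \<Longrightarrow> act \<one> w = w"
    and mul: "\<And>x y w. x \<in> P \<Longrightarrow> y \<in> P \<Longrightarrow> w \<in> W \<Longrightarrow> act (x \<otimes> y) w = act x (act y w)"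
  shows "\<exists>w\<in>W. \<forall>x\<in>P. act x w = w"
proof (rule ccontr)
  assume none: "\<not> ?thesis"
  note pc = subgroup.mem_carrier[OF P]
  define orb where "orb w = (\<lambda>x. act x w) ` P" for w
  have orbW: "orb w \<subseteq> W" if "w \<in> W" for w using that cl unfolding orb_def by auto
  have self: "w \<in> orb w" if "w \<in> W" for w
    unfolding orb_def using one[OF that] subgroup.one_closed[OF P] by (metis image_eqI)
  have sub: "orb v \<subseteq> orb w" if "w \<in> W" "v \<in> orb w" for v w
    using that mul subgroup.m_closed[OF P] unfolding orb_def by (auto simp: image_iff) metis
  have inv: "w \<in> orb v" if w: "w \<in> W" and v: "v \<in> orb w" for v w
  proof -
    obtain x where x: "x \<in> P" "v = act x w" using v unfolding orb_def by auto
    have "act (inv x) v = act (inv x \<otimes> x) w" using x w mul subgroup.m_inv_closed[OF P] by simp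
    also have "\<dots> = w" using x pc one[OF w] by simp
    finally show ?thesis unfolding orb_def using x subgroup.m_inv_closed[OF P] by (metis image_eqI)
  qed
  have dvd: "p dvd card (orb w)" if w: "w \<in> W" for w
  proof -
    define S where "S = {x \<in> P. act x w = w}"
    \<comment> \<open>The fibres of x |-> act x w are the left cosets of the stabiliser S, so the
      orbit length divides \<open>card P\<close>.\<close>
    have fib: "card {x \<in> P. act x w = v} = card S" if v: "v \<in> orb w" for v
    proof -
      obtain x where x: "x \<in> P" "v = act x w" using v unfolding orb_def by auto
      have "bij_betw (\<lambda>s. x \<otimes> s) S {y \<in> P. act y w = v}"
      proof (rule bij_betwI[where g = "\<lambda>y. inv x \<otimes> y"])
        show "(\<lambda>s. x \<otimes> s) \<in> S \<rightarrow> {y \<in> P. act y w = v}"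
          using x mul[OF _ _ w] subgroup.m_closed[OF P] unfolding S_def by auto
        show "(\<lambda>y. inv x \<otimes> y) \<in> {y \<in> P. act y w = v} \<rightarrow> S"
        proof
          fix y assume y: "y \<in> {y \<in> P. act y w = v}"
          have ix: "inv x \<in> P" using x P by (simp add: subgroup.m_inv_closed)
          have "act (inv x \<otimes> y) w = act (inv x) (act x w)" using y x ix mul[OF _ _ w] by simp
          also have "\<dots> = act (inv x \<otimes> x) w" using x ix mul[OF _ _ w] by simp
          also have "\<dots> = w" using x pc one[OF w] by simp
          finally show "inv x \<otimes> y \<in> S" using y ix subgroup.m_closed[OF P] unfolding S_def by simp
        qed
      qed (use x pc in \<open>auto simp: S_def m_assoc[symmetric]\<close>)
      then show ?thesis by (simp add: bij_betw_same_card)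
    qed
    have "card P = (\<Sum>v\<in>orb w. \<Sum>x\<in>{x \<in> P. act x w = v}. 1)"
      unfolding orb_def card_eq_sum by (rule sum.image_gen[OF subgroup_finite[OF P]])
    also have "\<dots> = (\<Sum>v\<in>orb w. card S)" using fib by (intro sum.cong) auto
    finally have "card (orb w) dvd p ^ n" using cP by simp
    moreover have "card (orb w) \<noteq> 1"
    proof
      assume "card (orb w) = 1"
      then have "orb w = {w}" using self[OF w] by (metis card_1_singletonE singletonD)
      then have "\<forall>x\<in>P. act x w = w" unfolding orb_def by auto
      then show False using none w by blast
    qed
    ultimately show ?thesis using pr
      by (metis divides_primepow_nat dvd_power nat_neq_iff not_gr_zero power_0)
  qed
  have U: "\<Union>(orb ` W) = W" using self orbW by blast
  have "p dvd card (\<Union>(orb ` W))"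
  proof (rule dvd_partition)
    show "finite (\<Union>(orb ` W))" using U fin by simp
    show "\<forall>c\<in>orb ` W. p dvd card c" using dvd by blast
    show "\<forall>c1\<in>orb ` W. \<forall>c2\<in>orb ` W. c1 \<noteq> c2 \<longrightarrow> c1 \<inter> c2 = {}"
    proof (intro ballI impI; rule ccontr)
      fix c1 c2 assume c: "c1 \<in> orb ` W" "c2 \<in> orb ` W" "c1 \<noteq> c2" "c1 \<inter> c2 \<noteq> {}"
      then obtain v w z where *: "v \<in> W" "w \<in> W" "c1 = orb v" "c2 = orb w" "z \<in> orb v" "z \<in> orb w" by blast
      have "z \<in> W" using * orbW by blast
      have "orb z = orb v" using sub[OF *(1) *(5)] sub[OF \<open>z \<in> W\<close> inv[OF *(1) *(5)]] by blast
      moreover have "orb z = orb w" using sub[OF *(2) *(6)] sub[OF \<open>z \<in> W\<close> inv[OF *(2) *(6)]] by blast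
      ultimately show False using c * by simp
    qed
  qed
  then show False using nd U by simp
qed

context finite_group
begin

lemma coprime_Int_trivial:
  assumes "subgroup H G" "subgroup K G" "coprime (card H) (card K)"
  shows "H \<inter> K = {\<one>}"
proof -
  have HK: "subgroup (H \<inter> K) G" using assms subgroups_Inter_pair by blast
  have "card (H \<inter> K) dvd card H" "card (H \<inter> K) dvd card K"
    using subgroup_card_dvd[OF HK assms(1)] subgroup_card_dvd[OF HK assms(2)] by auto
  then have "card (H \<inter> K) = 1" using assms(3) by (metis coprime_common_divisor nat_dvd_1_iff_1)
  then show ?thesis using subgroup.one_closed[OF HK] by (metis card_1_singletonE singletonD)
qed

lemma card_set_mult_coprime:
  assumes "subgroup H G" "subgroup K G" "coprime (card H) (card K)"
  shows "card (H <#> K) = card H * card K"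
  using card_set_mult[OF assms(1,2)] coprime_Int_trivial[OF assms] by simp

lemma card_left_cosets:
  assumes T: "subgroup T G" and P: "subgroup P G" and PT: "P \<subseteq> T"
  shows "card ((\<lambda>g. g <# P) ` T) = card T div card P" and "\<Union>((\<lambda>g. g <# P) ` T) = T"
proof -
  note tc = subgroup.mem_carrier[OF T] and Pc = subgroup.subset[OF P]
  define W where "W = (\<lambda>g. g <# P) ` T"
  have fT: "finite T" using subgroup_finite[OF T] .
  have self: "g \<in> g <# P" if "g \<in> T" for g
    using that tc subgroup.one_closed[OF P] unfolding l_coset_def by force
  have sub: "g <# P \<subseteq> T" if "g \<in> T" for g
    using that PT subgroup.m_closed[OF T] unfolding l_coset_def by auto
  have U: "\<Union>W = T" using self sub unfolding W_def by blast
  have "card P * card W = card (\<Union>W)"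
  proof (rule card_partition)
    show "finite W" unfolding W_def using fT by simp
    show "finite (\<Union>W)" using U fT by simp
    show "card c = card P" if c: "c \<in> W" for c
    proof -
      obtain g where g: "g \<in> T" "c = g <# P" using c unfolding W_def by blast
      have "c = (\<lambda>h. g \<otimes> h) ` P" unfolding g l_coset_def by auto
      moreover have "inj_on (\<lambda>h. g \<otimes> h) P"
        by (rule inj_onI) (use g tc Pc in \<open>auto simp: subset_iff\<close>)
      ultimately show ?thesis by (simp add: card_image)
    qed
    show "c1 \<inter> c2 = {}" if c: "c1 \<in> W" "c2 \<in> W" "c1 \<noteq> c2" for c1 c2
    proof (rule ccontr)
      assume "c1 \<inter> c2 \<noteq> {}"
      then obtain z where z: "z \<in> c1" "z \<in> c2" by blast
      obtain g where g: "g \<in> T" "c1 = g <# P" using c unfolding W_def by blast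
      obtain g' where g': "g' \<in> T" "c2 = g' <# P" using c unfolding W_def by blast
      have "c1 = z <# P" unfolding g(2)
        by (rule l_repr_independence[OF _ _ P]) (use z g tc in auto)
      moreover have "c2 = z <# P" unfolding g'(2)
        by (rule l_repr_independence[OF _ _ P]) (use z g' tc in auto)
      ultimately show False using c by simp
    qed
  qed
  then show "card ((\<lambda>g. g <# P) ` T) = card T div card P" using U subgroup_card_pos[OF P]
    unfolding W_def by (metis nonzero_mult_div_cancel_left not_gr_zero)
  show "\<Union>((\<lambda>g. g <# P) ` T) = T" using U unfolding W_def .
qed

lemma left_coset_self: "subgroup P G \<Longrightarrow> g \<in> carrier G \<Longrightarrow> g \<in> g <# P"
  using subgroup.one_closed unfolding l_coset_def by force

text \<open>Q acts by left multiplication on the left cosets of P in T. Their number is prime to p,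
  and a fixed coset g P gives Q inside g P g^-1.\<close>

lemma sylow_conjugate:
  assumes T: "subgroup T G" and P: "subgroup P G" and Q: "subgroup Q G"
    and PT: "P \<subseteq> T" and QT: "Q \<subseteq> T"
    and pr: "prime (p::nat)" and cQ: "card Q = p ^ k" and nd: "\<not> p dvd card T div card P"
  shows "\<exists>g\<in>T. Q \<subseteq> (\<lambda>h. g \<otimes> h \<otimes> inv g) ` P"
proof -
  note tc = subgroup.mem_carrier[OF T] and Pc = subgroup.subset[OF P]
  define W where "W = (\<lambda>g. g <# P) ` T"
  have fT: "finite T" by (rule subgroup_finite[OF T])
  have self: "g \<in> g <# P" if "g \<in> T" for g using that tc left_coset_self[OF P] by blast
  have U: "\<Union>W = T" and "card W = card T div card P" using card_left_cosets[OF T P PT] unfolding W_def by auto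
  then have nW: "\<not> p dvd card W" using nd by simp
  have "\<exists>w\<in>W. \<forall>x\<in>Q. x <# w = w"
  proof (rule p_group_fixed_point[OF Q pr cQ _ nW])
    show "finite W" unfolding W_def using fT by simp
    show "x <# w \<in> W" if "x \<in> Q" "w \<in> W" for x w
      using that lcos_m_assoc[OF Pc] QT tc subgroup.m_closed[OF T] unfolding W_def by auto
    show "\<one> <# w = w" if "w \<in> W" for w
      by (rule lcos_mult_one) (use U tc that in blast)
    show "x \<otimes> y <# w = x <# (y <# w)" if "x \<in> Q" "y \<in> Q" "w \<in> W" for x y w
      by (rule lcos_m_assoc[symmetric]) (use U tc that QT in blast)+
  qed
  then obtain g where g: "g \<in> T" "\<forall>x\<in>Q. x <# (g <# P) = g <# P" unfolding W_def by blast
  have "x \<in> (\<lambda>h. g \<otimes> h \<otimes> inv g) ` P" if x: "x \<in> Q" for x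
  proof -
    have xc: "x \<in> carrier G" using x QT tc by blast
    have "x \<otimes> g \<in> x <# (g <# P)" using self[OF g(1)] unfolding l_coset_def[of _ x] by blast
    then obtain h where h: "h \<in> P" "x \<otimes> g = g \<otimes> h" using g x unfolding l_coset_def by auto
    then have "x = g \<otimes> h \<otimes> inv g" using xc g tc Pc
      by (metis inv_solve_right m_closed subsetD)
    then show ?thesis using h by blast
  qed
  then show ?thesis using g by blast
qed

text \<open>For u in U the conjugate of P by u lies in T, hence inside the conjugate of P by some g
  in T; then g^-1 u normalises P.\<close>

lemma frattini_argument:
  assumes T: "subgroup T G" and U: "subgroup U G" and P: "subgroup P G"
    and PT: "P \<subseteq> T" and TU: "T \<subseteq> U" and n: "normalizes U T"
    and pr: "prime (p::nat)" and cP: "card P = p ^ k" and nd: "\<not> p dvd card T div card P"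
  shows "U = T <#> {x \<in> U. normalizes {x} P}"
proof
  note uc = subgroup.mem_carrier[OF U] and pc = subgroup.mem_carrier[OF P]
  show "T <#> {x \<in> U. normalizes {x} P} \<subseteq> U" using set_mult_subset[OF U TU] by auto
  show "U \<subseteq> T <#> {x \<in> U. normalizes {x} P}"
  proof
    fix u assume u: "u \<in> U"
    define Q where "Q = (\<lambda>h. u \<otimes> h \<otimes> inv u) ` P"
    have Q: "subgroup Q G" unfolding Q_def using conj_subgroup[OF P] uc u by blast
    have QT: "Q \<subseteq> T" using n u PT unfolding normalizes_def Q_def by blast
    have cQ: "card Q = p ^ k" unfolding Q_def using conj_card[OF subgroup.subset[OF P]] uc u cP by simp
    obtain g where g: "g \<in> T" "Q \<subseteq> (\<lambda>h. g \<otimes> h \<otimes> inv g) ` P"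
      using sylow_conjugate[OF T P Q PT QT pr cQ nd] by blast
    have gU: "g \<in> U" using g TU by blast
    have ig: "inv g \<otimes> u \<in> U" using gU u U by (simp add: subgroup.m_closed subgroup.m_inv_closed)
    have "normalizes {inv g \<otimes> u} P" unfolding normalizes_def
    proof clarify
      fix h assume h: "h \<in> P"
      have "u \<otimes> h \<otimes> inv u \<in> Q" unfolding Q_def using h by blast
      then obtain h' where h': "h' \<in> P" "u \<otimes> h \<otimes> inv u = g \<otimes> h' \<otimes> inv g" using g(2) by blast
      have "inv g \<otimes> u \<otimes> h \<otimes> inv (inv g \<otimes> u) = inv g \<otimes> (u \<otimes> h \<otimes> inv u) \<otimes> g"
        using u gU h uc pc by (simp add: inv_mult_group m_assoc)
      also have "\<dots> = h'" unfolding h' using gU h' uc pc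
        by (simp add: m_assoc) (simp add: m_assoc[symmetric])
      finally show "inv g \<otimes> u \<otimes> h \<otimes> inv (inv g \<otimes> u) \<in> P" using h' by simp
    qed
    moreover have "u = g \<otimes> (inv g \<otimes> u)" using u gU uc by (simp add: m_assoc[symmetric])
    ultimately show "u \<in> T <#> {x \<in> U. normalizes {x} P}" using g(1) ig
      by (metis (mono_tags, lifting) mem_Collect_eq set_multI)
  qed
qed

lemma not_dvd_div_sylow:
  fixes p n :: nat
  assumes "prime p" "n > 0"
  shows "\<not> p dvd n div p ^ multiplicity p n"
  using assms by (metis multiplicity_decompose not_gr_zero not_prime_unit)

text \<open>The Sylow subgroup R chosen first need not be P-invariant. By the Frattini argument its
  normaliser in K P has order divisible by \<open>card P\<close>, so it contains a subgroup P' of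
  this order, which is Sylow in K P. As P lies in a conjugate of P', the corresponding conjugate of
  R is normalised by P.\<close>

lemma invariant_sylow:
  assumes K: "subgroup K G" and P: "subgroup P G" and pr: "prime (p::nat)" and cP: "card P = p ^ n"
    and nPK: "normalizes P K" and nd: "\<not> p dvd card K" and r: "prime (r::nat)"
  shows "\<exists>R. subgroup R G \<and> R \<subseteq> K \<and> card R = r ^ multiplicity r (card K) \<and> normalizes P R"
proof -
  note kc = subgroup.mem_carrier[OF K] and pc = subgroup.mem_carrier[OF P]
  define W where "W = K <#> P"
  have W: "subgroup W G" unfolding W_def by (rule set_mult_subgroup[OF K P nPK])
  note wc = subgroup.mem_carrier[OF W]
  have KW: "K \<subseteq> W" unfolding W_def by (rule subset_set_mult_left[OF subgroup.subset[OF K] P])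
  have PW: "P \<subseteq> W" unfolding W_def by (rule subset_set_mult_right[OF K subgroup.subset[OF P]])
  have cop: "coprime (card K) (card P)"
    using nd pr cP by (simp add: prime_imp_coprime coprime_commute)
  have cW: "card W = card K * card P" unfolding W_def by (rule card_set_mult_coprime[OF K P cop])
  have nK: "normalizes W K" unfolding normalizes_def W_def
  proof clarify
    fix a h assume "a \<in> K <#> P" and h: "h \<in> K"
    then obtain k x where a: "k \<in> K" "x \<in> P" "a = k \<otimes> x" by (auto elim: set_multE)
    have 1: "x \<otimes> h \<otimes> inv x \<in> K" using nPK a h unfolding normalizes_def by blast
    have "a \<otimes> h \<otimes> inv a = k \<otimes> (x \<otimes> h \<otimes> inv x) \<otimes> inv k"
      using a h kc pc by (simp add: inv_mult_group m_assoc)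
    then show "a \<otimes> h \<otimes> inv a \<in> K" using 1 a K by (simp add: subgroup.m_closed subgroup.m_inv_closed)
  qed
  obtain R where R: "subgroup R G" "R \<subseteq> K" "card R = r ^ multiplicity r (card K)"
    using sylow_in[OF K r multiplicity_dvd] by blast
  define N where "N = {x \<in> W. normalizes {x} R}"
  have N: "subgroup N G" unfolding N_def by (rule subgroup_normalizer_in[OF R(1) W])
  have WKN: "W = K <#> N" unfolding N_def
    by (rule frattini_argument[OF K W R(1,2) KW nK r R(3)])
       (simp add: R(3) not_dvd_div_sylow[OF r subgroup_card_pos[OF K]])
  have "card K * card N = card K * (card P * card (K \<inter> N))"
    using card_set_mult[OF K N] cW WKN by (simp only: mult.assoc)
  then have "card N = card P * card (K \<inter> N)" using subgroup_card_pos[OF K] by simp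
  then have "p ^ n dvd card N" using cP by simp
  then obtain P' where P': "subgroup P' G" "P' \<subseteq> N" "card P' = p ^ n"
    using sylow_in[OF N pr] by blast
  have P'W: "P' \<subseteq> W" using P' unfolding N_def by blast
  have "\<not> p dvd card W div card P'" using cW P' cP nd pr by (simp add: prime_gt_0_nat)
  then obtain g where g: "g \<in> W" "P \<subseteq> (\<lambda>h. g \<otimes> h \<otimes> inv g) ` P'"
    using sylow_conjugate[OF W P'(1) P P'W PW pr cP] by blast
  have gc: "g \<in> carrier G" using g wc by blast
  have rc: "x \<in> carrier G" if "x \<in> R" for x using that R kc by blast
  define R' where "R' = (\<lambda>h. g \<otimes> h \<otimes> inv g) ` R"
  have "subgroup R' G" unfolding R'_def by (rule conj_subgroup[OF R(1) gc])
  moreover have "R' \<subseteq> K" unfolding R'_def using nK g(1) R(2) unfolding normalizes_def by blast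
  moreover have "card R' = r ^ multiplicity r (card K)"
    unfolding R'_def using conj_card[OF subgroup.subset[OF R(1)] gc] R(3) by simp
  moreover have "normalizes P R'" unfolding normalizes_def
  proof clarify
    fix a h assume a: "a \<in> P" and "h \<in> R'"
    then obtain h0 where h0: "h0 \<in> R" "h = g \<otimes> h0 \<otimes> inv g" unfolding R'_def by blast
    obtain b where b: "b \<in> P'" "a = g \<otimes> b \<otimes> inv g" using a g(2) by blast
    have bN: "b \<in> N" using b P' by blast
    have bc: "b \<in> carrier G" using b P'W wc by blast
    have "b \<otimes> h0 \<otimes> inv b \<in> R" using bN h0 unfolding N_def normalizes_def by blast
    moreover have "a \<otimes> h \<otimes> inv a = g \<otimes> (b \<otimes> h0 \<otimes> inv b) \<otimes> inv g"
      unfolding b h0 using bc gc rc[OF h0(1)]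
      by (simp add: inv_mult_group m_assoc) (simp add: m_assoc[symmetric])
    ultimately show "a \<otimes> h \<otimes> inv a \<in> R'" unfolding R'_def by blast
  qed
  ultimately show ?thesis by blast
qed

end

subsection \<open>Transfer into an abelian complement\<close>

locale abelian_complement = finite_group +
  fixes T A
  assumes T: "subgroup T G" and A: "subgroup A G"
    and comm: "\<And>x y. x \<in> A \<Longrightarrow> y \<in> A \<Longrightarrow> x \<otimes> y = y \<otimes> x"
    and TA: "T \<inter> A = {\<one>}" and X: "subgroup (T <#> A) G"
begin

lemmas tc = subgroup.mem_carrier[OF T] and ac = subgroup.mem_carrier[OF A]
  and xc = subgroup.mem_carrier[OF X]

lemma A_comm_group: "comm_group (G\<lparr>carrier := A\<rparr>)"
  by (rule group.group_comm_groupI[OF subgroup_imp_group[OF A]]) (simp add: comm)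

sublocale A: comm_group "G\<lparr>carrier := A\<rparr>" by (rule A_comm_group)

text \<open>T is a transversal of the left cosets of A in T A: \<open>compT g\<close> is the
  representative of the coset of g, and \<open>compA g\<close> the remaining factor in A. Outside T
  A the choice is unspecified.\<close>

definition compA :: "'a \<Rightarrow> 'a" where
  "compA g = (THE a. a \<in> A \<and> g \<otimes> inv a \<in> T)"

definition compT :: "'a \<Rightarrow> 'a" where
  "compT g = g \<otimes> inv (compA g)"

lemma compA_eq:
  assumes t: "t \<in> T" and a: "a \<in> A"
  shows "compA (t \<otimes> a) = a"
  unfolding compA_def
proof (rule the_equality)
  show "a \<in> A \<and> t \<otimes> a \<otimes> inv a \<in> T" using t a tc ac by (simp add: m_assoc)
next
  fix b assume b: "b \<in> A \<and> t \<otimes> a \<otimes> inv b \<in> T"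
  have "inv t \<otimes> (t \<otimes> a \<otimes> inv b) \<in> T" using b t T by (simp add: subgroup.m_closed subgroup.m_inv_closed)
  moreover have "inv t \<otimes> (t \<otimes> a \<otimes> inv b) = a \<otimes> inv b"
    using t a b tc ac by (simp add: m_assoc[symmetric])
  moreover have "a \<otimes> inv b \<in> A" using a b A by (simp add: subgroup.m_closed subgroup.m_inv_closed)
  ultimately have "a \<otimes> inv b = \<one>" using TA by auto
  then show "b = a" using a b ac by (metis inv_closed inv_equality inv_inv)
qed

lemma compT_eq: "t \<in> T \<Longrightarrow> a \<in> A \<Longrightarrow> compT (t \<otimes> a) = t"
  unfolding compT_def using tc ac by (simp add: compA_eq m_assoc)

lemma
  assumes "g \<in> T <#> A"
  shows compA_closed: "compA g \<in> A" and compT_closed: "compT g \<in> T"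
    and comp_decompose: "g = compT g \<otimes> compA g"
  using assms by (auto elim!: set_multE simp: compA_eq compT_eq)

lemma
  assumes "g \<in> T <#> A" "a \<in> A"
  shows compA_mult_right: "compA (g \<otimes> a) = compA g \<otimes> a"
    and compT_mult_right: "compT (g \<otimes> a) = compT g"
proof -
  obtain t b where *: "t \<in> T" "b \<in> A" "g = t \<otimes> b" using assms(1) by (rule set_multE)
  have "g \<otimes> a = t \<otimes> (b \<otimes> a)" "b \<otimes> a \<in> A" using * assms tc ac A by (simp_all add: m_assoc subgroup.m_closed)
  then show "compA (g \<otimes> a) = compA g \<otimes> a" "compT (g \<otimes> a) = compT g"
    using * by (simp_all add: compA_eq compT_eq)
qed

lemma T_subset: "T \<subseteq> T <#> A" using subset_set_mult_left[OF subgroup.subset[OF T] A] .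
lemma A_subset: "A \<subseteq> T <#> A" using subset_set_mult_right[OF T subgroup.subset[OF A]] .

lemma compA_T: "t \<in> T \<Longrightarrow> compA t = \<one>" and compT_T: "t \<in> T \<Longrightarrow> compT t = t"
  using compA_eq[of t \<one>] compT_eq[of t \<one>] subgroup.one_closed[OF A] tc by auto

lemma mult_T_closed: "x \<in> T <#> A \<Longrightarrow> u \<in> T \<Longrightarrow> x \<otimes> u \<in> T <#> A"
  using subgroup.m_closed[OF X] T_subset by blast

text \<open>If x u and x v have the same T-part, they differ by a right factor from A, so u^-1 v
  lies both in T and in A.\<close>

lemma compT_inj:
  assumes x: "x \<in> T <#> A"
  shows "inj_on (\<lambda>u. compT (x \<otimes> u)) T"
proof (rule inj_onI)
  fix u v assume uv: "u \<in> T" "v \<in> T" "compT (x \<otimes> u) = compT (x \<otimes> v)"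
  define w where "w = compT (x \<otimes> u)"
  define a where "a = compA (x \<otimes> u)"
  define b where "b = compA (x \<otimes> v)"
  have *: "w \<in> T" "a \<in> A" "b \<in> A" "x \<otimes> u = w \<otimes> a" "x \<otimes> v = w \<otimes> b"
    unfolding w_def a_def b_def using uv compT_closed compA_closed comp_decompose mult_T_closed[OF x] by metis+
  have "x \<otimes> v = x \<otimes> (u \<otimes> (inv a \<otimes> b))"
  proof -
    have "x \<otimes> (u \<otimes> (inv a \<otimes> b)) = (x \<otimes> u) \<otimes> (inv a \<otimes> b)"
      using xc[OF x] tc[OF uv(1)] ac[OF *(2)] ac[OF *(3)] by (intro m_assoc[symmetric]) auto
    also have "\<dots> = w \<otimes> b" unfolding *(4) using *(1-3) tc ac by (simp add: m_assoc) (simp add: m_assoc[symmetric])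
    finally show ?thesis using * by simp
  qed
  then have v: "v = u \<otimes> (inv a \<otimes> b)" using xc[OF x] uv tc * ac by simp
  then have "inv u \<otimes> v = inv a \<otimes> b" using uv tc * ac by (simp add: m_assoc[symmetric])
  moreover have "inv u \<otimes> v \<in> T" "inv a \<otimes> b \<in> A"
    using uv * T A by (simp_all add: subgroup.m_closed subgroup.m_inv_closed)
  ultimately have "inv a \<otimes> b = \<one>" using TA by auto
  then show "u = v" using v uv tc by simp
qed

lemma compT_image:
  assumes x: "x \<in> T <#> A"
  shows "(\<lambda>u. compT (x \<otimes> u)) ` T = T"
  using compT_inj[OF x] subgroup_finite[OF T] compT_closed mult_T_closed[OF x]
  by (intro endo_inj_surj) auto

text \<open>The classical transfer from T A to A, computed with the transversal T.\<close>

definition transfer :: "'a \<Rightarrow> 'a" where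
  "transfer x = finprod (G\<lparr>carrier := A\<rparr>) (\<lambda>u. compA (x \<otimes> u)) T"

lemma transfer_closed: "x \<in> T <#> A \<Longrightarrow> transfer x \<in> A"
  using A.finprod_closed[of "\<lambda>u. compA (x \<otimes> u)" T] compA_closed mult_T_closed
  unfolding transfer_def by (auto simp: Pi_def)

text \<open>In x y u, write y u as T-part times A-part; the A-part stays on the right and splits
  off. So left multiplication acts on T through \<open>compT\<close>, and \<open>compA\<close> is a
  cocycle for this action.\<close>

lemma
  assumes x: "x \<in> T <#> A" and y: "y \<in> T <#> A" and u: "u \<in> T"
  shows compA_cocycle: "compA (x \<otimes> y \<otimes> u) = compA (x \<otimes> compT (y \<otimes> u)) \<otimes> compA (y \<otimes> u)"
    and compT_cocycle: "compT (x \<otimes> y \<otimes> u) = compT (x \<otimes> compT (y \<otimes> u))"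
proof -
  have yu: "y \<otimes> u \<in> T <#> A" by (rule mult_T_closed[OF y u])
  have "x \<otimes> y \<otimes> u = x \<otimes> (y \<otimes> u)" using xc x y u tc by (simp add: m_assoc)
  also have "\<dots> = x \<otimes> (compT (y \<otimes> u) \<otimes> compA (y \<otimes> u))" using comp_decompose[OF yu] by simp
  also have "\<dots> = x \<otimes> compT (y \<otimes> u) \<otimes> compA (y \<otimes> u)"
    using xc[OF x] tc[OF compT_closed[OF yu]] ac[OF compA_closed[OF yu]] by (simp add: m_assoc)
  finally show "compA (x \<otimes> y \<otimes> u) = compA (x \<otimes> compT (y \<otimes> u)) \<otimes> compA (y \<otimes> u)"
    "compT (x \<otimes> y \<otimes> u) = compT (x \<otimes> compT (y \<otimes> u))"
    using compA_mult_right[OF mult_T_closed[OF x compT_closed[OF yu]] compA_closed[OF yu]]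
      compT_mult_right[OF mult_T_closed[OF x compT_closed[OF yu]] compA_closed[OF yu]] by simp_all
qed

text \<open>The cocycle identity is multiplied over T; in the first factor the product is reindexed
  by the permutation of T that y induces.\<close>

lemma transfer_mult:
  assumes x: "x \<in> T <#> A" and y: "y \<in> T <#> A"
  shows "transfer (x \<otimes> y) = transfer x \<otimes> transfer y"
proof -
  note 1 = compA_cocycle[OF x y]
  have cl: "(\<lambda>u. compA (z \<otimes> u)) \<in> T \<rightarrow> A" if "z \<in> T <#> A" for z
    using that compA_closed mult_T_closed by blast
  have "transfer (x \<otimes> y) = finprod (G\<lparr>carrier := A\<rparr>) (\<lambda>u. compA (x \<otimes> compT (y \<otimes> u)) \<otimes> compA (y \<otimes> u)) T"
    unfolding transfer_def
    by (rule A.finprod_cong') (use 1 compA_closed mult_T_closed x y compT_closed subgroup.m_closed[OF A] in \<open>auto simp: Pi_iff\<close>)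
  also have "\<dots> = finprod (G\<lparr>carrier := A\<rparr>) (\<lambda>u. compA (x \<otimes> compT (y \<otimes> u))) T \<otimes> transfer y"
    using A.finprod_multf[of "\<lambda>u. compA (x \<otimes> compT (y \<otimes> u))" T "\<lambda>u. compA (y \<otimes> u)"] cl[OF x] cl[OF y]
      compT_closed mult_T_closed[OF y] unfolding transfer_def by (simp add: Pi_iff)
  also have "finprod (G\<lparr>carrier := A\<rparr>) (\<lambda>u. compA (x \<otimes> compT (y \<otimes> u))) T = transfer x"
    using A.finprod_reindex[of "\<lambda>u. compA (x \<otimes> u)" "\<lambda>u. compT (y \<otimes> u)" T] compT_image[OF y] compT_inj[OF y] cl[OF x]
    unfolding transfer_def by simp
  finally show ?thesis .
qed

text \<open>The transversal is itself a subgroup: t u stays in T, so every factor is one.\<close>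

lemma transfer_T:
  assumes "t \<in> T" shows "transfer t = \<one>"
proof -
  have "transfer t = \<one>\<^bsub>G\<lparr>carrier := A\<rparr>\<^esub>"
    unfolding transfer_def
    by (rule A.finprod_one_eqI) (use assms subgroup.m_closed[OF T] in \<open>auto simp: compA_T\<close>)
  then show ?thesis by simp
qed

text \<open>z permutes T by u |-> \<open>compT (z \<otimes> u)\<close>. If no u^-1 z u with u in S
  falls into A, all orbits on S have length q, and along the orbit of u0 the factors telescope to
  the A-part of z^q u0 = u0, which is one. Orbits are split off one at a time.\<close>

lemma orbit_free_part:
  assumes q: "prime (q::nat)" and z: "z \<in> A" "z [^] q = \<one>"
  shows "S \<subseteq> T \<Longrightarrow> (\<And>u. u \<in> S \<Longrightarrow> compT (z \<otimes> u) \<in> S) \<Longrightarrow> (\<And>u. u \<in> S \<Longrightarrow> inv u \<otimes> z \<otimes> u \<notin> A)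
    \<Longrightarrow> finprod (G\<lparr>carrier := A\<rparr>) (\<lambda>u. compA (z \<otimes> u)) S = \<one> \<and> q dvd card S"
proof (induction "card S" arbitrary: S rule: less_induct)
  case less
  note ST = less.prems(1) and cl = less.prems(2) and free = less.prems(3)
  have finS: "finite S" using ST subgroup_finite[OF T] finite_subset by blast
  have zc: "z \<in> carrier G" using z ac by blast
  have zX: "z \<in> T <#> A" using z A_subset by blast
  have ziA: "z [^] i \<in> A" for i :: nat
    by (induction i) (use z A in \<open>auto simp: subgroup.m_closed subgroup.one_closed\<close>)
  have ziX: "z [^] i \<in> T <#> A" for i :: nat using ziA A_subset by blast
  have PiA: "(\<lambda>u. compA (z \<otimes> u)) \<in> V \<rightarrow> carrier (G\<lparr>carrier := A\<rparr>)" if "V \<subseteq> T" for V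
    using that compA_closed mult_T_closed[OF zX] by auto
  show ?case
  proof (cases "S = {}")
    case True then show ?thesis by simp
  next
    case False
    then obtain u0 where u0: "u0 \<in> S" by blast
    have u0T: "u0 \<in> T" using u0 ST by blast
    define w where "w i = compT (z [^] i \<otimes> u0)" for i :: nat
    have wT: "w i \<in> T" for i unfolding w_def by (rule compT_closed[OF mult_T_closed[OF ziX u0T]])
    have zSuc: "z [^] Suc i \<otimes> u0 = z \<otimes> z [^] i \<otimes> u0" for i :: nat
      using zc by (simp only: nat_pow_Suc2)
    have wSuc: "w (Suc i) = compT (z \<otimes> w i)" for i
      unfolding w_def zSuc by (rule compT_cocycle[OF zX ziX u0T])
    define b where "b i = compA (z [^] i \<otimes> u0)" for i :: nat
    have bA: "b i \<in> A" for i unfolding b_def by (rule compA_closed[OF mult_T_closed[OF ziX u0T]])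
    have ozi: "z [^] i \<otimes> u0 = w i \<otimes> b i" for i
      unfolding w_def b_def by (rule comp_decompose[OF mult_T_closed[OF ziX u0T]])
    have bSuc: "compA (z \<otimes> w i) \<otimes> b i = b (Suc i)" for i
      unfolding w_def b_def zSuc by (rule compA_cocycle[OF zX ziX u0T, symmetric])
    have czA: "compA (z \<otimes> w i) \<in> A" for i using compA_closed mult_T_closed[OF zX wT] by blast
    have w0: "w 0 = u0" unfolding w_def using u0T tc by (simp add: compT_T)
    have wq: "w q = u0" unfolding w_def using u0T tc z by (simp add: compT_T)
    have b0: "b 0 = \<one>" unfolding b_def using u0T tc by (simp add: compA_T)
    have bq: "b q = \<one>" unfolding b_def using u0T tc z by (simp add: compA_T)
    have wS: "w i \<in> S" for i by (induction i) (auto simp: w0 u0 wSuc cl)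
    \<comment> \<open>A repetition would put u0^-1 z^d u0 with d = j - i into A. As d is invertible
      modulo q, some power of this element is u0^-1 z u0, against the freeness of u0.\<close>
    have w_ne: "w i \<noteq> w j" if ij: "i < j" "j < q" for i j
    proof
      assume eq: "w i = w j"
      define d where "d = j - i"
      have d: "0 < d" "d < q" "j = i + d" using ij unfolding d_def by auto
      have "z [^] j = z [^] i \<otimes> z [^] d" unfolding d(3) by (rule nat_pow_mult[OF zc, symmetric])
      have c: "z [^] i \<in> carrier G" "z [^] d \<in> carrier G" "u0 \<in> carrier G" "b i \<in> carrier G" "b j \<in> carrier G" "w j \<in> carrier G"
        using ac ziA bA u0T wT tc by auto
      have "z [^] i \<otimes> (z [^] d \<otimes> u0) = w j \<otimes> b j"
        using ozi[of j] \<open>z [^] j = _\<close> c by (simp add: m_assoc)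
      also have "\<dots> = z [^] i \<otimes> u0 \<otimes> (inv (b i) \<otimes> b j)"
        unfolding ozi[of i] eq using c by (simp add: m_assoc) (simp add: m_assoc[symmetric])
      finally have "z [^] d \<otimes> u0 = u0 \<otimes> (inv (b i) \<otimes> b j)" using c by (simp add: m_assoc)
      then have "inv u0 \<otimes> z [^] d \<otimes> u0 = inv (b i) \<otimes> b j" using c by (simp add: m_assoc) (simp add: m_assoc[symmetric])
      then have conjA: "inv u0 \<otimes> z [^] d \<otimes> u0 \<in> A" using bA A by (simp add: subgroup.m_closed subgroup.m_inv_closed)
      have powA: "inv u0 \<otimes> (z [^] d) [^] k \<otimes> u0 \<in> A" for k :: nat
      proof (induction k)
        case 0 then show ?case using c A by (simp add: subgroup.one_closed)
      next
        case (Suc k)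
        have "(z [^] d) [^] k \<in> carrier G" using c by simp
        then have "inv u0 \<otimes> (z [^] d) [^] Suc k \<otimes> u0 = (inv u0 \<otimes> (z [^] d) [^] k \<otimes> u0) \<otimes> (inv u0 \<otimes> z [^] d \<otimes> u0)"
          using c by (simp add: m_assoc) (simp add: m_assoc[symmetric])
        then show ?case using Suc conjA A by (simp add: subgroup.m_closed)
      qed
      have "coprime d q" using q d by (metis coprime_commute nat_dvd_not_less prime_imp_coprime)
      then obtain k where "[d * k = 1] (mod q)" using cong_solve_coprime_nat unfolding One_nat_def by blast
      then have "d * k mod q = 1" using prime_gt_1_nat[OF q] by (simp add: cong_def)
      then have dk: "d * k = q * (d * k div q) + 1" by (metis mult_div_mod_eq)
      have "(z [^] d) [^] k = z [^] (q * (d * k div q) + 1)" using zc dk by (simp add: nat_pow_pow)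
      also have "\<dots> = (z [^] q) [^] (d * k div q) \<otimes> z" using zc by (simp add: nat_pow_pow)
      also have "\<dots> = z" using z zc by simp
      finally show False using powA[of k] free[OF u0] by simp
    qed
    have inj: "inj_on w {..<q}"
    proof (rule inj_onI)
      fix i j assume ij: "i \<in> {..<q}" "j \<in> {..<q}" "w i = w j"
      show "i = j" using ij w_ne[of i j] w_ne[of j i] by (cases i j rule: linorder_cases) auto
    qed
    define Orb where "Orb = w ` {..<q}"
    have OS: "Orb \<subseteq> S" unfolding Orb_def using wS by blast
    have cO: "card Orb = q" unfolding Orb_def using inj by (simp add: card_image)
    have qp: "q > 0" using prime_gt_0_nat[OF q] .
    have uO: "u0 \<in> Orb" unfolding Orb_def using w0 qp by (metis image_eqI lessThan_iff)
    have tel: "finprod (G\<lparr>carrier := A\<rparr>) (\<lambda>i. compA (z \<otimes> w i)) {..<n} = b n" for n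
    proof (induction n)
      case 0 then show ?case using b0 by simp
    next
      case (Suc n)
      then show ?case using A.finprod_insert[of "{..<n}" n "\<lambda>i. compA (z \<otimes> w i)"] czA bSuc
        by (simp add: lessThan_Suc Pi_iff)
    qed
    have pO: "finprod (G\<lparr>carrier := A\<rparr>) (\<lambda>u. compA (z \<otimes> u)) Orb = \<one>"
      unfolding Orb_def using A.finprod_reindex[of "\<lambda>u. compA (z \<otimes> u)" w "{..<q}"] inj tel[of q] bq czA
      by (auto simp: Pi_iff)
    have IH: "finprod (G\<lparr>carrier := A\<rparr>) (\<lambda>u. compA (z \<otimes> u)) (S - Orb) = \<one> \<and> q dvd card (S - Orb)"
    proof (rule less.hyps)
      show "card (S - Orb) < card S" using finS u0 uO by (intro psubset_card_mono) auto
      show "S - Orb \<subseteq> T" using ST by blast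
      show "inv u \<otimes> z \<otimes> u \<notin> A" if "u \<in> S - Orb" for u using that free by blast
      show "compT (z \<otimes> u) \<in> S - Orb" if u: "u \<in> S - Orb" for u
      proof -
        have "compT (z \<otimes> u) \<notin> Orb"
        proof
          assume "compT (z \<otimes> u) \<in> Orb"
          then obtain i where i: "i < q" "compT (z \<otimes> u) = w i" unfolding Orb_def by auto
          \<comment> \<open>Predecessors of orbit points are orbit points; the predecessor of w 0 is
            w (q - 1), because w q = w 0.\<close>
          obtain j where j: "j < q" "w i = w (Suc j)"
          proof (cases i)
            case 0
            then show ?thesis using that[of "q - 1"] qp w0 wq by simp
          next
            case (Suc k) then show ?thesis using that[of k] i by simp
          qed
          have "compT (z \<otimes> u) = compT (z \<otimes> w j)" using i j wSuc by simp
          then have "u = w j" using compT_inj[OF zX] u ST wT unfolding inj_on_def by blast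
          then show False using u j unfolding Orb_def by blast
        qed
        then show ?thesis using u cl by blast
      qed
    qed
    have S: "S = Orb \<union> (S - Orb)" using OS by blast
    have fO: "finite Orb" using OS finS finite_subset by blast
    have "finprod (G\<lparr>carrier := A\<rparr>) (\<lambda>u. compA (z \<otimes> u)) (Orb \<union> (S - Orb)) = \<one>"
      using A.finprod_Un_disjoint[of Orb "S - Orb" "\<lambda>u. compA (z \<otimes> u)"] PiA[of Orb] PiA[of "S - Orb"]
        ST OS fO finS pO IH by auto
    moreover have "card S = q + card (S - Orb)"
      using card_Un_disjoint[of Orb "S - Orb"] fO finS cO S by (metis Diff_disjoint finite_Diff)
    ultimately show ?thesis using S IH by simp
  qed
qed

text \<open>The factors with u^-1 z u in A are all equal to z, and the others cancel along orbits of
  length q. Hence the transfer of z is z to the power \<open>card F\<close>, and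
  \<open>card F\<close> is congruent to \<open>card T\<close> modulo q, so it is not divisible by
  q.\<close>

lemma transfer_prime_order:
  assumes q: "prime (q::nat)" and z: "z \<in> A" "z [^] q = \<one>" "z \<noteq> \<one>"
    and unique: "\<And>y. y \<in> A \<Longrightarrow> y [^] q = \<one> \<Longrightarrow> \<exists>k::nat. y = z [^] k"
    and large: "\<And>p. prime p \<Longrightarrow> p dvd card T \<Longrightarrow> q < p"
  shows "transfer z \<noteq> \<one>"
proof -
  have zc: "z \<in> carrier G" using z ac by blast
  have zX: "z \<in> T <#> A" using z A_subset by blast
  have cT: "card T > 0" by (rule subgroup_card_pos[OF T])
  have zpow: "z [^] i = z [^] j" if "[i = j] (mod q)" for i j :: nat
  proof -
    have "z [^] i = z [^] (i mod q)" for i :: nat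
    proof -
      have "z [^] i = z [^] (q * (i div q) + i mod q)" by simp
      also have "\<dots> = (z [^] q) [^] (i div q) \<otimes> z [^] (i mod q)"
        using zc by (simp only: nat_pow_pow nat_pow_mult[symmetric])
      also have "\<dots> = z [^] (i mod q)" using z zc by simp
      finally show ?thesis .
    qed
    then show ?thesis using that unfolding cong_def by metis
  qed
  have zord: "z [^] n \<noteq> \<one>" if "\<not> q dvd n" for n :: nat
  proof
    assume *: "z [^] n = \<one>"
    have "coprime n q" using that q by (metis coprime_commute prime_imp_coprime)
    then obtain k where "[n * k = 1] (mod q)" using cong_solve_coprime_nat unfolding One_nat_def by blast
    then have "z [^] (n * k) = z" using zpow[of "n * k" 1] zc by simp
    moreover have "z [^] (n * k) = \<one>" using * zc by (simp add: nat_pow_pow[symmetric])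
    ultimately show False using z by simp
  qed
  define F where "F = {u \<in> T. inv u \<otimes> z \<otimes> u \<in> A}"
  \<comment> \<open>Conjugation by u sends z to z^k. Both k^(card T) and k^(q - 1) are 1 modulo q,
    and the two exponents are coprime because primes dividing \<open>card T\<close> exceed q. So k
    is 1 modulo q, and u commutes with z.\<close>
  have Fz: "compA (z \<otimes> u) = z" if u: "u \<in> F" for u
  proof -
    have uT: "u \<in> T" "inv u \<otimes> z \<otimes> u \<in> A" using u unfolding F_def by auto
    have uc: "u \<in> carrier G" using uT tc by blast
    have pw: "(inv u \<otimes> y \<otimes> u) [^] n = inv u \<otimes> y [^] n \<otimes> u" if "y \<in> carrier G" for y and n :: nat
    proof (induction n)
      case 0 then show ?case using uc by simp
    next
      case (Suc n)
      have "y [^] n \<in> carrier G" using that by simp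
      then show ?case unfolding nat_pow_Suc Suc using uc that
        by (simp add: m_assoc) (simp add: m_assoc[symmetric])
    qed
    have "(inv u \<otimes> z \<otimes> u) [^] q = \<one>" using pw[OF zc] z uc by simp
    then obtain k :: nat where k: "inv u \<otimes> z \<otimes> u = z [^] k" using unique uT by blast
    have it: "inv (u [^] n) \<otimes> z \<otimes> u [^] n = z [^] (k ^ n)" for n :: nat
    proof (induction n)
      case 0 then show ?case using zc by simp
    next
      case (Suc n)
      have un: "u [^] n \<in> carrier G" using uc by simp
      have "inv (u [^] Suc n) \<otimes> z \<otimes> u [^] Suc n = inv u \<otimes> (inv (u [^] n) \<otimes> z \<otimes> u [^] n) \<otimes> u"
        using un uc zc by (simp add: inv_mult_group m_assoc)
      also have "\<dots> = inv u \<otimes> z [^] (k ^ n) \<otimes> u" using Suc by simp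
      also have "\<dots> = (z [^] k) [^] (k ^ n)" using pw[OF zc] k by simp
      also have "\<dots> = z [^] (k ^ Suc n)" using zc by (simp add: nat_pow_pow)
      finally show ?case .
    qed
    have "u [^] card T = \<one>"
    proof -
      interpret TT: group "G\<lparr>carrier := T\<rparr>" by (rule subgroup_imp_group[OF T])
      have "u [^]\<^bsub>G\<lparr>carrier := T\<rparr>\<^esub> order (G\<lparr>carrier := T\<rparr>) = \<one>\<^bsub>G\<lparr>carrier := T\<rparr>\<^esub>"
        by (rule TT.pow_order_eq_1) (use uT in simp)
      then show ?thesis by (simp add: order_def nat_pow_consistent[symmetric])
    qed
    then have kT: "z [^] (k ^ card T) = z" using it[of "card T"] zc by simp
    have k0: "\<not> q dvd k"
    proof
      assume "q dvd k"
      then have "[k ^ card T = 0] (mod q)" using cT q by (simp add: cong_0_iff prime_dvd_power_iff)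
      then have "z [^] (k ^ card T) = z [^] (0::nat)" by (rule zpow)
      then show False using kT z by simp
    qed
    obtain m where m: "k ^ card T = Suc m"
      using k0 by (metis dvd_0_right not0_implies_Suc power_eq_0_iff)
    have "z [^] m \<in> carrier G" using zc by simp
    moreover have "z [^] m \<otimes> z = z" using kT unfolding m by simp
    ultimately have "z [^] m = \<one>" using zc by simp
    then have "q dvd m" using zord by blast
    then have c1: "[k ^ card T = 1] (mod q)" unfolding m using cong_altdef_nat[of 1 "Suc m" q] by simp
    have c2: "[k ^ (q - 1) = 1] (mod q)" by (rule fermat_theorem[OF q k0])
    have "coprime (card T) (q - 1)"
    proof (rule ccontr)
      assume "\<not> ?thesis"
      then have "gcd (card T) (q - 1) \<noteq> 1" using coprime_iff_gcd_eq_1 by blast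
      then obtain p where p: "prime p" "p dvd gcd (card T) (q - 1)" using prime_factor_nat by blast
      then have "p \<le> q - 1" using prime_gt_1_nat[OF q] by (intro dvd_imp_le) auto
      then show False using p large[of p] prime_gt_1_nat[OF q] by auto
    qed
    then obtain x y where xy: "card T * x = (q - 1) * y + 1"
      using cT bezout_nat[of "card T" "q - 1"] unfolding coprime_iff_gcd_eq_1 by auto
    have "[(k ^ card T) ^ x = 1 ^ x] (mod q)" by (rule cong_pow[OF c1])
    then have "[k ^ (card T * x) = 1] (mod q)" by (simp add: power_mult)
    moreover have "[(k ^ (q - 1)) ^ y * k = 1 ^ y * k] (mod q)" by (rule cong_mult[OF cong_pow[OF c2] cong_refl])
    then have "[k ^ (card T * x) = k] (mod q)" unfolding xy power_mult power_add by (simp only: power_one_right power_one mult_1_left)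
    ultimately have "[k = 1] (mod q)" by (meson cong_sym cong_trans)
    then have "inv u \<otimes> z \<otimes> u = z" using zpow[of k 1] k zc by simp
    moreover have "z \<otimes> u = u \<otimes> (inv u \<otimes> z \<otimes> u)" using uc zc by (simp add: m_assoc[symmetric])
    ultimately show ?thesis using compA_eq[OF uT(1) z(1)] by simp
  qed
  have rest: "finprod (G\<lparr>carrier := A\<rparr>) (\<lambda>u. compA (z \<otimes> u)) (T - F) = \<one> \<and> q dvd card (T - F)"
  proof (rule orbit_free_part[OF q z(1,2)])
    show "inv u \<otimes> z \<otimes> u \<notin> A" if "u \<in> T - F" for u using that unfolding F_def by blast
    show "compT (z \<otimes> u) \<in> T - F" if u: "u \<in> T - F" for u
    proof -
      define v where "v = compT (z \<otimes> u)"
      define a where "a = compA (z \<otimes> u)"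
      have zu: "z \<otimes> u \<in> T <#> A" using mult_T_closed[OF zX] u by blast
      have va: "v \<in> T" "a \<in> A" "z \<otimes> u = v \<otimes> a"
        unfolding v_def a_def using zu by (auto simp: compT_closed compA_closed comp_decompose[symmetric])
      have c: "v \<in> carrier G" "a \<in> carrier G" "u \<in> carrier G" using va u tc ac by auto
      \<comment> \<open>From z u = v a it follows that u^-1 z u is the conjugate of v^-1 z v by
        a^-1, and a lies in A; so u and v are in F together.\<close>
      have "v \<notin> F"
      proof
        assume "v \<in> F"
        then have "inv a \<otimes> (inv v \<otimes> z \<otimes> v) \<otimes> a \<in> A"
          using va A unfolding F_def by (simp add: subgroup.m_closed subgroup.m_inv_closed)
        moreover have "inv a \<otimes> (inv v \<otimes> z \<otimes> v) \<otimes> a = inv (v \<otimes> a) \<otimes> z \<otimes> (v \<otimes> a)"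
          using c zc by (simp add: inv_mult_group m_assoc)
        moreover have "\<dots> = inv u \<otimes> z \<otimes> u" unfolding va(3)[symmetric]
          using c zc by (simp add: inv_mult_group m_assoc)
        ultimately show False using u unfolding F_def by simp
      qed
      then show ?thesis using va unfolding v_def by blast
    qed
  qed simp
  have FT: "F \<subseteq> T" unfolding F_def by blast
  have fT: "finite T" by (rule subgroup_finite[OF T])
  have Pi: "(\<lambda>u. compA (z \<otimes> u)) \<in> V \<rightarrow> carrier (G\<lparr>carrier := A\<rparr>)" if "V \<subseteq> T" for V
    using that compA_closed mult_T_closed[OF zX] by auto
  have "finprod (G\<lparr>carrier := A\<rparr>) (\<lambda>u. compA (z \<otimes> u)) F = finprod (G\<lparr>carrier := A\<rparr>) (\<lambda>u. z) F"
    by (rule A.finprod_cong') (use z Fz in auto)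
  also have "\<dots> = z [^] card F" using A.finprod_const[of z F] z by (simp add: nat_pow_consistent[symmetric])
  finally have pF: "finprod (G\<lparr>carrier := A\<rparr>) (\<lambda>u. compA (z \<otimes> u)) F = z [^] card F" .
  have "transfer z = finprod (G\<lparr>carrier := A\<rparr>) (\<lambda>u. compA (z \<otimes> u)) (F \<union> (T - F))"
    unfolding transfer_def using FT by (simp add: Un_absorb1)
  also have "\<dots> = z [^] card F"
    using A.finprod_Un_disjoint[of F "T - F" "\<lambda>u. compA (z \<otimes> u)"] Pi[of F] Pi[of "T - F"] FT fT
      finite_subset[OF FT fT] pF rest zc by auto
  finally have tz: "transfer z = z [^] card F" .
  have "\<not> q dvd card T" using large[OF q] by auto
  moreover have "card T = card F + card (T - F)"
    using card_Un_disjoint[of F "T - F"] FT fT finite_subset[OF FT fT] by (simp add: Un_absorb1)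
  ultimately have "\<not> q dvd card F" using rest by (metis dvd_add)
  then show ?thesis using zord tz by simp
qed

end

section \<open>Cyclic complements with smaller primes\<close>

context finite_group
begin

text \<open>Of the cyclicity of A, only this much is used, and it is visibly inherited by subgroups.\<close>
definition cyclic_like :: "'a set \<Rightarrow> bool" where
  "cyclic_like A \<longleftrightarrow> subgroup A G \<and> (\<forall>x\<in>A. \<forall>y\<in>A. x \<otimes> y = y \<otimes> x) \<and>
     (\<forall>(q::nat) z y. prime q \<longrightarrow> z \<in> A \<longrightarrow> y \<in> A \<longrightarrow> z [^] q = \<one> \<longrightarrow> y [^] q = \<one> \<longrightarrow> z \<noteq> \<one> \<longrightarrow>
        (\<exists>k::nat. y = z [^] k))"

lemma cyclic_like_subgroup: "cyclic_like A \<Longrightarrow> subgroup B G \<Longrightarrow> B \<subseteq> A \<Longrightarrow> cyclic_like B"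
  unfolding cyclic_like_def by blast

lemma generate_nat_pow:
  "a \<in> carrier G \<Longrightarrow> x \<in> generate G {a} \<longleftrightarrow> (\<exists>k::nat. x = a [^] k)"
  using generate_pow_on_finite_carrier[OF finite_carrier] by auto

lemma generate_single_subgroup: "a \<in> carrier G \<Longrightarrow> subgroup (generate G {a}) G"
  by (rule generate_is_subgroup) simp

lemma generate_single_self: "a \<in> generate G {a}"
  by (rule generate.incl) simp

lemma generate_single_card: "a \<in> carrier G \<Longrightarrow> card (generate G {a}) = ord a"
  using generate_pow_card by simp

lemma generate_single_comm:
  assumes "a \<in> carrier G" "x \<in> generate G {a}" "y \<in> generate G {a}"
  shows "x \<otimes> y = y \<otimes> x"
proof -
  obtain i j :: nat where "x = a [^] i" "y = a [^] j" using assms generate_nat_pow by metis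
  then show ?thesis using assms(1) by (simp add: nat_pow_mult add.commute)
qed

text \<open>With n = ord a, the exponents i of z and j of y are multiples of m = n / q. As z is not
  one, i / m is invertible modulo q, so a multiple of i is congruent to j modulo n.\<close>

lemma cyclic_like_generate:
  assumes a: "a \<in> carrier G"
  shows "cyclic_like (generate G {a})"
  unfolding cyclic_like_def
proof (intro conjI ballI allI impI)
  show "subgroup (generate G {a}) G" by (rule generate_single_subgroup[OF a])
  show "x \<otimes> y = y \<otimes> x" if "x \<in> generate G {a}" "y \<in> generate G {a}" for x y
    by (rule generate_single_comm[OF a that])
  fix q :: nat and z y
  assume q: "prime q" and z: "z \<in> generate G {a}" and y: "y \<in> generate G {a}"
    and zq: "z [^] q = \<one>" and yq: "y [^] q = \<one>" and z1: "z \<noteq> \<one>"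
  obtain i where i: "z = a [^] (i::nat)" using z generate_nat_pow[OF a] by blast
  obtain j where j: "y = a [^] (j::nat)" using y generate_nat_pow[OF a] by blast
  define n where "n = ord a"
  have npos: "n > 0" unfolding n_def using ord_ge_1[OF finite_carrier a] by simp
  have id: "a [^] k = \<one> \<longleftrightarrow> n dvd k" for k :: nat unfolding n_def by (rule pow_eq_id[OF a])
  have iq: "n dvd i * q" using zq unfolding i by (simp add: nat_pow_pow a id)
  have jq: "n dvd j * q" using yq unfolding j by (simp add: nat_pow_pow a id)
  have ni: "\<not> n dvd i" using z1 unfolding i by (simp add: id)
  have "q dvd n"
  proof (rule ccontr)
    assume "\<not> q dvd n"
    then have "coprime n q" using q by (metis coprime_commute prime_imp_coprime)
    then show False using iq ni by (simp add: coprime_dvd_mult_left_iff)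
  qed
  then obtain m where m: "n = q * m" by blast
  have qpos: "q > 0" using q by (rule prime_gt_0_nat)
  have "m dvd i" "m dvd j" using iq jq qpos unfolding m by (simp_all add: mult.commute)
  then obtain i' j' where ij: "i = m * i'" "j = m * j'" by (auto elim!: dvdE)
  have "\<not> q dvd i'" using ni unfolding m ij by (auto simp: mult.commute)
  then have "coprime i' q" using q by (metis coprime_commute prime_imp_coprime)
  then obtain k where "[i' * k = Suc 0] (mod q)" using cong_solve_coprime_nat by blast
  then have "i' * k mod q = 1" using prime_gt_1_nat[OF q] by (simp add: cong_def)
  then have ik: "i' * k = q * (i' * k div q) + 1" by (metis mult_div_mod_eq)
  have "i * (k * j') = m * (i' * k) * j'" unfolding ij by (simp only: mult_ac)
  also have "\<dots> = n * ((i' * k div q) * j') + j"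
    by (subst ik) (simp add: m ij algebra_simps)
  finally have "a [^] (i * (k * j')) = (a [^] n) [^] ((i' * k div q) * j') \<otimes> a [^] j"
    using a by (simp only: nat_pow_mult nat_pow_pow nat_pow_closed)
  then have "a [^] (i * (k * j')) = a [^] j"
    using a id[of n] by simp
  then have "y = z [^] (k * j')" unfolding i j using a by (simp add: nat_pow_pow)
  then show "\<exists>k::nat. y = z [^] k" by blast
qed

lemma pow_card_subgroup:
  assumes "subgroup H G" "x \<in> H"
  shows "x [^] card H = \<one>"
proof -
  interpret H: group "G\<lparr>carrier := H\<rparr>" by (rule subgroup_imp_group[OF assms(1)])
  have "x [^]\<^bsub>G\<lparr>carrier := H\<rparr>\<^esub> order (G\<lparr>carrier := H\<rparr>) = \<one>\<^bsub>G\<lparr>carrier := H\<rparr>\<^esub>"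
    by (rule H.pow_order_eq_1) (use assms in simp)
  then show ?thesis by (simp add: order_def nat_pow_consistent[symmetric])
qed

lemma coprime_if_primes_less:
  fixes m n :: nat
  assumes "\<And>p q. prime p \<Longrightarrow> prime q \<Longrightarrow> p dvd m \<Longrightarrow> q dvd n \<Longrightarrow> q < p"
  shows "coprime m n"
  by (rule ccontr) (use assms prime_factor_nat in \<open>metis coprime_iff_gcd_eq_1 gcd_greatest_iff order_less_irrefl\<close>)

text \<open>The transfer into A kills T but no element of prime order of A, so its kernel is a
  smaller group of the same shape that contains T.\<close>
theorem normal_if_cyclic_complement:
  "subgroup T G \<Longrightarrow> cyclic_like A \<Longrightarrow> subgroup (T <#> A) G \<Longrightarrow>
   (\<And>p q. prime p \<Longrightarrow> prime q \<Longrightarrow> p dvd card T \<Longrightarrow> q dvd card A \<Longrightarrow> q < p) \<Longrightarrow>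
   normalizes (T <#> A) T"
proof (induction "card A" arbitrary: A rule: less_induct)
  case less
  note T = less.prems(1) and cA = less.prems(2) and X = less.prems(3) and large = less.prems(4)
  have A: "subgroup A G" using cA unfolding cyclic_like_def by blast
  have cop: "coprime (card T) (card A)" using large by (rule coprime_if_primes_less)
  note tc = subgroup.mem_carrier[OF T] and ac = subgroup.mem_carrier[OF A] and xc = subgroup.mem_carrier[OF X]
  show ?case
  proof (cases "card A = 1")
    case True
    then have A1: "A = {\<one>}" using subgroup.one_closed[OF A] by (metis card_1_singletonE singletonD)
    have "T <#> A = T" unfolding A1 using tc by (auto simp: set_mult_def)
    then show ?thesis unfolding normalizes_def using T
      by (simp add: subgroup.m_closed subgroup.m_inv_closed)
  next
    case False
    obtain q where q: "prime q" "q dvd card A" using prime_factor_nat[OF False] by blast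
    obtain Z where Z: "subgroup Z G" "Z \<subseteq> A" "card Z = q" using sylow_in[OF A q(1), of 1] q by auto
    have "\<exists>z\<in>Z. z \<noteq> \<one>"
    proof (rule ccontr)
      assume "\<not> ?thesis"
      then have "Z \<subseteq> {\<one>}" by blast
      then have "card Z \<le> 1" by (metis card_mono card.empty card_insert_if empty_iff finite.emptyI finite_insert One_nat_def)
      then show False using Z prime_gt_1_nat[OF q(1)] by simp
    qed
    then obtain z where z: "z \<in> Z" "z \<noteq> \<one>" by blast
    have zA: "z \<in> A" using z Z by blast
    have zq: "z [^] q = \<one>" using pow_card_subgroup[OF Z(1) z(1)] Z by simp
    interpret abelian_complement G T A
    proof (intro abelian_complement.intro abelian_complement_axioms.intro finite_group_axioms)
      show "x \<otimes> y = y \<otimes> x" if "x \<in> A" "y \<in> A" for x y using that cA unfolding cyclic_like_def by blast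
      show "T \<inter> A = {\<one>}" by (rule coprime_Int_trivial[OF T A cop])
    qed (fact T A X)+
    have tz: "transfer z \<noteq> \<one>"
    proof (rule transfer_prime_order[OF q(1) zA zq z(2)])
      show "\<exists>k::nat. y = z [^] k" if "y \<in> A" "y [^] q = \<one>" for y
        using cA q(1) zA zq z(2) that unfolding cyclic_like_def by blast
      show "q < p" if "prime p" "p dvd card T" for p using large that q by blast
    qed
    have t1: "transfer \<one> = \<one>" by (rule transfer_T[OF subgroup.one_closed[OF T]])
    \<comment> \<open>The kernel of the transfer is normal in T A, contains T and avoids z, so it
      will be T B with B properly inside A.\<close>
    define E where "E = {x \<in> T <#> A. transfer x = \<one>}"
    have EX: "E \<subseteq> T <#> A" unfolding E_def by blast
    have nE: "normalizes (T <#> A) E" unfolding normalizes_def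
    proof clarify
      fix x e assume x: "x \<in> T <#> A" and e: "e \<in> E"
      have ix: "inv x \<in> T <#> A" by (rule subgroup.m_inv_closed[OF X x])
      have eX: "e \<in> T <#> A" "transfer e = \<one>" using e unfolding E_def by auto
      have xe: "x \<otimes> e \<in> T <#> A" by (rule subgroup.m_closed[OF X x eX(1)])
      have "transfer (x \<otimes> e \<otimes> inv x) = transfer x \<otimes> \<one> \<otimes> transfer (inv x)"
        using transfer_mult[OF xe ix] transfer_mult[OF x eX(1)] eX by simp
      also have "\<dots> = transfer x \<otimes> transfer (inv x)" using ac[OF transfer_closed[OF x]] by simp
      also have "\<dots> = \<one>" using transfer_mult[OF x ix] xc[OF x] t1 by simp
      finally show "x \<otimes> e \<otimes> inv x \<in> E" unfolding E_def using subgroup.m_closed[OF X xe ix] by simp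
    qed
    have E: "subgroup E G"
    proof (rule subgroupI)
      show "E \<subseteq> carrier G" using EX xc by blast
      show "E \<noteq> {}" using subgroup.one_closed[OF X] t1 unfolding E_def by blast
      show "x \<otimes> y \<in> E" if "x \<in> E" "y \<in> E" for x y
        using that subgroup.m_closed[OF X] transfer_mult unfolding E_def by simp
      show "inv x \<in> E" if x: "x \<in> E" for x
      proof -
        have xX: "x \<in> T <#> A" "transfer x = \<one>" using x unfolding E_def by auto
        have ix: "inv x \<in> T <#> A" by (rule subgroup.m_inv_closed[OF X xX(1)])
        have "transfer x \<otimes> transfer (inv x) = \<one>" using transfer_mult[OF xX(1) ix] xc[OF xX(1)] t1 by simp
        then show ?thesis using xX ix ac[OF transfer_closed[OF ix]] unfolding E_def by simp
      qed
    qed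
    note ec = subgroup.mem_carrier[OF E]
    have TE: "T \<subseteq> E" unfolding E_def using T_subset transfer_T by blast
    define B where "B = A \<inter> E"
    have B: "subgroup B G" unfolding B_def using subgroups_Inter_pair[OF A E] .
    have EB: "E = T <#> B"
    proof
      show "E \<subseteq> T <#> B"
      proof
        fix e assume e: "e \<in> E"
        then obtain t a where *: "t \<in> T" "a \<in> A" "e = t \<otimes> a" using EX by (blast elim: set_multE)
        have "a = inv t \<otimes> e" using * tc ac by (simp add: m_assoc[symmetric])
        moreover have "inv t \<otimes> e \<in> E" using * e TE E by (blast intro: subgroup.m_closed subgroup.m_inv_closed)
        ultimately have "a \<in> E" by simp
        then show "e \<in> T <#> B" using * unfolding B_def by (auto intro: set_multI)
      qed
      show "T <#> B \<subseteq> E" by (rule set_mult_subset[OF E TE]) (simp add: B_def)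
    qed
    have "z \<notin> B" using tz unfolding B_def E_def by blast
    then have cB: "card B < card A" using subgroup_finite[OF A] zA by (intro psubset_card_mono) (auto simp: B_def)
    have dB: "card B dvd card A" by (rule subgroup_card_dvd[OF B A]) (simp add: B_def)
    have nET: "normalizes E T" unfolding EB
    proof (rule less.hyps[OF cB T])
      show "cyclic_like B" by (rule cyclic_like_subgroup[OF cA B]) (simp add: B_def)
      show "subgroup (T <#> B) G" using E EB by simp
      show "q < p" if "prime p" "prime q" "p dvd card T" "q dvd card B" for p q
        using large that dB dvd_trans by blast
    qed
    have copB: "coprime (card T) (card B)" using cop dB coprime_divisors dvd_refl by blast
    have cE: "card E div card T = card B"
      using card_set_mult_coprime[OF T B copB] EB subgroup_card_pos[OF T] by simp
    \<comment> \<open>T is normal in E and its index there, \<open>card B\<close>, is prime to its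
      order, so E has no other subgroup of order \<open>card T\<close>. Conjugation by elements of T
      A preserves E, hence T.\<close>
    show ?thesis unfolding normalizes_def
    proof (intro ballI)
      fix x t assume x: "x \<in> T <#> A" and t: "t \<in> T"
      define Q where "Q = (\<lambda>h. x \<otimes> h \<otimes> inv x) ` T"
      have Q: "subgroup Q G" unfolding Q_def by (rule conj_subgroup[OF T xc[OF x]])
      have QE: "Q \<subseteq> E" unfolding Q_def using nE x TE unfolding normalizes_def by blast
      have cQ: "card Q = card T" unfolding Q_def by (rule conj_card[OF subgroup.subset[OF T] xc[OF x]])
      have "Q \<subseteq> T"
        by (rule coprime_index_subset[OF Q T E QE TE]) (use nET QE cQ cE copB in \<open>auto simp: normalizes_def\<close>)
      then show "x \<otimes> t \<otimes> inv x \<in> T" using t unfolding Q_def by blast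
    qed
  qed
qed

end

subsection \<open>Normal Hall subgroups\<close>

lemma prime_multiplicity_mult:
  fixes p m n :: nat
  assumes "prime p" "m > 0" "n > 0"
  shows "multiplicity p (m * n) = multiplicity p m + multiplicity p n"
  using assms by (simp add: prime_elem_multiplicity_mult_distrib)

text \<open>To be applied to the order of an element x that permutes with a Sylow
  p-subgroup.\<close>

lemma ex_split_at_prime:
  fixes n p :: nat
  assumes "n > 0"
  shows "\<exists>a b. n = a * b \<and> (\<forall>q. prime q \<longrightarrow> q dvd a \<longrightarrow> q < p) \<and> (\<forall>q. prime q \<longrightarrow> q dvd b \<longrightarrow> p \<le> q)"
  using assms
proof (induction n rule: less_induct)
  case (less n)
  show ?case
  proof (cases "n = 1")
    case True
    then show ?thesis by (intro exI[of _ 1]) auto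
  next
    case False
    obtain r where r: "prime r" "r dvd n" using prime_factor_nat[OF False] by blast
    then obtain m where m: "n = r * m" by blast
    have "m < n" "m > 0" using m less.prems prime_gt_1_nat[OF r(1)] by auto
    then obtain a b where ab: "m = a * b" "\<forall>q. prime q \<longrightarrow> q dvd a \<longrightarrow> q < p" "\<forall>q. prime q \<longrightarrow> q dvd b \<longrightarrow> p \<le> q"
      using less.IH by blast
    show ?thesis
    proof (cases "r < p")
      case True
      then show ?thesis
        by (intro exI[of _ "r * a"] exI[of _ b])
           (use m ab r in \<open>auto simp: prime_dvd_mult_iff dest: primes_dvd_imp_eq\<close>)
    next
      case False
      then show ?thesis
        by (intro exI[of _ a] exI[of _ "r * b"])
           (use m ab r in \<open>auto simp: prime_dvd_mult_iff dest: primes_dvd_imp_eq\<close>)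
    qed
  qed
qed

lemma coprime_primesI:
  fixes m n :: nat
  assumes "\<And>q. prime q \<Longrightarrow> q dvd m \<Longrightarrow> q dvd n \<Longrightarrow> False"
  shows "coprime m n"
  by (rule ccontr) (use assms prime_factor_nat in \<open>metis coprime_iff_gcd_eq_1 gcd_greatest_iff\<close>)

context finite_group
begin

lemma carrier_subgroup: "subgroup (carrier G) G" by (rule subgroup_self)

lemma normalizes_mono: "normalizes A H \<Longrightarrow> B \<subseteq> A \<Longrightarrow> normalizes B H"
  unfolding normalizes_def by blast

lemma order_pos: "order G > 0"
  using subgroup_card_pos[OF carrier_subgroup] unfolding order_def .

lemma subgroup_normalizes_self: "subgroup H G \<Longrightarrow> normalizes H H"
  unfolding normalizes_def by (simp add: subgroup.m_closed subgroup.m_inv_closed)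

lemma not_dvd_index:
  assumes "subgroup H G" "subgroup K G" "H \<subseteq> K" "prime (q::nat)"
    and "multiplicity q (card K) \<le> multiplicity q (card H)"
  shows "\<not> q dvd card K div card H"
proof
  assume d: "q dvd card K div card H"
  have K: "card K = card H * (card K div card H)" using subgroup_card_dvd[OF assms(1-3)] by simp
  have pos: "card H > 0" "card K div card H > 0"
    using subgroup_card_pos[OF assms(1)] subgroup_card_pos[OF assms(2)] K by (auto intro: Nat.gr0I)
  have "multiplicity q (card K) = multiplicity q (card H) + multiplicity q (card K div card H)"
    using prime_multiplicity_mult[OF assms(4) pos] K by simp
  moreover have "multiplicity q (card K div card H) > 0"
    using d pos(2) assms(4) by (simp add: prime_multiplicity_gt_zero_iff)
  ultimately show False using assms(5) by simp
qed

text \<open>Multiplicities make sense for every natural \<open>m\<close>, prime or not, so that an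
  induction can descend by one at a time.\<close>

definition hall :: "nat \<Rightarrow> 'a set \<Rightarrow> bool" where
  "hall m N \<longleftrightarrow> subgroup N G \<and> normalizes (carrier G) N \<and>
     (\<forall>q. prime q \<longrightarrow> multiplicity q (card N) = (if m < q then multiplicity q (order G) else 0))"

lemma hall_subgroup: "hall m N \<Longrightarrow> subgroup N G" unfolding hall_def by blast
lemma hall_normal: "hall m N \<Longrightarrow> normalizes (carrier G) N" unfolding hall_def by blast
lemma hall_normalizes: "hall m N \<Longrightarrow> H \<subseteq> carrier G \<Longrightarrow> normalizes H N"
  using hall_normal normalizes_mono by blast

lemma hall_prime_dvd:
  assumes "hall m N" "prime q" "q dvd card N"
  shows "m < q"
proof (rule ccontr)
  assume "\<not> m < q"
  then have "multiplicity q (card N) = 0" using assms unfolding hall_def by simp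
  then show False using assms subgroup_card_pos[OF hall_subgroup[OF assms(1)]]
    by (simp add: prime_multiplicity_gt_zero_iff[symmetric])
qed

text \<open>N absorbs the full power of every prime larger than m, so its index is prime to
  \<open>card Q\<close>.\<close>

lemma hall_subset:
  assumes N: "hall m N" and Q: "subgroup Q G" and pr: "\<And>q. prime q \<Longrightarrow> q dvd card Q \<Longrightarrow> m < q"
  shows "Q \<subseteq> N"
proof (rule coprime_index_subset[OF Q hall_subgroup[OF N] carrier_subgroup])
  show "Q \<subseteq> carrier G" "N \<subseteq> carrier G" using Q hall_subgroup[OF N] subgroup.subset by auto
  then show "normalizes Q N" using hall_normalizes[OF N] by blast
  show "coprime (card Q) (card (carrier G) div card N)"
  proof (rule coprime_primesI)
    fix q assume q: "prime q" "q dvd card Q" "q dvd card (carrier G) div card N"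
    have "m < q" using pr q by blast
    then show False using not_dvd_index[OF hall_subgroup[OF N] carrier_subgroup _ q(1)] q(1,3) \<open>N \<subseteq> carrier G\<close> N
      unfolding hall_def order_def by auto
  qed
qed

lemma hall_coprime_power:
  assumes "hall p N" "prime q" "q \<le> p"
  shows "coprime (card N) (q ^ k)"
proof -
  have "\<not> q dvd card N" using hall_prime_dvd[OF assms(1,2)] assms(3) by auto
  then show ?thesis using assms(2) by (metis coprime_commute coprime_power_left_iff prime_imp_coprime)
qed

lemma hall_mult_sylow:
  assumes N: "hall p N" and pr: "prime p" and P: "subgroup P G" and cP: "card P = p ^ multiplicity p (order G)"
  shows "subgroup (N <#> P) G" and "card (N <#> P) = card N * card P"
    and "prime q \<Longrightarrow> multiplicity q (card (N <#> P)) = (if p \<le> q then multiplicity q (order G) else 0)"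
proof -
  note Ns = hall_subgroup[OF N]
  show "subgroup (N <#> P) G"
    by (rule set_mult_subgroup[OF Ns P hall_normalizes[OF N subgroup.subset[OF P]]])
  show c: "card (N <#> P) = card N * card P"
    by (rule card_set_mult_coprime[OF Ns P]) (use hall_coprime_power[OF N pr] cP in simp)
  show "multiplicity q (card (N <#> P)) = (if p \<le> q then multiplicity q (order G) else 0)" if q: "prime q"
  proof -
    have 1: "multiplicity q (card (N <#> P)) = multiplicity q (card N) + multiplicity q (card P)"
      unfolding c using prime_multiplicity_mult[OF q] subgroup_card_pos[OF Ns] subgroup_card_pos[OF P] by blast
    have 2: "multiplicity q (card P) = (if p = q then multiplicity q (order G) else 0)"
      unfolding cP using multiplicity_distinct_prime_power[OF q pr] multiplicity_prime_power pr by auto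
    show ?thesis using N q unfolding 1 2 hall_def by auto
  qed
qed

lemma hall_Suc_mult_sylow:
  assumes N: "hall (Suc m) N" and pr: "prime (Suc m)" and P: "subgroup P G"
    and cP: "card P = Suc m ^ multiplicity (Suc m) (order G)"
    and n: "normalizes (carrier G) (N <#> P)"
  shows "hall m (N <#> P)"
  using hall_mult_sylow[OF N pr P cP] n unfolding hall_def by auto

text \<open>Downward recursion on m, starting with the trivial group once m reaches the group order.
  Only prime values of m + 1 change the group.\<close>

lemma hall_tower:
  assumes step: "\<And>p N. prime p \<Longrightarrow> hall p N \<Longrightarrow>
     \<exists>P. subgroup P G \<and> card P = p ^ multiplicity p (order G) \<and> normalizes (carrier G) (N <#> P)"
  shows "\<exists>N. hall m N"
proof (induction "order G - m" arbitrary: m)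
  case 0
  have "hall m {\<one>}" unfolding hall_def
  proof (intro conjI allI impI)
    show "subgroup {\<one>} G" by (rule triv_subgroup)
    show "normalizes (carrier G) {\<one>}" unfolding normalizes_def by simp
    fix q :: nat assume q: "prime q"
    have "m < q \<Longrightarrow> \<not> q dvd order G" using 0 order_pos by (auto dest: dvd_imp_le)
    then have "m < q \<Longrightarrow> multiplicity q (order G) = 0" by (simp add: not_dvd_imp_multiplicity_0)
    then show "multiplicity q (card {\<one>}) = (if m < q then multiplicity q (order G) else 0)" by simp
  qed
  then show ?case by blast
next
  case (Suc d)
  then obtain N where N: "hall (Suc m) N" by (metis Suc_diff_Suc diff_Suc_Suc diff_diff_left nat.inject plus_1_eq_Suc add.commute zero_less_Suc zero_less_diff)
  show ?case
  proof (cases "prime (Suc m)")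
    case True
    then show ?thesis using step[OF True N] hall_Suc_mult_sylow[OF N True] by blast
  next
    case False
    have "m < q \<longleftrightarrow> Suc m < q" if "prime q" for q using that False by (metis Suc_lessI Suc_lessD)
    then have "hall m N" using N unfolding hall_def by auto
    then show ?thesis by blast
  qed
qed

text \<open>Let ord x = a b, where a collects the primes below p. Then x^b generates a cyclic group
  A of order a, and <x> P = T A, where T is the intersection of <x> P with N P. By
  \<open>normal_if_cyclic_complement\<close> x normalises T, which contains P; and x normalises N,
  which is normal in G.\<close>

lemma permuting_normalizes:
  assumes pr: "prime p" and N: "hall p N" and P: "subgroup P G"
    and cP: "card P = p ^ multiplicity p (order G)"
    and x: "x \<in> carrier G" and perm: "generate G {x} <#> P = P <#> generate G {x}"
  shows "normalizes {x} (N <#> P)"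
proof -
  note Ns = hall_subgroup[OF N]
  define C where "C = generate G {x}"
  have C: "subgroup C G" unfolding C_def by (rule generate_single_subgroup[OF x])
  have cC: "card C = ord x" unfolding C_def by (rule generate_single_card[OF x])
  have Ccomm: "a \<otimes> b = b \<otimes> a" if "a \<in> C" "b \<in> C" for a b
    using generate_single_comm[OF x] that unfolding C_def by blast
  have Cn: "normalizes A B" if "A \<subseteq> C" "B \<subseteq> C" for A B
    unfolding normalizes_def
  proof (intro ballI)
    fix a b assume "a \<in> A" "b \<in> B"
    then have ab: "a \<in> C" "b \<in> C" using that by auto
    have "a \<otimes> b \<otimes> inv a = b" using Ccomm[OF ab] subgroup.mem_carrier[OF C] ab by (simp add: m_assoc)
    then show "a \<otimes> b \<otimes> inv a \<in> B" using \<open>b \<in> B\<close> by simp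
  qed
  define M where "M = N <#> P"
  have M: "subgroup M G" unfolding M_def by (rule hall_mult_sylow[OF N pr P cP])
  have PM: "P \<subseteq> M" unfolding M_def by (rule subset_set_mult_right[OF Ns subgroup.subset[OF P]])
  have NM: "N \<subseteq> M" unfolding M_def by (rule subset_set_mult_left[OF subgroup.subset[OF Ns] P])
  have multM: "multiplicity q (card M) = (if p \<le> q then multiplicity q (order G) else 0)" if "prime q" for q
    unfolding M_def by (rule hall_mult_sylow(3)[OF N pr P cP that])
  have Mprime: "p \<le> q" if "prime q" "q dvd card M" for q
  proof (rule ccontr)
    assume "\<not> p \<le> q"
    then have "multiplicity q (card M) = 0" using multM[OF that(1)] by simp
    then show False using that subgroup_card_pos[OF M] by (simp add: prime_multiplicity_gt_zero_iff[symmetric])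
  qed
  define X where "X = P <#> C"
  have X: "subgroup X G" unfolding X_def
    by (rule set_mult_subgroup_if_commute[OF P C]) (use perm in \<open>simp add: C_def\<close>)
  have PX: "P \<subseteq> X" unfolding X_def by (rule subset_set_mult_left[OF subgroup.subset[OF P] C])
  have CX: "C \<subseteq> X" unfolding X_def by (rule subset_set_mult_right[OF P subgroup.subset[OF C]])
  define D where "D = C \<inter> M"
  have D: "subgroup D G" unfolding D_def by (rule subgroups_Inter_pair[OF C M])
  \<comment> \<open>A Sylow r-subgroup of C lies in N if r > p. If r = p it lies in P, because C
    \<inter> P has the same index in C as P has in X, and this index is prime to p.\<close>
  have large: "r ^ multiplicity r (card C) dvd card D" if r: "prime r" "p \<le> r" for r
  proof -
    obtain R where R: "subgroup R G" "R \<subseteq> C" "card R = r ^ multiplicity r (card C)"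
      using sylow_in[OF C r(1) multiplicity_dvd] by blast
    have "R \<subseteq> M"
    proof (cases "p = r")
      case True
      have CP: "subgroup (C \<inter> P) G" by (rule subgroups_Inter_pair[OF C P])
      have "card X * card (C \<inter> P) = card P * card C"
        using card_set_mult[OF P C] unfolding X_def by (simp add: Int_commute)
      moreover obtain i where i: "card C = card (C \<inter> P) * i"
        using subgroup_card_dvd[OF CP C] by auto
      moreover obtain j where j: "card X = card P * j"
        using subgroup_card_dvd[OF P X PX] by auto
      ultimately have ij: "i = j" using subgroup_card_pos[OF P] subgroup_card_pos[OF CP] by simp
      have "\<not> p dvd card X div card P"
      proof (rule not_dvd_index[OF P X PX pr])
        show "multiplicity p (card X) \<le> multiplicity p (card P)"
          using dvd_imp_multiplicity_le[OF subgroup_card_dvd_order[OF X]] order_pos cP pr by simp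
      qed
      then have "\<not> p dvd j" using j subgroup_card_pos[OF P] by simp
      then have cop: "coprime (card R) (card C div card (C \<inter> P))"
        using i ij R(3) True pr subgroup_card_pos[OF CP]
        by (simp add: prime_imp_coprime)
      have "R \<subseteq> C \<inter> P"
        by (rule coprime_index_subset[OF R(1) CP C R(2) _ _ cop]) (use Cn R in auto)
      then show ?thesis using PM by blast
    next
      case False
      have "R \<subseteq> N"
      proof (rule hall_subset[OF N R(1)])
        fix q assume "prime q" "q dvd card R"
        then have "q = r" using R(3) r(1) by (metis prime_dvd_power primes_dvd_imp_eq)
        then show "p < q" using False r by simp
      qed
      then show ?thesis using NM by blast
    qed
    then have "R \<subseteq> D" using R unfolding D_def by blast
    then show ?thesis using subgroup_card_dvd[OF R(1) D] R(3) by simp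
  qed
  obtain a b where ab: "card C = a * b" "\<forall>q. prime q \<longrightarrow> q dvd a \<longrightarrow> q < p" "\<forall>q. prime q \<longrightarrow> q dvd b \<longrightarrow> p \<le> q"
    using ex_split_at_prime[OF subgroup_card_pos[OF C]] by blast
  have abpos: "a > 0" "b > 0" using ab(1) subgroup_card_pos[OF C] by (auto intro: Nat.gr0I)
  have bD: "b dvd card D"
  proof (rule multiplicity_le_imp_dvd)
    show "b \<noteq> 0" using abpos by simp
    fix q :: nat assume q: "prime q"
    show "multiplicity q b \<le> multiplicity q (card D)"
    proof (cases "q dvd b")
      case True
      then have "p \<le> q" using ab q by blast
      then have "multiplicity q (card C) \<le> multiplicity q (card D)"
        using dvd_imp_multiplicity_le[OF large[OF q], of q] subgroup_card_pos[OF D] q by simp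
      moreover have "multiplicity q b \<le> multiplicity q (card C)"
        using ab(1) subgroup_card_pos[OF C] by (intro dvd_imp_multiplicity_le) auto
      ultimately show ?thesis by simp
    next
      case False then show ?thesis by (simp add: not_dvd_imp_multiplicity_0)
    qed
  qed
  define A where "A = generate G {x [^] b}"
  have xb: "x [^] b \<in> carrier G" using x by simp
  have A: "subgroup A G" unfolding A_def by (rule generate_single_subgroup[OF xb])
  have "x [^] b \<in> C" unfolding C_def using generate_nat_pow[OF x] by blast
  then have AC: "A \<subseteq> C" unfolding A_def using generate_subgroup_incl[OF _ C] by blast
  have cA: "card A = a" unfolding A_def generate_single_card[OF xb]
    using ord_pow[OF x, of b] ab(1) cC abpos by simp
  have DA: "D <#> A = C"
  proof -
    have sub: "subgroup (D <#> A) G"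
      by (rule set_mult_subgroup[OF D A]) (use Cn AC in \<open>auto simp: D_def\<close>)
    have le: "D <#> A \<subseteq> C" by (rule set_mult_subset[OF C]) (use AC in \<open>auto simp: D_def\<close>)
    have "a dvd card (D <#> A)"
      using subgroup_card_dvd[OF A sub subset_set_mult_right[OF D subgroup.subset[OF A]]] cA by simp
    moreover have "b dvd card (D <#> A)"
      using subgroup_card_dvd[OF D sub subset_set_mult_left[OF subgroup.subset[OF D] A]] bD dvd_trans by blast
    moreover have "coprime a b"
      by (rule coprime_primesI) (use ab(2,3) in \<open>meson leD\<close>)
    ultimately have "card C dvd card (D <#> A)" unfolding ab(1) by (simp add: divides_mult)
    then have "card C \<le> card (D <#> A)" using subgroup_card_pos[OF sub] by (simp add: dvd_imp_le)
    then show ?thesis using le subgroup_finite[OF C] by (simp add: card_seteq)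
  qed
  define T where "T = X \<inter> M"
  have T: "subgroup T G" unfolding T_def by (rule subgroups_Inter_pair[OF X M])
  have XTA: "X = T <#> A"
  proof
    show "T <#> A \<subseteq> X" by (rule set_mult_subset[OF X]) (use AC CX in \<open>auto simp: T_def\<close>)
    show "X \<subseteq> T <#> A"
    proof
      fix g assume "g \<in> X"
      then obtain u c where 1: "u \<in> P" "c \<in> C" "g = u \<otimes> c" unfolding X_def by (rule set_multE)
      then obtain d e where 2: "d \<in> D" "e \<in> A" "c = d \<otimes> e" using DA by (blast elim: set_multE)
      have "u \<otimes> d \<in> T" unfolding T_def
        using 1 2 PX CX PM subgroup.m_closed[OF X] subgroup.m_closed[OF M] unfolding D_def by blast
      moreover have "g = (u \<otimes> d) \<otimes> e" unfolding 1 2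
        using 1 2 subgroup.mem_carrier P D A by (metis m_assoc)
      ultimately show "g \<in> T <#> A" using 2 by (auto intro: set_multI)
    qed
  qed
  have "normalizes (T <#> A) T"
  proof (rule normal_if_cyclic_complement[OF T])
    show "cyclic_like A" unfolding A_def by (rule cyclic_like_generate[OF xb])
    show "subgroup (T <#> A) G" using X XTA by simp
    fix r q :: nat assume *: "prime r" "prime q" "r dvd card T" "q dvd card A"
    have "card T dvd card M" by (rule subgroup_card_dvd[OF T M]) (simp add: T_def)
    then have "p \<le> r" using Mprime * dvd_trans by blast
    moreover have "q < p" using ab(2) * cA by blast
    ultimately show "q < r" by simp
  qed
  then have nT: "normalizes {x} T"
    using XTA CX generate_single_self[of x] unfolding C_def normalizes_def by blast
  show ?thesis unfolding normalizes_def M_def[symmetric]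
  proof clarify
    fix h assume "h \<in> M"
    then obtain n u where h: "n \<in> N" "u \<in> P" "h = n \<otimes> u" unfolding M_def by (rule set_multE)
    have c: "n \<in> carrier G" "u \<in> carrier G" using h subgroup.mem_carrier[OF Ns] subgroup.mem_carrier[OF P] by auto
    have "x \<otimes> n \<otimes> inv x \<in> M" using hall_normal[OF N] h x NM unfolding normalizes_def by blast
    moreover have "x \<otimes> u \<otimes> inv x \<in> M" using nT h PX PM unfolding normalizes_def T_def by blast
    moreover have "x \<otimes> h \<otimes> inv x = (x \<otimes> n \<otimes> inv x) \<otimes> (x \<otimes> u \<otimes> inv x)"
      unfolding h(3) using x c by (simp add: m_assoc) (simp add: m_assoc[symmetric])
    ultimately show "x \<otimes> h \<otimes> inv x \<in> M" using subgroup.m_closed[OF M] by simp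
  qed
qed

text \<open>The elements normalising N P form a subgroup that contains all generators of the
  permutizer.\<close>

lemma permuteral_normal:
  assumes pr: "prime p" and N: "hall p N" and P: "subgroup P G"
    and cP: "card P = p ^ multiplicity p (order G)" and perm: "permutizer G P = carrier G"
  shows "normalizes (carrier G) (N <#> P)"
proof -
  define S where "S = {x \<in> carrier G. generate G {x} <#> P = P <#> generate G {x}}"
  define U where "U = {x \<in> carrier G. normalizes {x} (N <#> P)}"
  have "S \<subseteq> U" unfolding S_def U_def using permuting_normalizes[OF pr N P cP] by blast
  moreover have "subgroup U G" unfolding U_def
    by (rule subgroup_normalizer_in[OF hall_mult_sylow(1)[OF N pr P cP] carrier_subgroup])
  ultimately have "generate G S \<subseteq> U" by (rule generate_subgroup_incl)
  then have "carrier G \<subseteq> U" using perm unfolding permutizer_def S_def by simp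
  then show ?thesis unfolding U_def normalizes_def by blast
qed

subsection \<open>Chains of prime index\<close>

text \<open>The index is a quotient of orders, which suits the arithmetic below; that the inclusion
  is strict follows from primality.\<close>

definition prime_step :: "'a set \<Rightarrow> 'a set \<Rightarrow> bool" where
  "prime_step H K \<longleftrightarrow> subgroup H G \<and> subgroup K G \<and> H \<subseteq> K \<and> prime (card K div card H)"

lemma prime_step_iff:
  "prime_step H K \<longleftrightarrow> subgroup H G \<and> subgroup K G \<and> H \<subset> K \<and> prime (subgroup_index G K H)"
proof -
  have "subgroup_index G K H = card K div card H" if "subgroup H G" "subgroup K G" "H \<subseteq> K"
    using subgroup_index_mult[OF that] subgroup_card_pos[OF that(1)] by (metis nonzero_mult_div_cancel_right not_gr0)
  moreover have "H \<noteq> K" if "prime (card K div card H)" "subgroup H G"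
    using that subgroup_card_pos[OF that(2)] by auto
  ultimately show ?thesis unfolding prime_step_def by auto
qed

lemma prime_stepsD: "prime_step\<^sup>*\<^sup>* H K \<Longrightarrow> subgroup H G \<Longrightarrow> subgroup K G \<and> H \<subseteq> K"
  by (induction rule: rtranclp_induct) (auto simp: prime_step_def)

text \<open>The reflexive transitive closure permits rule induction along a chain and concatenation
  of chains; H = G is the empty chain.\<close>

lemma P_subnormal_iff:
  assumes "subgroup H G"
  shows "P_subnormal H G \<longleftrightarrow> prime_step\<^sup>*\<^sup>* H (carrier G)"
proof
  assume "P_subnormal H G"
  then consider "H = carrier G" | n C where "C 0 = H" "C n = carrier G" "\<forall>i\<le>n. subgroup (C i) G"
    "\<forall>i<n. C i \<subset> C (Suc i) \<and> prime (subgroup_index G (C (Suc i)) (C i))"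
    unfolding P_subnormal_def by blast
  then show "prime_step\<^sup>*\<^sup>* H (carrier G)"
  proof cases
    case 1 then show ?thesis by simp
  next
    case (2 n C)
    have "i \<le> n \<Longrightarrow> prime_step\<^sup>*\<^sup>* H (C i)" for i
    proof (induction i)
      case 0 then show ?case using 2 by simp
    next
      case (Suc i)
      have "prime_step (C i) (C (Suc i))" unfolding prime_step_iff using 2 Suc.prems by auto
      then show ?case using Suc by (meson Suc_leD rtranclp.rtrancl_into_rtrancl)
    qed
    then show ?thesis using 2(2) by (metis order_refl)
  qed
next
  assume "prime_step\<^sup>*\<^sup>* H (carrier G)"
  moreover have "prime_step\<^sup>*\<^sup>* H K \<Longrightarrow> \<exists>(n::nat) (C :: nat \<Rightarrow> 'a set). C 0 = H \<and> C n = K \<and>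
        (\<forall>i\<le>n. subgroup (C i) G) \<and>
        (\<forall>i<n. C i \<subset> C (Suc i) \<and> prime (subgroup_index G (C (Suc i)) (C i)))" for K
  proof (induction rule: rtranclp_induct)
    case base
    show ?case by (rule exI[of _ 0], rule exI[of _ "\<lambda>_. H"]) (use assms in auto)
  next
    case (step K L)
    then obtain n C where C: "C 0 = H" "C n = K" "\<forall>i\<le>(n::nat). subgroup (C i) G"
        "\<forall>i<n. C i \<subset> C (Suc i) \<and> prime (subgroup_index G (C (Suc i)) (C i))" by blast
    show ?case
    proof (rule exI[of _ "Suc n"], rule exI[of _ "C(Suc n := L)"], intro conjI allI impI)
      fix i assume "i < Suc n"
      then show "(C(Suc n := L)) i \<subset> (C(Suc n := L)) (Suc i)"
        "prime (subgroup_index G ((C(Suc n := L)) (Suc i)) ((C(Suc n := L)) i))"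
        using C step.hyps(2) unfolding prime_step_iff by (cases "i = n"; auto)+
    next
      fix i assume "i \<le> Suc n"
      then show "subgroup ((C(Suc n := L)) i) G"
        using C step.hyps(2) unfolding prime_step_iff by (cases "i = Suc n") auto
    qed (use C in auto)
  qed
  ultimately show "P_subnormal H G" unfolding P_subnormal_def by blast
qed

lemma prime_step_between:
  assumes "prime_step H K" "subgroup L G" "H \<subseteq> L" "L \<subseteq> K"
  shows "L = H \<or> L = K"
proof -
  have H: "subgroup H G" and K: "subgroup K G" and pr: "prime (card K div card H)"
    using assms(1) unfolding prime_step_def by auto
  obtain a where a: "card L = card H * a" using subgroup_card_dvd[OF H assms(2,3)] by blast
  obtain b where b: "card K = card L * b" using subgroup_card_dvd[OF assms(2) K assms(4)] by blast
  have "card K div card H = a * b" using a b subgroup_card_pos[OF H] by simp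
  then have "a = 1 \<or> b = 1" using pr prime_product by metis
  then show ?thesis
  proof
    assume "a = 1"
    then have "H = L" using a assms(3) subgroup_finite[OF assms(2)] by (intro card_subset_eq) auto
    then show ?thesis by simp
  next
    assume "b = 1"
    then have "L = K" using b assms(4) subgroup_finite[OF K] by (intro card_subset_eq) auto
    then show ?thesis by simp
  qed
qed

text \<open>K \<inter> N H lies between H and K. If it is K, the two products agree; if it is H,
  then N meets H and K in the same group, and the order formula preserves the index.\<close>

lemma prime_step_mult:
  assumes st: "prime_step H K" and N: "subgroup N G" and n: "normalizes (carrier G) N"
  shows "N <#> H = N <#> K \<or> prime_step (N <#> H) (N <#> K)"
proof -
  have H: "subgroup H G" and K: "subgroup K G" and HK: "H \<subseteq> K" and pr: "prime (card K div card H)"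
    using st unfolding prime_step_def by auto
  define M where "M = N <#> H"
  define X where "X = N <#> K"
  have M: "subgroup M G" unfolding M_def
    by (rule set_mult_subgroup[OF N H normalizes_mono[OF n subgroup.subset[OF H]]])
  have X: "subgroup X G" unfolding X_def
    by (rule set_mult_subgroup[OF N K normalizes_mono[OF n subgroup.subset[OF K]]])
  have MX: "M \<subseteq> X" unfolding M_def X_def by (rule set_mult_mono) (use HK in auto)
  have HM: "H \<subseteq> M" unfolding M_def by (rule subset_set_mult_right[OF N subgroup.subset[OF H]])
  have NM: "N \<subseteq> M" unfolding M_def by (rule subset_set_mult_left[OF subgroup.subset[OF N] H])
  have "K \<inter> M = H \<or> K \<inter> M = K"
    by (rule prime_step_between[OF st subgroups_Inter_pair[OF K M]]) (use HK HM in auto)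
  then show ?thesis
  proof
    assume "K \<inter> M = K"
    then have "X \<subseteq> M" unfolding X_def using NM by (intro set_mult_subset[OF M]) auto
    then show ?thesis using MX unfolding M_def X_def by blast
  next
    assume KM: "K \<inter> M = H"
    have "N \<inter> K = N \<inter> H" using KM NM HK by blast
    then have "card X * card (N \<inter> H) = card N * card K" "card M * card (N \<inter> H) = card N * card H"
      using card_set_mult[OF N K] card_set_mult[OF N H] unfolding X_def M_def by simp_all
    moreover have cK: "card K = card H * (card K div card H)" using subgroup_card_dvd[OF H K HK] by simp
    ultimately have "card X * card (N \<inter> H) = (card M * (card K div card H)) * card (N \<inter> H)"
      by (metis mult.assoc mult.commute)
    then have "card X = card M * (card K div card H)"
      using subgroup_card_pos[OF subgroups_Inter_pair[OF N H]] by simp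
    then have "prime (card X div card M)" using pr subgroup_card_pos[OF M] by simp
    then show ?thesis using M X MX unfolding prime_step_def M_def X_def by blast
  qed
qed

lemma dvd_prime_power_le_eq_1:
  fixes p k n :: nat
  assumes "prime p" "k dvd p ^ n" "k < p"
  shows "k = 1"
proof -
  obtain i where i: "k = p ^ i" using assms(1,2) by (auto simp: divides_primepow_nat)
  have "i = 0"
  proof (rule ccontr)
    assume "i \<noteq> 0"
    then have "p dvd k" unfolding i by (simp add: dvd_power)
    moreover have "k > 0" using i assms(1) prime_gt_0_nat by simp
    ultimately show False using assms(3) by (auto dest: dvd_imp_le)
  qed
  then show ?thesis using i by simp
qed

text \<open>The chain is multiplied by N, so that it starts at T = N P. By induction T is normal in
  the lower group M of a step; a conjugate of P by an element of the upper group is shown to lie in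
  M, and then in T because T has index prime to p in M.\<close>

lemma subnormal_sylow_normal:
  assumes pr: "prime p" and N: "hall p N" and P: "subgroup P G"
    and cP: "card P = p ^ multiplicity p (order G)" and ch: "prime_step\<^sup>*\<^sup>* P (carrier G)"
  shows "normalizes (carrier G) (N <#> P)"
proof -
  note Ns = hall_subgroup[OF N] and Nn = hall_normal[OF N]
  define T where "T = N <#> P"
  have T: "subgroup T G" unfolding T_def by (rule hall_mult_sylow[OF N pr P cP])
  have PT: "P \<subseteq> T" unfolding T_def by (rule subset_set_mult_right[OF Ns subgroup.subset[OF P]])
  have NT: "N \<subseteq> T" unfolding T_def by (rule subset_set_mult_left[OF subgroup.subset[OF Ns] P])
  have multT: "multiplicity q (card T) = (if p \<le> q then multiplicity q (order G) else 0)" if "prime q" for q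
    unfolding T_def by (rule hall_mult_sylow(3)[OF N pr P cP that])
  have "normalizes (N <#> carrier G) T"
    using ch
  proof (induction rule: rtranclp_induct)
    case base
    show ?case using subgroup_normalizes_self[OF T] unfolding T_def .
  next
    case (step H K)
    have PH: "P \<subseteq> H" using prime_stepsD[OF step.hyps(1) P] by blast
    define M where "M = N <#> H"
    define X where "X = N <#> K"
    have nM: "normalizes M T" using step.IH unfolding M_def .
    show ?case
    proof (cases "M = X")
      case True then show ?thesis using nM unfolding X_def by simp
    next
      case False
      then have MX: "prime_step M X" using prime_step_mult[OF step.hyps(2) Ns Nn] unfolding M_def X_def by blast
      have M: "subgroup M G" and X: "subgroup X G" and sub: "M \<subseteq> X" and prs: "prime (card X div card M)"
        using MX unfolding prime_step_def by auto
      have TM: "T \<subseteq> M" unfolding T_def M_def by (rule set_mult_mono) (use PH in auto)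
      define s where "s = card X div card M"
      have cX: "card X = s * card M" unfolding s_def using subgroup_card_dvd[OF M X sub] by simp
      \<comment> \<open>T already carries the full power of each prime from p on, so no such prime
        is left for an index above T.\<close>
      have idx: "\<not> q dvd card X div card M" "\<not> q dvd card M div card T" if q: "prime q" "p \<le> q" for q
      proof -
        have 1: "multiplicity q (card T) = multiplicity q (order G)" using multT q by simp
        have 2: "multiplicity q (card T) \<le> multiplicity q (card M)"
          by (rule dvd_imp_multiplicity_le[OF subgroup_card_dvd[OF T M TM]]) (use subgroup_card_pos[OF M] in simp)
        have 3: "multiplicity q (card Y) \<le> multiplicity q (order G)" if "subgroup Y G" for Y
          by (rule dvd_imp_multiplicity_le[OF subgroup_card_dvd_order[OF that]]) (use order_pos in simp)
        show "\<not> q dvd card X div card M"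
          by (rule not_dvd_index[OF M X sub q(1)]) (use 1 2 3[OF X] in simp)
        show "\<not> q dvd card M div card T"
          by (rule not_dvd_index[OF T M TM q(1)]) (use 1 3[OF M] in simp)
      qed
      have sp: "s < p" using idx(1)[OF prs] unfolding s_def by (meson dvd_refl not_le)
      show ?thesis unfolding normalizes_def X_def[symmetric]
      proof (intro ballI)
        fix x h assume x: "x \<in> X" and h: "h \<in> T"
        have xc: "x \<in> carrier G" using x subgroup.mem_carrier[OF X] by blast
        define Q where "Q = (\<lambda>h. x \<otimes> h \<otimes> inv x) ` P"
        have Q: "subgroup Q G" unfolding Q_def by (rule conj_subgroup[OF P xc])
        have cQ: "card Q = p ^ multiplicity p (order G)" unfolding Q_def
          using conj_card[OF subgroup.subset[OF P] xc] cP by simp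
        have QX: "Q \<subseteq> X" unfolding Q_def using x PT TM sub X
          by (auto intro!: subgroup.m_closed subgroup.m_inv_closed)
        have QM: "subgroup (Q \<inter> M) G" by (rule subgroups_Inter_pair[OF Q M])
        obtain k where k: "card Q = card (Q \<inter> M) * k" using subgroup_card_dvd[OF QM Q] by auto
        \<comment> \<open>The product Q M fits into X, so the index k of Q \<inter> M in Q is at
          most s. A power of p that is smaller than p is 1.\<close>
        have "card (Q <#> M) \<le> card X"
          by (rule card_mono[OF subgroup_finite[OF X] set_mult_subset[OF X QX sub]])
        then have "card (Q <#> M) * card (Q \<inter> M) \<le> s * card M * card (Q \<inter> M)" unfolding cX by simp
        then have "card (Q \<inter> M) * k * card M \<le> s * card M * card (Q \<inter> M)"
          using card_set_mult[OF Q M] k by simp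
        then have "k \<le> s" using subgroup_card_pos[OF M] subgroup_card_pos[OF QM] by (simp add: mult_ac)
        moreover have "k dvd p ^ multiplicity p (order G)" using k cQ by (metis dvd_triv_right)
        ultimately have "k = 1" using dvd_prime_power_le_eq_1[OF pr] sp by simp
        then have "Q \<inter> M = Q" using k subgroup_finite[OF Q] by (intro card_subset_eq) auto
        then have QsM: "Q \<subseteq> M" by blast
        have "Q \<subseteq> T"
        proof (rule coprime_index_subset[OF Q T M QsM TM normalizes_mono[OF nM QsM]])
          show "coprime (card Q) (card M div card T)"
            unfolding cQ using idx(2)[OF pr] pr by (simp add: prime_imp_coprime)
        qed
        then have PQ: "x \<otimes> u \<otimes> inv x \<in> T" if "u \<in> P" for u using that unfolding Q_def by blast
        obtain n u where nu: "n \<in> N" "u \<in> P" "h = n \<otimes> u" using h unfolding T_def by (rule set_multE)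
        have c: "n \<in> carrier G" "u \<in> carrier G" using nu subgroup.mem_carrier[OF Ns] subgroup.mem_carrier[OF P] by auto
        have "x \<otimes> n \<otimes> inv x \<in> T" using Nn nu xc NT unfolding normalizes_def by blast
        moreover have "x \<otimes> h \<otimes> inv x = (x \<otimes> n \<otimes> inv x) \<otimes> (x \<otimes> u \<otimes> inv x)"
          unfolding nu(3) using xc c by (simp add: m_assoc) (simp add: m_assoc[symmetric])
        ultimately show "x \<otimes> h \<otimes> inv x \<in> T" using subgroup.m_closed[OF T] PQ[OF nu(2)] by simp
      qed
    qed
  qed
  moreover have "N <#> carrier G = carrier G"
    using subset_set_mult_right[OF Ns] set_mult_subset[OF carrier_subgroup subgroup.subset[OF Ns]] by blast
  ultimately show ?thesis unfolding T_def by simp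
qed

section \<open>Cyclic subgroups of r-groups normalised by P\<close>

lemma conj_nat_pow:
  assumes "x \<in> carrier G" "y \<in> carrier G"
  shows "(x \<otimes> y \<otimes> inv x) [^] (k::nat) = x \<otimes> y [^] k \<otimes> inv x"
proof (induction k)
  case 0 then show ?case using assms by simp
next
  case (Suc k)
  have "y [^] k \<in> carrier G" using assms by simp
  then show ?case unfolding nat_pow_Suc Suc using assms by (simp add: m_assoc) (simp add: m_assoc[symmetric])
qed

lemma conj_generate:
  assumes "x \<in> carrier G" "y \<in> carrier G"
  shows "(\<lambda>h. x \<otimes> h \<otimes> inv x) ` generate G {y} = generate G {x \<otimes> y \<otimes> inv x}"
proof -
  have "x \<otimes> y \<otimes> inv x \<in> carrier G" using assms by simp
  then show ?thesis
    using generate_nat_pow assms conj_nat_pow[OF assms] by (auto simp: image_iff) metis+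
qed

text \<open>The non-generators of a cyclic r-group form its subgroup of index r. The factor r - 1 is
  kept apart because it cancels in the count over all cyclic subgroups.\<close>

lemma card_generators:
  assumes a: "a \<in> carrier G" and r: "prime (r::nat)" and oa: "ord a = r ^ Suc j"
  shows "card {y \<in> generate G {a}. generate G {y} = generate G {a}} = (r - 1) * (ord a div r)"
proof -
  define X where "X = generate G {a}"
  have X: "subgroup X G" unfolding X_def by (rule generate_single_subgroup[OF a])
  have cX: "card X = ord a" unfolding X_def by (rule generate_single_card[OF a])
  have ar: "a [^] r \<in> carrier G" using a by simp
  have r0: "r > 0" using r by (rule prime_gt_0_nat)
  define Y where "Y = generate G {a [^] r}"
  have cY: "card Y = ord a div r" unfolding Y_def generate_single_card[OF ar]
    by (rule ord_pow[OF a]) (use oa r0 in auto)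
  have YX: "Y \<subseteq> X" unfolding Y_def X_def
    using generate_nat_pow[OF a] generate_subgroup_incl[OF _ generate_single_subgroup[OF a]] by blast
  have iff: "generate G {y} = X \<longleftrightarrow> y \<notin> Y" if y: "y \<in> X" for y
  proof -
    obtain k :: nat where k: "y = a [^] k" using y generate_nat_pow[OF a] unfolding X_def by blast
    have yc: "y \<in> carrier G" using k a by simp
    show ?thesis
    proof
      assume eq: "generate G {y} = X"
      show "y \<notin> Y"
      proof
        assume "y \<in> Y"
        then have "generate G {y} \<subseteq> Y" unfolding Y_def
          using generate_subgroup_incl[OF _ generate_single_subgroup[OF ar]] by blast
        then have "card X \<le> card Y" using eq subgroup_finite[OF generate_single_subgroup[OF ar]]
          unfolding Y_def by (metis card_mono)
        then show False using cX cY oa prime_gt_1_nat[OF r] by simp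
      qed
    next
      assume nY: "y \<notin> Y"
      have "\<not> r dvd k"
      proof
        assume "r dvd k"
        then obtain l where "k = r * l" by blast
        then have "y = (a [^] r) [^] l" using k a by (simp add: nat_pow_pow)
        then show False using nY generate_nat_pow[OF ar] unfolding Y_def by blast
      qed
      then have "coprime (ord a) k" unfolding oa using r by (simp add: prime_imp_coprime)
      then have "ord y = ord a" unfolding k ord_pow_gen[OF a] using \<open>\<not> r dvd k\<close> by auto
      then have "card (generate G {y}) = card X" using generate_single_card[OF yc] cX by simp
      moreover have "generate G {y} \<subseteq> X" using generate_subgroup_incl[OF _ X] y by blast
      ultimately show "generate G {y} = X" using subgroup_finite[OF X] by (metis card_subset_eq)
    qed
  qed
  then have "{y \<in> X. generate G {y} = X} = X - Y" by blast
  then have "card {y \<in> X. generate G {y} = X} = ord a - ord a div r"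
    using card_Diff_subset[OF finite_subset[OF YX subgroup_finite[OF X]] YX] cX cY by simp
  moreover have "ord a = r * (ord a div r)" using oa by simp
  then have "ord a - ord a div r = (r - 1) * (ord a div r)" by (metis diff_mult_distrib nat_mult_1)
  ultimately show ?thesis unfolding X_def by simp
qed

text \<open>Counting generators gives that the numbers card X / r, taken over the cyclic subgroups X of R
  not contained in S, sum to card S, which is prime to p. So P fixes one of these X.\<close>
lemma invariant_cyclic_subgroup:
  assumes R: "subgroup R G" and S: "subgroup S G" and SR: "S \<subseteq> R" and r: "prime (r::nat)"
    and cR: "card R = r ^ k" and idx: "card R = r * card S"
    and P: "subgroup P G" and p: "prime (p::nat)" and cP: "card P = p ^ n" and pr: "p \<noteq> r"
    and nR: "normalizes P R" and nS: "normalizes P S"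
  shows "\<exists>y\<in>R - S. normalizes P (generate G {y})"
proof -
  note rc = subgroup.mem_carrier[OF R] and pc = subgroup.mem_carrier[OF P]
  define XX where "XX = (\<lambda>y. generate G {y}) ` (R - S)"
  have fR: "finite R" by (rule subgroup_finite[OF R])
  have fXX: "finite XX" unfolding XX_def using fR by simp
  have genR: "generate G {y} \<subseteq> R" if "y \<in> R" for y using generate_subgroup_incl[OF _ R] that by blast
  have fib: "card {y \<in> R - S. generate G {y} = X} = (r - 1) * (card X div r)" if XXX: "X \<in> XX" for X
  proof -
    obtain a where a: "a \<in> R" "a \<notin> S" "X = generate G {a}" using XXX unfolding XX_def by blast
    have ac: "a \<in> carrier G" using a rc by blast
    \<comment> \<open>No generator of X lies in S, since X would then lie in S; so the fibre
      consists of all generators of X.\<close>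
    have "{y \<in> R - S. generate G {y} = X} = {y \<in> X. generate G {y} = X}"
    proof -
      have "y \<in> X" if "generate G {y} = X" for y using that generate_single_self by blast
      moreover have "y \<notin> S" if "generate G {y} = X" for y
        using that generate_subgroup_incl[OF _ S, of "{y}"] a generate_single_self[of a] by blast
      ultimately show ?thesis using genR[OF a(1)] a(3) by blast
    qed
    moreover have "ord a dvd r ^ k"
      using subgroup_card_dvd[OF generate_single_subgroup[OF ac] R genR[OF a(1)]] generate_single_card[OF ac] cR by simp
    then obtain i where i: "ord a = r ^ i" using r by (auto simp: divides_primepow_nat)
    have "i \<noteq> 0"
    proof
      assume "i = 0"
      then have "a = \<one>" using i ord_eq_1[OF ac] by simp
      then show False using a subgroup.one_closed[OF S] by simp
    qed
    then obtain j where "i = Suc j" using not0_implies_Suc by blast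
    then have "card {y \<in> generate G {a}. generate G {y} = generate G {a}} = (r - 1) * (ord a div r)"
      using card_generators[OF ac r] i by simp
    ultimately show ?thesis using a(3) generate_single_card[OF ac] by simp
  qed
  have "card (R - S) = (\<Sum>y\<in>R - S. 1)" by simp
  also have "\<dots> = (\<Sum>X\<in>XX. \<Sum>y\<in>{y \<in> R - S. generate G {y} = X}. 1)"
    unfolding XX_def by (rule sum.image_gen) (use fR in simp)
  also have "\<dots> = (\<Sum>X\<in>XX. (r - 1) * (card X div r))" using fib by (intro sum.cong) auto
  also have "\<dots> = (r - 1) * (\<Sum>X\<in>XX. card X div r)" by (simp add: sum_distrib_left)
  finally have "(r - 1) * card S = (r - 1) * (\<Sum>X\<in>XX. card X div r)"
    using card_Diff_subset[OF subgroup_finite[OF S] SR] idx by (simp add: diff_mult_distrib)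
  then have cS: "card S = (\<Sum>X\<in>XX. card X div r)" using prime_gt_1_nat[OF r] by simp
  \<comment> \<open>Repeating each X exactly \<open>card X div r\<close> times turns the weighted
    sum into the size of a set. P acts on it through the first component, and conjugation preserves
    the number of repetitions.\<close>
  define W where "W = (SIGMA X:XX. {..<card X div r})"
  have cW: "card W = card S" unfolding W_def cS using fXX by (subst card_SigmaI) auto
  have "card S dvd r ^ k" using subgroup_card_dvd[OF S R SR] cR by simp
  then have "\<not> p dvd card S" using p r pr by (metis dvd_trans prime_dvd_power primes_dvd_imp_eq)
  then have nW: "\<not> p dvd card W" using cW by simp
  define act where "act x w = ((\<lambda>h. x \<otimes> h \<otimes> inv x) ` fst w, snd w)" for x and w :: "'a set \<times> nat"
  have XXc: "X \<subseteq> carrier G" if "X \<in> XX" for X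
    using that genR rc unfolding XX_def by blast
  have "\<exists>w\<in>W. \<forall>x\<in>P. act x w = w"
  proof (rule p_group_fixed_point[OF P p cP _ nW])
    show "finite W" unfolding W_def using fXX by simp
    show "act x w \<in> W" if x: "x \<in> P" and w: "w \<in> W" for x w
    proof -
      obtain X i where X: "w = (X, i)" "X \<in> XX" "i < card X div r" using w unfolding W_def by auto
      obtain y where y: "y \<in> R" "y \<notin> S" "X = generate G {y}" using X unfolding XX_def by blast
      have 1: "x \<otimes> y \<otimes> inv x \<in> R" using nR x y unfolding normalizes_def by blast
      have 2: "x \<otimes> y \<otimes> inv x \<notin> S"
      proof
        assume "x \<otimes> y \<otimes> inv x \<in> S"
        then have "inv x \<otimes> (x \<otimes> y \<otimes> inv x) \<otimes> x \<in> S"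
          using normalizes_inv[OF S pc[OF x]] normalizes_mono[OF nS] x by blast
        moreover have "inv x \<otimes> (x \<otimes> y \<otimes> inv x) \<otimes> x = y" using pc[OF x] rc[OF y(1)]
          by (simp add: m_assoc) (simp add: m_assoc[symmetric])
        ultimately show False using y by simp
      qed
      have "(\<lambda>h. x \<otimes> h \<otimes> inv x) ` X \<in> XX"
        unfolding y(3) conj_generate[OF pc[OF x] rc[OF y(1)]] XX_def using 1 2 by blast
      moreover have "card ((\<lambda>h. x \<otimes> h \<otimes> inv x) ` X) = card X" by (rule conj_card[OF XXc[OF X(2)] pc[OF x]])
      ultimately show ?thesis using X unfolding act_def W_def by simp
    qed
    show "act \<one> w = w" if w: "w \<in> W" for w
    proof -
      have "fst w \<subseteq> carrier G" using w XXc[of "fst w"] unfolding W_def by auto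
      then have "(\<lambda>h. \<one> \<otimes> h \<otimes> inv \<one>) ` fst w = (\<lambda>h. h) ` fst w" by (intro image_cong) auto
      then show ?thesis unfolding act_def by simp
    qed
    show "act (x \<otimes> y) w = act x (act y w)" if x: "x \<in> P" and y: "y \<in> P" and w: "w \<in> W" for x y w
    proof -
      have "fst w \<subseteq> carrier G" using w XXc[of "fst w"] unfolding W_def by auto
      then have "(\<lambda>h. x \<otimes> y \<otimes> h \<otimes> inv (x \<otimes> y)) ` fst w = (\<lambda>h. x \<otimes> (y \<otimes> h \<otimes> inv y) \<otimes> inv x) ` fst w"
        using pc[OF x] pc[OF y] by (intro image_cong) (auto simp: inv_mult_group m_assoc subset_iff)
      then show ?thesis unfolding act_def by (simp add: image_image)
    qed
  qed
  then obtain X i where X: "X \<in> XX" "\<forall>x\<in>P. (\<lambda>h. x \<otimes> h \<otimes> inv x) ` X = X"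
    unfolding W_def act_def by auto
  then obtain y where "y \<in> R - S" "X = generate G {y}" unfolding XX_def by blast
  then show ?thesis using X(2) unfolding normalizes_def by blast
qed

lemma normalizes_Int: "normalizes A H \<Longrightarrow> normalizes A K \<Longrightarrow> normalizes A (H \<inter> K)"
  unfolding normalizes_def by blast

lemma hall_unique: "hall m N \<Longrightarrow> hall m N' \<Longrightarrow> N = N'"
  by (meson hall_subgroup hall_subset hall_prime_dvd subset_antisym)

text \<open>Along the chain from P to G, the subgroup R meets A H in larger and larger P-invariant
  subgroups, each of index 1 or r in the next.\<close>
lemma subnormal_invariant_subset:
  assumes ch: "prime_step\<^sup>*\<^sup>* P (carrier G)" and P: "subgroup P G" and p: "prime p" and cP: "card P = p ^ n"
    and hA: "hall r A" and hB: "hall (r - 1) B" and r: "prime r" and less: "p < r"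
    and R: "subgroup R G" and cR: "card R = r ^ k" and nR: "normalizes P R"
    and D: "subgroup D G" and inD: "\<And>y. y \<in> R \<Longrightarrow> normalizes P (generate G {y}) \<Longrightarrow> y \<in> D"
  shows "R \<subseteq> D"
proof -
  note A = hall_subgroup[OF hA] and B = hall_subgroup[OF hB] and An = hall_normal[OF hA] and Bn = hall_normal[OF hB]
  have AB: "A \<subseteq> B" by (rule hall_subset[OF hB A]) (meson hall_prime_dvd[OF hA] less_imp_diff_less)
  have RB: "R \<subseteq> B"
  proof (rule hall_subset[OF hB R])
    fix q assume "prime q" "q dvd card R"
    then have "q = r" using cR r by (metis prime_dvd_power primes_dvd_imp_eq)
    then show "r - 1 < q" using prime_gt_0_nat[OF r] by simp
  qed
  have "P \<subseteq> carrier G \<and> R \<inter> (A <#> carrier G) \<subseteq> D"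
    using ch
  proof (induction rule: rtranclp_induct)
    case base
    have AP: "subgroup (A <#> P) G"
      by (rule set_mult_subgroup[OF A P normalizes_mono[OF An subgroup.subset[OF P]]])
    have cAP: "card (A <#> P) = card A * card P"
      by (rule card_set_mult_coprime[OF A P]) (use hall_coprime_power[OF hA p] less cP in simp)
    have "\<not> r dvd card A" using hall_prime_dvd[OF hA r] by auto
    moreover have "\<not> r dvd card P" using cP p r less by (metis order_less_irrefl prime_dvd_power primes_dvd_imp_eq)
    ultimately have "\<not> r dvd card (A <#> P)" using cAP r by (simp add: prime_dvd_mult_iff)
    then have "coprime (card R) (card (A <#> P))" using cR r by (simp add: prime_imp_coprime)
    then have "R \<inter> (A <#> P) = {\<one>}" by (rule coprime_Int_trivial[OF R AP])
    then show ?case using subgroup.subset[OF P] subgroup.one_closed[OF D] by simp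
  next
    case (step H K)
    have PH: "P \<subseteq> H" and PK: "P \<subseteq> K"
      using prime_stepsD[OF step.hyps(1) P] step.hyps(2) unfolding prime_step_def by auto
    define M where "M = A <#> H"
    define X where "X = A <#> K"
    have IH: "R \<inter> M \<subseteq> D" using step.IH unfolding M_def by simp
    have "R \<inter> X \<subseteq> D"
    proof (cases "M = X \<or> R \<inter> X \<subseteq> M")
      case True then show ?thesis using IH by blast
    next
      case False
      then have MX: "prime_step M X" using prime_step_mult[OF step.hyps(2) A An] unfolding M_def X_def by blast
      have M: "subgroup M G" and X: "subgroup X G" and sub: "M \<subseteq> X" and prs: "prime (card X div card M)"
        using MX unfolding prime_step_def by auto
      have HS: "subgroup H G" and KS: "subgroup K G" using step.hyps(2) unfolding prime_step_def by auto
      have PM: "P \<subseteq> M" using PH subset_set_mult_right[OF A subgroup.subset[OF HS]] unfolding M_def by blast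
      have PX: "P \<subseteq> X" using PM sub by blast
      have AM: "A \<subseteq> M" unfolding M_def by (rule subset_set_mult_left[OF subgroup.subset[OF A] HS])
      define s where "s = card X div card M"
      have cX: "card X = s * card M" unfolding s_def using subgroup_card_dvd[OF M X sub] by simp
      have XB: "subgroup (X \<inter> B) G" and MB: "subgroup (M \<inter> B) G"
        using subgroups_Inter_pair[OF X B] subgroups_Inter_pair[OF M B] by auto
      have "normalizes M (X \<inter> B)"
        by (rule normalizes_Int[OF normalizes_mono[OF subgroup_normalizes_self[OF X] sub]
            normalizes_mono[OF Bn subgroup.subset[OF M]]])
      then have L: "subgroup ((X \<inter> B) <#> M) G" by (rule set_mult_subgroup[OF XB M])
      have MsubL: "M \<subseteq> (X \<inter> B) <#> M" by (rule subset_set_mult_right[OF XB subgroup.subset[OF M]])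
      have BL: "X \<inter> B \<subseteq> (X \<inter> B) <#> M" by (rule subset_set_mult_left[OF subgroup.subset[OF XB] M])
      have "(X \<inter> B) <#> M \<subseteq> X" by (rule set_mult_subset[OF X]) (use sub in auto)
      \<comment> \<open>The product contains R \<inter> X, which is not inside M, so it must be X.
        Hence M \<inter> B has index s in X \<inter> B.\<close>
      then have "(X \<inter> B) <#> M = M \<or> (X \<inter> B) <#> M = X" using prime_step_between[OF MX L MsubL] by blast
      then have "(X \<inter> B) <#> M = X" using False RB BL by blast
      then have "card X * card (X \<inter> B \<inter> M) = card (X \<inter> B) * card M" using card_set_mult[OF XB M] by simp
      moreover have "X \<inter> B \<inter> M = M \<inter> B" using sub by blast
      ultimately have cXB: "card (X \<inter> B) = s * card (M \<inter> B)" using cX subgroup_card_pos[OF M] by simp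
      \<comment> \<open>Outside r the orders of A and B have the same prime powers, and A lies in M
        \<inter> B. So only r can divide the index of M \<inter> B in X \<inter> B.\<close>
      have sr: "s = r"
      proof (rule ccontr)
        assume ne: "s \<noteq> r"
        have prs2: "prime s" using prs unfolding s_def .
        have "multiplicity s (card (X \<inter> B)) \<le> multiplicity s (card B)"
          by (rule dvd_imp_multiplicity_le[OF subgroup_card_dvd[OF XB B]]) (use subgroup_card_pos[OF B] in auto)
        also have "\<dots> = multiplicity s (card A)"
          using hA hB prs2 ne prime_gt_0_nat[OF r] unfolding hall_def by auto
        also have "\<dots> \<le> multiplicity s (card (M \<inter> B))"
          by (rule dvd_imp_multiplicity_le[OF subgroup_card_dvd[OF A MB]]) (use AM AB subgroup_card_pos[OF MB] in auto)
        finally have "\<not> s dvd card (X \<inter> B) div card (M \<inter> B)"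
          using not_dvd_index[OF MB XB _ prs2] sub by blast
        then show False using cXB subgroup_card_pos[OF MB] by simp
      qed
      define R1 where "R1 = R \<inter> X"
      define R0 where "R0 = R \<inter> M"
      have R1: "subgroup R1 G" and R0: "subgroup R0 G"
        unfolding R1_def R0_def using subgroups_Inter_pair[OF R X] subgroups_Inter_pair[OF R M] by auto
      have R01: "R0 \<subseteq> R1" unfolding R1_def R0_def using sub by blast
      have ne: "R0 \<noteq> R1" using False unfolding R1_def R0_def by blast
      have "card R1 dvd r ^ k" using subgroup_card_dvd[OF R1 R] cR unfolding R1_def by simp
      then obtain j where j: "card R1 = r ^ j" using r by (auto simp: divides_primepow_nat)
      \<comment> \<open>The index c of R0 in R1 is a power of r other than 1, so at least r. It is
        at most r because R1 M fits into X.\<close>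
      obtain c where c: "card R1 = card R0 * c" using subgroup_card_dvd[OF R0 R1 R01] by blast
      have cd: "c dvd r ^ j" using c j by (metis dvd_triv_right)
      have "c \<noteq> 1" using ne c R01 subgroup_finite[OF R1] by (auto dest: card_subset_eq)
      then have cr: "r \<le> c" using dvd_prime_power_le_eq_1[OF r cd] by (meson not_le)
      have "card (R1 <#> M) \<le> card X"
        by (rule card_mono[OF subgroup_finite[OF X] set_mult_subset[OF X]]) (use sub in \<open>auto simp: R1_def\<close>)
      then have "card (R1 <#> M) * card (R1 \<inter> M) \<le> r * card M * card (R1 \<inter> M)" unfolding cX sr by simp
      moreover have "R1 \<inter> M = R0" unfolding R1_def R0_def using sub by blast
      ultimately have "card R0 * c * card M \<le> r * card M * card R0" using card_set_mult[OF R1 M] by (metis c)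
      then have "c \<le> r" using subgroup_card_pos[OF M] subgroup_card_pos[OF R0] by (simp add: mult_ac)
      then have idx: "card R1 = r * card R0" using cr c by simp
      have nR1: "normalizes P R1" unfolding R1_def
        by (rule normalizes_Int[OF nR normalizes_mono[OF subgroup_normalizes_self[OF X] PX]])
      have nR0: "normalizes P R0" unfolding R0_def
        by (rule normalizes_Int[OF nR normalizes_mono[OF subgroup_normalizes_self[OF M] PM]])
      have "p \<noteq> r" using less by simp
      then obtain y where y: "y \<in> R1 - R0" "normalizes P (generate G {y})"
        using invariant_cyclic_subgroup[OF R1 R0 R01 r j idx P p cP _ nR1 nR0] by blast
      have yD: "y \<in> D" using inD y unfolding R1_def by blast
      have st: "prime_step R0 R1" unfolding prime_step_def
        using R0 R1 R01 idx r subgroup_card_pos[OF R0] by simp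
      \<comment> \<open>R0 has prime index in R1, so D, which contains R0 and the element y outside
        it, contains all of R1.\<close>
      have "R1 \<inter> D = R0 \<or> R1 \<inter> D = R1"
        by (rule prime_step_between[OF st subgroups_Inter_pair[OF R1 D]]) (use R01 IH in \<open>auto simp: R0_def\<close>)
      then have "R1 \<inter> D = R1" using y(1) yD by blast
      then show ?thesis unfolding R1_def by blast
    qed
    then show ?case using PK unfolding X_def by blast
  qed
  moreover have "A <#> carrier G = carrier G"
    using subset_set_mult_right[OF A] set_mult_subset[OF carrier_subgroup subgroup.subset[OF A]] by blast
  ultimately show ?thesis using subgroup.subset[OF R] by auto
qed

section \<open>From P-subnormal to strongly permuteral\<close>

definition permuting :: "'a set \<Rightarrow> 'a set \<Rightarrow> 'a set" where
  "permuting P U = {x \<in> U. generate G {x} <#> P = P <#> generate G {x}}"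

lemma permutizer_restrict:
  assumes U: "subgroup U G"
  shows "permutizer (G\<lparr>carrier := U\<rparr>) P = generate G (permuting P U)"
proof -
  have "generate (G\<lparr>carrier := U\<rparr>) {x} = generate G {x}" if "x \<in> U" for x
    by (rule generate_consistent) (use that U in auto)
  then have "{x \<in> U. generate (G\<lparr>carrier := U\<rparr>) {x} <#> P = P <#> generate (G\<lparr>carrier := U\<rparr>) {x}} = permuting P U"
    unfolding permuting_def by auto
  then show ?thesis unfolding permutizer_def
    using generate_consistent[of "permuting P U" U] U by (simp add: permuting_def)
qed

text \<open>One of two sources of permuting elements; in \<open>permuting_if_normalized\<close> the
  roles of P and of the cyclic group are exchanged.\<close>

lemma permuting_if_normalizes:
  assumes P: "subgroup P G" and U: "subgroup U G" and x: "x \<in> U" and n: "normalizes {x} P"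
  shows "x \<in> permuting P U"
proof -
  have xc: "x \<in> carrier G" by (rule subgroup.mem_carrier[OF U x])
  have "x \<in> {x \<in> carrier G. normalizes {x} P}" using xc n by simp
  then have "generate G {x} \<subseteq> {x \<in> carrier G. normalizes {x} P}"
    by (intro generate_subgroup_incl subgroup_normalizer_in[OF P carrier_subgroup] insert_subsetI empty_subsetI)
  then have n2: "normalizes {y} P" if "y \<in> generate G {x}" for y using that by blast
  have "normalizes (generate G {x}) P" unfolding normalizes_def
    using n2 unfolding normalizes_def by (metis singletonI)
  then show ?thesis unfolding permuting_def
    using normalizes_commute[OF P generate_single_subgroup[OF xc]] x by simp
qed

lemma permuting_if_normalized:
  assumes P: "subgroup P G" and U: "subgroup U G" and x: "x \<in> U" and n: "normalizes P (generate G {x})"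
  shows "x \<in> permuting P U"
proof -
  have xc: "x \<in> carrier G" by (rule subgroup.mem_carrier[OF U x])
  show ?thesis unfolding permuting_def
    using normalizes_commute[OF generate_single_subgroup[OF xc] P n] x by simp
qed

text \<open>K \<inter> D contains a full Sylow subgroup of K for every prime divisor, so it has the
  order of K.\<close>

lemma subset_if_sylow_subset:
  assumes K: "subgroup K G" and D: "subgroup D G"
    and sub: "\<And>r. prime r \<Longrightarrow> r dvd card K \<Longrightarrow> \<exists>R. subgroup R G \<and> R \<subseteq> K \<inter> D \<and> card R = r ^ multiplicity r (card K)"
  shows "K \<subseteq> D"
proof -
  have KD: "subgroup (K \<inter> D) G" by (rule subgroups_Inter_pair[OF K D])
  have "card K dvd card (K \<inter> D)"
  proof (rule multiplicity_le_imp_dvd)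
    show "card K \<noteq> 0" using subgroup_card_pos[OF K] by simp
    fix r :: nat assume r: "prime r"
    show "multiplicity r (card K) \<le> multiplicity r (card (K \<inter> D))"
    proof (cases "r dvd card K")
      case True
      then obtain R where R: "subgroup R G" "R \<subseteq> K \<inter> D" "card R = r ^ multiplicity r (card K)" using sub r by blast
      show ?thesis
        using dvd_imp_multiplicity_le[OF subgroup_card_dvd[OF R(1) KD R(2)], of r] R(3) r subgroup_card_pos[OF KD] by simp
    qed (simp add: not_dvd_imp_multiplicity_0)
  qed
  then have "card K \<le> card (K \<inter> D)" using subgroup_card_pos[OF KD] by (simp add: dvd_imp_le)
  then have "K \<inter> D = K" using subgroup_finite[OF K] by (intro card_seteq) auto
  then show ?thesis by blast
qed

text \<open>With K = N \<inter> U, the group K P = N P \<inter> U is normal in U, which gives U = K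
  P N_U(P). Elements normalising P permute with it, and K is captured prime by prime through
  P-invariant Sylow subgroups.\<close>

lemma subnormal_sylow_strongly_permuteral:
  assumes tower: "\<And>m. \<exists>N. hall m N" and p: "prime p" and P: "subgroup P G"
    and cP: "card P = p ^ multiplicity p (order G)" and ch: "prime_step\<^sup>*\<^sup>* P (carrier G)"
  shows "strongly_permuteral P G"
  unfolding strongly_permuteral_def
proof (intro conjI allI impI P; elim conjE)
  fix U assume U: "subgroup U G" and PU: "P \<subseteq> U"
  define D where "D = generate G (permuting P U)"
  have uc: "U \<subseteq> carrier G" by (rule subgroup.subset[OF U])
  have pU: "permuting P U \<subseteq> U" unfolding permuting_def by blast
  have D: "subgroup D G" unfolding D_def by (rule generate_is_subgroup) (use pU uc in blast)
  have DU: "D \<subseteq> U" unfolding D_def by (rule generate_subgroup_incl[OF pU U])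
  have pD: "permuting P U \<subseteq> D" unfolding D_def by (auto intro: generate.incl)
  obtain N where N: "hall p N" using tower by blast
  note Ns = hall_subgroup[OF N]
  have nNP: "normalizes (carrier G) (N <#> P)" by (rule subnormal_sylow_normal[OF p N P cP ch])
  have NP: "subgroup (N <#> P) G" by (rule hall_mult_sylow[OF N p P cP])
  define K where "K = N \<inter> U"
  have K: "subgroup K G" unfolding K_def by (rule subgroups_Inter_pair[OF Ns U])
  define T where "T = (N <#> P) \<inter> U"
  have T: "subgroup T G" unfolding T_def by (rule subgroups_Inter_pair[OF NP U])
  have TKP: "T = K <#> P" unfolding T_def K_def by (rule dedekind_law[OF U Ns PU])
  have PT: "P \<subseteq> T" unfolding TKP by (rule subset_set_mult_right[OF K subgroup.subset[OF P]])
  have nT: "normalizes U T" unfolding T_def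
    by (rule normalizes_Int[OF normalizes_mono[OF nNP uc] subgroup_normalizes_self[OF U]])
  have "U = T <#> {x \<in> U. normalizes {x} P}"
  proof (rule frattini_argument[OF T U P PT _ nT p cP])
    show "T \<subseteq> U" unfolding T_def by blast
    show "\<not> p dvd card T div card P"
    proof (rule not_dvd_index[OF P T PT p])
      show "multiplicity p (card T) \<le> multiplicity p (card P)"
        using dvd_imp_multiplicity_le[OF subgroup_card_dvd_order[OF T]] order_pos cP p by simp
    qed
  qed
  moreover have "{x \<in> U. normalizes {x} P} \<subseteq> D" using permuting_if_normalizes[OF P U] pD by blast
  moreover have "P \<subseteq> D"
  proof
    fix x assume "x \<in> P"
    then show "x \<in> D"
      using permuting_if_normalizes[OF P U, of x] normalizes_mono[OF subgroup_normalizes_self[OF P], of "{x}"] PU pD by blast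
  qed
  moreover have "K \<subseteq> D"
  proof (rule subset_if_sylow_subset[OF K D])
    fix r assume r: "prime r" "r dvd card K"
    have Kdvd: "card K dvd card N" by (rule subgroup_card_dvd[OF K Ns]) (simp add: K_def)
    have pr: "p < r" using hall_prime_dvd[OF N r(1)] r(2) Kdvd dvd_trans by blast
    have nPK: "normalizes P K" unfolding K_def
      by (rule normalizes_Int[OF hall_normalizes[OF N subgroup.subset[OF P]]
          normalizes_mono[OF subgroup_normalizes_self[OF U] PU]])
    have "\<not> p dvd card K" using hall_prime_dvd[OF N p] Kdvd dvd_trans by blast
    then obtain R where R: "subgroup R G" "R \<subseteq> K" "card R = r ^ multiplicity r (card K)" "normalizes P R"
      using invariant_sylow[OF K P p cP nPK _ r(1)] by blast
    obtain A where A: "hall r A" using tower by blast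
    obtain B where B: "hall (r - 1) B" using tower by blast
    have "R \<subseteq> D"
    proof (rule subnormal_invariant_subset[OF ch P p cP A B r(1) pr R(1,3,4) D])
      fix y assume y: "y \<in> R" "normalizes P (generate G {y})"
      then have "y \<in> U" using R(2) unfolding K_def by blast
      then show "y \<in> D" using permuting_if_normalized[OF P U _ y(2)] pD by blast
    qed
    then show "\<exists>R. subgroup R G \<and> R \<subseteq> K \<inter> D \<and> card R = r ^ multiplicity r (card K)" using R by blast
  qed
  ultimately have "U \<subseteq> D" unfolding TKP using set_mult_subset[OF D] by metis
  then show "permutizer (G\<lparr>carrier := U\<rparr>) P = U"
    unfolding permutizer_restrict[OF U] using DU unfolding D_def by blast
qed

subsection \<open>Invariant chains in p-groups\<close>

text \<open>S acts on the left cosets of S in R other than S itself. Their number is one less than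
  the index of S, hence prime to r. A fixed coset g S satisfies S g inside g S, so g^-1 normalises
  S.\<close>

lemma p_group_normalizer_grows:
  assumes R: "subgroup R G" and S: "subgroup S G" and SR: "S \<subset> R" and r: "prime (r::nat)" and cR: "card R = r ^ k"
  shows "\<exists>x\<in>R - S. normalizes {x} S"
proof -
  note rc = subgroup.mem_carrier[OF R] and sc = subgroup.subset[OF S]
  have SR': "S \<subseteq> R" using SR by blast
  define V where "V = (\<lambda>g. g <# S) ` R"
  have cV: "card V = card R div card S" and UV: "\<Union>V = R" using card_left_cosets[OF R S SR'] unfolding V_def by auto
  have fV: "finite V" unfolding V_def using subgroup_finite[OF R] by simp
  have oneS: "\<one> <# S = S" by (rule lcos_mult_one[OF sc])
  have SV: "S \<in> V" unfolding V_def using oneS subgroup.one_closed[OF R] by (metis image_eqI)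
  have Rdiv: "card R = card S * card V" unfolding cV using subgroup_card_dvd[OF S R SR'] by simp
  have "card V dvd r ^ k" using Rdiv cR by (metis dvd_triv_right)
  then obtain j where j: "card V = r ^ j" using r by (auto simp: divides_primepow_nat)
  have "j \<noteq> 0"
  proof
    assume "j = 0"
    then have "S = R" using Rdiv j SR' subgroup_finite[OF R] by (intro card_subset_eq) auto
    then show False using SR by blast
  qed
  then have "r dvd card V" unfolding j by simp
  moreover have "card V = Suc (card (V - {S}))" using fV SV by (rule card.remove)
  ultimately have nd: "\<not> r dvd card (V - {S})"
    using prime_gt_1_nat[OF r] by (metis One_nat_def dvd_1_iff_1 dvd_add_right_iff less_irrefl plus_1_eq_Suc add.commute)
  have "card S dvd r ^ k" using subgroup_card_dvd[OF S R SR'] cR by simp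
  then obtain i where i: "card S = r ^ i" using r by (auto simp: divides_primepow_nat)
  have Vc: "w \<subseteq> carrier G" if "w \<in> V" for w using that UV rc by blast
  have "\<exists>w\<in>V - {S}. \<forall>x\<in>S. x <# w = w"
  proof (rule p_group_fixed_point[OF S r i _ nd])
    show "finite (V - {S})" using fV by simp
    show "x <# w \<in> V - {S}" if x: "x \<in> S" and w: "w \<in> V - {S}" for x w
    proof -
      have xc: "x \<in> carrier G" using x sc by blast
      obtain g where g: "g \<in> R" "w = g <# S" using w unfolding V_def by blast
      have "x <# w = (x \<otimes> g) <# S" unfolding g using lcos_m_assoc[OF sc xc rc[OF g(1)]] .
      then have 1: "x <# w \<in> V" unfolding V_def using subgroup.m_closed[OF R] x SR' g by blast
      have "x <# w \<noteq> S"
      proof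
        assume eq: "x <# w = S"
        have "w = inv x <# (x <# w)" using lcos_m_assoc[OF Vc, of w "inv x" x] xc w lcos_mult_one[OF Vc, of w] by auto
        also have "\<dots> = S" unfolding eq using l_repr_independence[of "inv x" \<one> S] oneS subgroup.m_inv_closed[OF S x] S by simp
        finally show False using w by simp
      qed
      then show ?thesis using 1 by blast
    qed
    show "\<one> <# w = w" if "w \<in> V - {S}" for w using that Vc lcos_mult_one by blast
    show "x \<otimes> y <# w = x <# (y <# w)" if "x \<in> S" "y \<in> S" "w \<in> V - {S}" for x y w
      by (rule lcos_m_assoc[symmetric]) (use that Vc sc in blast)+
  qed
  then obtain g where g: "g \<in> R" "g <# S \<noteq> S" "\<forall>x\<in>S. x <# (g <# S) = g <# S" unfolding V_def by blast
  have gc: "g \<in> carrier G" using g rc by blast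
  have "g \<notin> S"
  proof
    assume "g \<in> S"
    then have "g <# S = S" using l_repr_independence[of g \<one> S] oneS S by simp
    then show False using g by simp
  qed
  then have ig: "inv g \<in> R - S"
    using g gc subgroup.m_inv_closed[OF R] subgroup.m_inv_closed[OF S, of "inv g"] by auto
  moreover have "normalizes {inv g} S" unfolding normalizes_def
  proof clarify
    fix h assume h: "h \<in> S"
    have hc: "h \<in> carrier G" using h sc by blast
    have "h \<otimes> g \<in> h <# (g <# S)" using left_coset_self[OF S gc] unfolding l_coset_def[of _ h] by blast
    then have "h \<otimes> g \<in> g <# S" using g(3) h by blast
    then obtain h' where h': "h' \<in> S" "h \<otimes> g = g \<otimes> h'" unfolding l_coset_def by blast
    have "inv g \<otimes> h \<otimes> inv (inv g) = inv g \<otimes> (g \<otimes> h')" using gc hc by (simp add: m_assoc h'(2))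
    also have "\<dots> = h'" using gc h' sc by (simp add: m_assoc[symmetric] subsetD)
    finally show "inv g \<otimes> h \<otimes> inv (inv g) \<in> S" using h' by simp
  qed
  ultimately show ?thesis by blast
qed

definition invariant_step :: "'a set \<Rightarrow> nat \<Rightarrow> 'a set \<Rightarrow> 'a set \<Rightarrow> bool" where
  "invariant_step P r S R \<longleftrightarrow> subgroup S G \<and> subgroup R G \<and> S \<subseteq> R \<and> card R = r * card S \<and>
     normalizes P S \<and> normalizes P R"

text \<open>Each element of P acts on <y> by y |-> y^j for some j, so it preserves the subgroup
  generated by any power of y.\<close>

lemma normalizes_generate:
  assumes P: "subgroup P G" and y: "y \<in> carrier G" and n: "normalizes P (generate G {y})"
  shows "normalizes P (generate G {y [^] (m::nat)})"
  unfolding normalizes_def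
proof (intro ballI)
  fix a h assume a: "a \<in> P" and h: "h \<in> generate G {y [^] m}"
  have ac: "a \<in> carrier G" using a subgroup.mem_carrier[OF P] by blast
  have ym: "y [^] m \<in> carrier G" using y by simp
  obtain i :: nat where "h = (y [^] m) [^] i" using h generate_nat_pow[OF ym] by blast
  then have h2: "h = y [^] (m * i)" using y by (simp add: nat_pow_pow)
  have "a \<otimes> y \<otimes> inv a \<in> generate G {y}" using n a generate_single_self unfolding normalizes_def by blast
  then obtain j :: nat where j: "a \<otimes> y \<otimes> inv a = y [^] j" using generate_nat_pow[OF y] by blast
  have "a \<otimes> h \<otimes> inv a = (y [^] j) [^] (m * i)" unfolding h2 using conj_nat_pow[OF ac y, of "m * i"] j by simp
  also have "\<dots> = (y [^] m) [^] (i * j)" using y by (simp add: nat_pow_pow mult_ac)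
  finally show "a \<otimes> h \<otimes> inv a \<in> generate G {y [^] m}" using generate_nat_pow[OF ym] by blast
qed

lemma normalizes_set_mult:
  assumes H: "subgroup H G" and K: "subgroup K G" and P: "subgroup P G" and "normalizes P H" "normalizes P K"
  shows "normalizes P (H <#> K)"
  unfolding normalizes_def
proof (intro ballI)
  fix a x assume a: "a \<in> P" and "x \<in> H <#> K"
  then obtain h k where x: "h \<in> H" "k \<in> K" "x = h \<otimes> k" by (blast elim: set_multE)
  have c: "a \<in> carrier G" "h \<in> carrier G" "k \<in> carrier G"
    using subgroup.mem_carrier[OF P a] subgroup.mem_carrier[OF H x(1)] subgroup.mem_carrier[OF K x(2)] by auto
  have "a \<otimes> x \<otimes> inv a = (a \<otimes> h \<otimes> inv a) \<otimes> (a \<otimes> k \<otimes> inv a)"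
    unfolding x(3) using c by (simp add: m_assoc) (simp add: m_assoc[symmetric])
  then show "a \<otimes> x \<otimes> inv a \<in> H <#> K" using assms(4,5) a x set_multI unfolding normalizes_def by simp
qed

text \<open>For a maximal P-invariant proper subgroup S of R, some x permuting with P lies outside S P.
  The r-part of x generates a P-invariant cyclic group outside S, and a suitable power of it
  extends S by index r.\<close>
lemma invariant_chain:
  assumes P: "subgroup P G" and p: "prime (p::nat)" and cP: "card P = p ^ n" and r: "prime (r::nat)" and ne: "p \<noteq> r"
  shows "subgroup R G \<Longrightarrow> card R = r ^ k \<Longrightarrow> normalizes P R \<Longrightarrow>
    (\<And>S. subgroup S G \<Longrightarrow> S \<subseteq> R \<Longrightarrow> normalizes P S \<Longrightarrow> generate G (permuting P (S <#> P)) = S <#> P) \<Longrightarrow>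
    (invariant_step P r)\<^sup>*\<^sup>* {\<one>} R"
proof (induction "card R" arbitrary: R k rule: less_induct)
  case less
  note R = less.prems(1) and cR = less.prems(2) and nR = less.prems(3) and gen = less.prems(4)
  note rc = subgroup.mem_carrier[OF R] and pc = subgroup.mem_carrier[OF P]
  have fR: "finite R" by (rule subgroup_finite[OF R])
  have rgrp: "\<exists>j. card S = r ^ j" if "subgroup S G" "S \<subseteq> R" for S
    using subgroup_card_dvd[OF that(1) R that(2)] cR r by (auto simp: divides_primepow_nat)
  show ?case
  proof (cases "R = {\<one>}")
    case True then show ?thesis by simp
  next
    case False
    define F where "F = {S. subgroup S G \<and> S \<subset> R \<and> normalizes P S}"
    have "F \<subseteq> Pow R" unfolding F_def by blast
    then have fF: "finite F" using fR finite_subset by blast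
    have "{\<one>} \<in> F" unfolding F_def normalizes_def
      using False subgroup.one_closed[OF R] triv_subgroup pc by auto
    then have "Max (card ` F) \<in> card ` F" using fF by (intro Max_in) auto
    then obtain S where SF: "S \<in> F" and "Max (card ` F) = card S" by blast
    then have Smax: "\<forall>S'\<in>F. card S' \<le> card S" using fF by (metis Max_ge finite_imageI imageI)
    have S: "subgroup S G" and SR: "S \<subset> R" and nS: "normalizes P S" using SF unfolding F_def by auto
    have SRe: "S \<subseteq> R" using SR by blast
    have full: "S' = R" if S': "subgroup S' G" "S \<subset> S'" "S' \<subseteq> R" "normalizes P S'" for S'
    proof (rule ccontr)
      assume "S' \<noteq> R"
      then have "S' \<in> F" using S' unfolding F_def by blast
      moreover have "card S < card S'" using S' subgroup_finite by (blast intro: psubset_card_mono)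
      ultimately show False using Smax by force
    qed
    \<comment> \<open>The normaliser of S in R is P-invariant and properly larger than S, so the
      maximality of S makes S normal in R.\<close>
    define N where "N = {x \<in> R. normalizes {x} S}"
    have NS: "subgroup N G" unfolding N_def by (rule subgroup_normalizer_in[OF S R])
    have SN: "S \<subseteq> N" unfolding N_def
      using SRe normalizes_mono[OF subgroup_normalizes_self[OF S]] by blast
    have nN: "normalizes P N" unfolding normalizes_def
    proof (intro ballI)
      fix a x assume a: "a \<in> P" and x: "x \<in> N"
      have xR: "x \<in> R" and nx: "normalizes {x} S" using x unfolding N_def by auto
      have ax: "a \<otimes> x \<otimes> inv a \<in> R" using nR a xR unfolding normalizes_def by blast
      have "normalizes {a \<otimes> x \<otimes> inv a} S" unfolding normalizes_def
      proof clarify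
        fix h assume h: "h \<in> S"
        have c: "a \<in> carrier G" "x \<in> carrier G" "h \<in> carrier G" using a pc xR rc h SRe by auto
        have "inv a \<otimes> h \<otimes> a \<in> S" using normalizes_inv[OF S c(1) normalizes_mono[OF nS] h] a by blast
        then have "x \<otimes> (inv a \<otimes> h \<otimes> a) \<otimes> inv x \<in> S" using nx unfolding normalizes_def by blast
        then have "a \<otimes> (x \<otimes> (inv a \<otimes> h \<otimes> a) \<otimes> inv x) \<otimes> inv a \<in> S" using nS a unfolding normalizes_def by blast
        moreover have "a \<otimes> (x \<otimes> (inv a \<otimes> h \<otimes> a) \<otimes> inv x) \<otimes> inv a
            = (a \<otimes> x \<otimes> inv a) \<otimes> h \<otimes> inv (a \<otimes> x \<otimes> inv a)"
          using c by (simp add: inv_mult_group m_assoc)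
        ultimately show "a \<otimes> x \<otimes> inv a \<otimes> h \<otimes> inv (a \<otimes> x \<otimes> inv a) \<in> S" by simp
      qed
      then show "a \<otimes> x \<otimes> inv a \<in> N" unfolding N_def using ax by blast
    qed
    obtain g where "g \<in> R - S" "normalizes {g} S" using p_group_normalizer_grows[OF R S SR r cR] by blast
    then have "S \<subset> N" using SN unfolding N_def by blast
    then have "N = R" using full[OF NS _ _ nN] unfolding N_def by blast
    then have nRS: "normalizes R S" unfolding N_def normalizes_def by blast
    have copP: "coprime (card Q) (card P)" if Q: "subgroup Q G" "Q \<subseteq> R" for Q
    proof -
      obtain j where "card Q = r ^ j" using rgrp[OF Q] by blast
      then show ?thesis unfolding cP using primes_coprime[OF r p] ne by simp
    qed
    define V where "V = R <#> P"
    define L where "L = S <#> P"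
    have V: "subgroup V G" unfolding V_def by (rule set_mult_subgroup[OF R P nR])
    have L: "subgroup L G" unfolding L_def by (rule set_mult_subgroup[OF S P nS])
    have cV: "card V = card R * card P" unfolding V_def by (rule card_set_mult_coprime[OF R P copP[OF R order_refl]])
    have cL: "card L = card S * card P" unfolding L_def by (rule card_set_mult_coprime[OF S P copP[OF S SRe]])
    have RV: "R \<subseteq> V" unfolding V_def by (rule subset_set_mult_left[OF subgroup.subset[OF R] P])
    have PV: "P \<subseteq> V" unfolding V_def by (rule subset_set_mult_right[OF R subgroup.subset[OF P]])
    have "card L < card V" unfolding cL cV
      using psubset_card_mono[OF fR SR] subgroup_card_pos[OF P] by simp
    moreover have "card V \<le> card L" if "V \<subseteq> L" using that subgroup_finite[OF L] by (simp add: card_mono)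
    ultimately have "\<not> V \<subseteq> L" by (meson not_le)
    moreover have "generate G (permuting P V) = V" using gen[OF R order_refl nR] unfolding V_def .
    ultimately have "\<not> permuting P V \<subseteq> L" using generate_subgroup_incl[OF _ L] by metis
    then obtain x where x: "x \<in> V" "generate G {x} <#> P = P <#> generate G {x}" "x \<notin> L"
      unfolding permuting_def by blast
    have xc: "x \<in> carrier G" using x(1) subgroup.mem_carrier[OF V] by blast
    define C where "C = generate G {x}"
    have C: "subgroup C G" unfolding C_def by (rule generate_single_subgroup[OF xc])
    have CV: "C \<subseteq> V" unfolding C_def by (rule generate_subgroup_incl[OF _ V]) (use x in simp)
    have cC: "card C = ord x" unfolding C_def by (rule generate_single_card[OF xc])
    define X where "X = P <#> C"
    have X: "subgroup X G" unfolding X_def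
      by (rule set_mult_subgroup_if_commute[OF P C]) (use x(2) in \<open>simp add: C_def\<close>)
    have PX: "P \<subseteq> X" unfolding X_def by (rule subset_set_mult_left[OF subgroup.subset[OF P] C])
    have xX: "x \<in> X" using subset_set_mult_right[OF P subgroup.subset[OF C]] generate_single_self[of x]
      unfolding X_def C_def by blast
    have XV: "X \<subseteq> V" unfolding X_def by (rule set_mult_subset[OF V PV CV])
    define Z where "Z = R \<inter> X"
    have Z: "subgroup Z G" unfolding Z_def by (rule subgroups_Inter_pair[OF R X])
    have "V \<inter> X = Z <#> P" unfolding V_def Z_def by (rule dedekind_law[OF X R PX])
    then have XZ: "X = Z <#> P" using XV by blast
    have nZ: "normalizes P Z" unfolding Z_def
      by (rule normalizes_Int[OF nR normalizes_mono[OF subgroup_normalizes_self[OF X] PX]])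
    have ZR: "Z \<subseteq> R" unfolding Z_def by blast
    have cX: "card X = card Z * card P" unfolding XZ by (rule card_set_mult_coprime[OF Z P copP[OF Z ZR]])
    have "card P * (card Z * card (P \<inter> C)) = card P * card C"
      using card_set_mult[OF P C] cX unfolding X_def by (metis mult.assoc mult.commute)
    then have cZC: "card Z * card (P \<inter> C) = card C" using subgroup_card_pos[OF P] by simp
    \<comment> \<open>By \<open>cZC\<close> the order of x is an r-power times the p-power m, so x^m
      generates the r-part of <x>, and that has order \<open>card Z\<close>.\<close>
    define m where "m = card (P \<inter> C)"
    have mpos: "m > 0" unfolding m_def by (rule subgroup_card_pos[OF subgroups_Inter_pair[OF P C]])
    define y where "y = x [^] m"
    have yc: "y \<in> carrier G" unfolding y_def using xc by simp
    define Y where "Y = generate G {y}"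
    have Y: "subgroup Y G" unfolding Y_def by (rule generate_single_subgroup[OF yc])
    have "ord y = ord x div m" unfolding y_def
      by (rule ord_pow[OF xc]) (use cZC cC mpos in \<open>metis dvd_triv_right m_def\<close>, use mpos in simp)
    then have cY: "card Y = card Z" unfolding Y_def generate_single_card[OF yc]
      using cZC cC mpos unfolding m_def by (metis nonzero_mult_div_cancel_right not_gr0)
    have YC: "Y \<subseteq> C" unfolding Y_def C_def y_def
      by (rule generate_subgroup_incl[OF _ generate_single_subgroup[OF xc]]) (use generate_nat_pow[OF xc] in blast)
    have nVR: "normalizes V R" unfolding normalizes_def
    proof (intro ballI)
      fix v h assume v: "v \<in> V" and h: "h \<in> R"
      obtain a b where ab: "a \<in> R" "b \<in> P" "v = a \<otimes> b" using v unfolding V_def by (rule set_multE)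
      have c: "a \<in> carrier G" "b \<in> carrier G" "h \<in> carrier G" using ab h rc pc by auto
      have "v \<otimes> h \<otimes> inv v = a \<otimes> (b \<otimes> h \<otimes> inv b) \<otimes> inv a" unfolding ab(3) using c by (simp add: inv_mult_group m_assoc)
      moreover have "b \<otimes> h \<otimes> inv b \<in> R" using nR ab h unfolding normalizes_def by blast
      ultimately show "v \<otimes> h \<otimes> inv v \<in> R" using ab R by (simp add: subgroup.m_closed subgroup.m_inv_closed)
    qed
    have YV: "Y \<subseteq> V" using YC CV by blast
    \<comment> \<open>R is normal in V, and its index \<open>card P\<close> is prime to the order of
      Y. Once Y lies in R, it must by its order be all of R \<inter> X, and this group is normalised
      by P.\<close>
    have "Y \<subseteq> R"
      by (rule coprime_index_subset[OF Y R V YV RV normalizes_mono[OF nVR YV]])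
         (use cV cY copP[OF Z ZR] subgroup_card_pos[OF R] in simp)
    moreover have "Y \<subseteq> X" using YC subset_set_mult_right[OF P subgroup.subset[OF C]] unfolding X_def by blast
    ultimately have YZ: "Y = Z" using cY subgroup_finite[OF Z] unfolding Z_def by (intro card_subset_eq) auto
    have yR: "y \<in> R" using YZ ZR generate_single_self[of y] unfolding Y_def by blast
    have nY: "normalizes P (generate G {y})" using nZ YZ unfolding Y_def by simp
    \<comment> \<open>Otherwise Z = Y would be inside S, so X = Z P, which contains x, would be
      inside L = S P.\<close>
    have yS: "y \<notin> S"
    proof
      assume "y \<in> S"
      then have "Y \<subseteq> S" unfolding Y_def by (intro generate_subgroup_incl[OF _ S]) simp
      then have "X \<subseteq> L" unfolding XZ L_def using YZ by (intro set_mult_mono) auto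
      then show False using xX x(3) by blast
    qed
    have "y [^] (r ^ k) = \<one>" using pow_card_subgroup[OF R yR] cR by simp
    then have ex: "\<exists>i. y [^] (r ^ i) \<in> S" using subgroup.one_closed[OF S] by metis
    \<comment> \<open>Among the iterated r-th powers of y, w is to be the last one before S is
      reached. Then w^r lies in S, which limits the index of S in S W to r, while maximality of S
      makes S W all of R.\<close>
    define i where "i = (LEAST i. y [^] (r ^ i) \<in> S)"
    have iS: "y [^] (r ^ i) \<in> S" unfolding i_def using LeastI_ex[OF ex] .
    have "i \<noteq> 0" using iS yS yc by (metis nat_pow_eone power_0)
    then obtain j where j: "i = Suc j" using not0_implies_Suc by blast
    define w where "w = y [^] (r ^ j)"
    have wS: "w \<notin> S" unfolding w_def using not_less_Least[of j "\<lambda>i. y [^] (r ^ i) \<in> S"] j unfolding i_def by simp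
    have wc: "w \<in> carrier G" unfolding w_def using yc by simp
    have wr: "w [^] r \<in> S" using iS unfolding j w_def using yc by (simp add: nat_pow_pow mult.commute)
    define W where "W = generate G {w}"
    have W: "subgroup W G" unfolding W_def by (rule generate_single_subgroup[OF wc])
    have nW: "normalizes P W" unfolding W_def w_def by (rule normalizes_generate[OF P yc nY])
    have "w \<in> Y" unfolding w_def Y_def using generate_nat_pow[OF yc] by blast
    then have wR: "w \<in> R" using YZ ZR by blast
    then have WR: "W \<subseteq> R" unfolding W_def by (intro generate_subgroup_incl[OF _ R]) simp
    have SW: "subgroup (S <#> W) G" by (rule set_mult_subgroup[OF S W normalizes_mono[OF nRS WR]])
    have "S <#> W = R"
    proof (rule full[OF SW])
      have "w \<in> S <#> W" using subset_set_mult_right[OF S subgroup.subset[OF W]] generate_single_self[of w] unfolding W_def by blast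
      then show "S \<subset> S <#> W" using wS subset_set_mult_left[OF subgroup.subset[OF S] W] by blast
      show "S <#> W \<subseteq> R" by (rule set_mult_subset[OF R SRe WR])
      show "normalizes P (S <#> W)" by (rule normalizes_set_mult[OF S W P nS nW])
    qed
    then have cSW: "card R * card (S \<inter> W) = card S * card W" using card_set_mult[OF S W] by simp
    have SWi: "subgroup (S \<inter> W) G" by (rule subgroups_Inter_pair[OF S W])
    have "card W \<le> r * card (S \<inter> W)"
    proof -
      have wrc: "w [^] r \<in> carrier G" using wc by simp
      have "w [^] r \<in> W" unfolding W_def using generate_nat_pow[OF wc] by blast
      then have "generate G {w [^] r} \<subseteq> S \<inter> W" using wr by (intro generate_subgroup_incl[OF _ SWi]) simp
      then have "ord (w [^] r) \<le> card (S \<inter> W)"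
        using card_mono[OF subgroup_finite[OF SWi]] generate_single_card[OF wrc] by metis
      moreover have "card W dvd r * ord (w [^] r)"
      proof -
        have "w [^] (r * ord (w [^] r)) = \<one>" using wc wrc by (simp add: nat_pow_pow[symmetric])
        then show ?thesis unfolding W_def generate_single_card[OF wc] using pow_eq_id[OF wc] by blast
      qed
      then have "card W \<le> r * ord (w [^] r)"
        using ord_ge_1[OF finite_carrier wrc] prime_gt_0_nat[OF r] by (intro dvd_imp_le) auto
      ultimately show ?thesis by (meson mult_le_mono2 order_trans)
    qed
    then have "card R * card (S \<inter> W) \<le> card S * (r * card (S \<inter> W))" unfolding cSW by simp
    then have le: "card R \<le> r * card S" using subgroup_card_pos[OF SWi] by (simp add: mult_ac)
    obtain c where c: "card R = card S * c" using subgroup_card_dvd[OF S R SRe] by blast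
    have "c \<noteq> 1" using c SR fR by (metis card_subset_eq mult.right_neutral psubset_imp_subset order_less_irrefl)
    moreover have "c dvd r ^ k" using c cR by (metis dvd_triv_right)
    ultimately have "r \<le> c" using dvd_prime_power_le_eq_1[OF r] by (meson not_le)
    then have idx: "card R = r * card S" using le c by (metis antisym mult.commute mult_le_mono1)
    then have st: "invariant_step P r S R" unfolding invariant_step_def using S R SRe nS nR by blast
    obtain k' where k': "card S = r ^ k'" using rgrp[OF S SRe] by blast
    have "(invariant_step P r)\<^sup>*\<^sup>* {\<one>} S"
      by (rule less.hyps[OF psubset_card_mono[OF fR SR] S k' nS]) (use gen SRe in blast)
    then show ?thesis using st by (rule rtranclp.rtrancl_into_rtrancl)
  qed
qed

lemma prime_steps_between_halls:
  assumes hA: "hall r A" and hB: "hall (r - 1) B" and r: "prime r"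
    and P: "subgroup P G" and p: "prime p" and cP: "card P = p ^ n" and nd: "\<not> p dvd card B" and ne: "p \<noteq> r"
    and gen: "\<And>S. subgroup S G \<Longrightarrow> normalizes P S \<Longrightarrow> generate G (permuting P (S <#> P)) = S <#> P"
  shows "prime_step\<^sup>*\<^sup>* (A <#> P) (B <#> P)"
proof -
  note A = hall_subgroup[OF hA] and B = hall_subgroup[OF hB] and An = hall_normal[OF hA]
  have nPB: "normalizes P B" by (rule hall_normalizes[OF hB subgroup.subset[OF P]])
  have AB: "A \<subseteq> B" by (rule hall_subset[OF hB A]) (meson hall_prime_dvd[OF hA] less_imp_diff_less)
  obtain R where R: "subgroup R G" "R \<subseteq> B" "card R = r ^ multiplicity r (card B)" "normalizes P R"
    using invariant_sylow[OF B P p cP nPB nd r] by blast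
  have copP: "coprime (card Q) (card P)" if "subgroup Q G" "Q \<subseteq> B" for Q
  proof -
    have "\<not> p dvd card Q" using subgroup_card_dvd[OF that(1) B that(2)] nd dvd_trans by blast
    then show ?thesis unfolding cP using p by (simp add: prime_imp_coprime coprime_commute)
  qed
  have rA: "\<not> r dvd card A" using hall_prime_dvd[OF hA r] by auto
  have cX: "card (A <#> (S <#> P)) = card A * (card S * card P)" and Xs: "subgroup (A <#> (S <#> P)) G"
    if S: "subgroup S G" "S \<subseteq> R" "normalizes P S" for S
  proof -
    have SP: "subgroup (S <#> P) G" by (rule set_mult_subgroup[OF S(1) P S(3)])
    have c: "card (S <#> P) = card S * card P"
      by (rule card_set_mult_coprime[OF S(1) P copP]) (use S R in auto)
    have "card S dvd r ^ multiplicity r (card B)" using subgroup_card_dvd[OF S(1) R(1) S(2)] R(3) by simp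
    then have "coprime (card S) (card A)" using r rA
      by (auto simp: divides_primepow_nat prime_imp_coprime)
    then have "coprime (card A) (card S * card P)" using copP[OF A AB] by (simp add: coprime_commute)
    then show "card (A <#> (S <#> P)) = card A * (card S * card P)"
      using card_set_mult_coprime[OF A SP] c by simp
    show "subgroup (A <#> (S <#> P)) G"
      by (rule set_mult_subgroup[OF A SP normalizes_mono[OF An subgroup.subset[OF SP]]])
  qed
  have "(invariant_step P r)\<^sup>*\<^sup>* {\<one>} R"
    by (rule invariant_chain[OF P p cP r ne R(1,3,4)]) (use gen in blast)
  moreover have "S \<subseteq> R \<longrightarrow> prime_step\<^sup>*\<^sup>* (A <#> ({\<one>} <#> P)) (A <#> (S <#> P))" if "(invariant_step P r)\<^sup>*\<^sup>* {\<one>} S" for S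
    using that
  proof (induction rule: rtranclp_induct)
    case base show ?case by simp
  next
    case (step S S')
    show ?case
    proof
      assume S'R: "S' \<subseteq> R"
      have S: "subgroup S G" and S': "subgroup S' G" and SS': "S \<subseteq> S'" and c: "card S' = r * card S"
        and n: "normalizes P S" "normalizes P S'" using step.hyps(2) unfolding invariant_step_def by auto
      have SR: "S \<subseteq> R" using SS' S'R by blast
      have "card (A <#> (S' <#> P)) = r * card (A <#> (S <#> P))"
        unfolding cX[OF S SR n(1)] cX[OF S' S'R n(2)] c by (simp only: mult_ac)
      then have "prime (card (A <#> (S' <#> P)) div card (A <#> (S <#> P)))"
        using subgroup_card_pos[OF Xs[OF S SR n(1)]] r by simp
      moreover have "A <#> (S <#> P) \<subseteq> A <#> (S' <#> P)" using SS' by (intro set_mult_mono) auto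
      ultimately have "prime_step (A <#> (S <#> P)) (A <#> (S' <#> P))"
        unfolding prime_step_def using Xs[OF S SR n(1)] Xs[OF S' S'R n(2)] by blast
      then show "prime_step\<^sup>*\<^sup>* (A <#> ({\<one>} <#> P)) (A <#> (S' <#> P))"
        using step.IH SR by (meson rtranclp.rtrancl_into_rtrancl)
    qed
  qed
  ultimately have "prime_step\<^sup>*\<^sup>* (A <#> ({\<one>} <#> P)) (A <#> (R <#> P))" by blast
  moreover have "{\<one>} <#> P = P" using subgroup.mem_carrier[OF P] by (auto simp: set_mult_def)
  moreover have "A <#> (R <#> P) = B <#> P"
  proof (rule card_seteq)
    have BP: "subgroup (B <#> P) G" by (rule set_mult_subgroup[OF B P nPB])
    show "finite (B <#> P)" by (rule subgroup_finite[OF BP])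
    have B1: "B \<subseteq> B <#> P" by (rule subset_set_mult_left[OF subgroup.subset[OF B] P])
    have P1: "P \<subseteq> B <#> P" by (rule subset_set_mult_right[OF B subgroup.subset[OF P]])
    show "A <#> (R <#> P) \<subseteq> B <#> P"
      by (intro set_mult_subset[OF BP]) (use B1 P1 AB R in auto)
    have "card B dvd card A * card R"
    proof (rule multiplicity_le_imp_dvd)
      show "card B \<noteq> 0" using subgroup_card_pos[OF B] by simp
      fix q :: nat assume q: "prime q"
      have m: "multiplicity q (card A * card R) = multiplicity q (card A) + multiplicity q (card R)"
        using prime_multiplicity_mult[OF q subgroup_card_pos[OF A] subgroup_card_pos[OF R(1)]] .
      show "multiplicity q (card B) \<le> multiplicity q (card A * card R)"
      proof (cases "q = r")
        case True
        have "multiplicity r (card R) = multiplicity r (card B)" unfolding R(3) using r by simp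
        then show ?thesis unfolding m using True by simp
      next
        case False
        then show ?thesis unfolding m using hA hB q unfolding hall_def by auto
      qed
    qed
    then have "card B \<le> card A * card R" using subgroup_card_pos[OF A] subgroup_card_pos[OF R(1)] by (intro dvd_imp_le) auto
    then show "card (B <#> P) \<le> card (A <#> (R <#> P))"
      unfolding cX[OF R(1) order_refl R(4)] card_set_mult_coprime[OF B P copP[OF B order_refl]]
      by (simp add: mult.assoc[symmetric])
  qed
  ultimately show ?thesis by simp
qed

text \<open>The groups N_m P run from P, at m = \<open>order G\<close>, up to G, at m = 0. When m +
  1 is a prime above p, an invariant chain fills the gap; at m + 1 = p nothing changes, since N_p P
  = N_(p-1); below p the group P is absorbed in N_m, and a chain between the Hall subgroups
  themselves is used.\<close>

lemma strongly_permuteral_sylow_subnormal: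
  assumes tower: "\<And>m. \<exists>N. hall m N" and p: "prime p" and P: "subgroup P G"
    and cP: "card P = p ^ multiplicity p (order G)" and sp: "strongly_permuteral P G"
    and nP: "\<And>N. hall p N \<Longrightarrow> normalizes (carrier G) (N <#> P)"
  shows "prime_step\<^sup>*\<^sup>* P (carrier G)"
proof -
  define N where "N m = (SOME N. hall m N)" for m
  have N: "hall m (N m)" for m unfolding N_def by (rule someI_ex[OF tower])
  have triv: "prime_step\<^sup>*\<^sup>* (N (Suc m)) (N m)" if r: "prime (Suc m)" for m
  proof -
    \<comment> \<open>The trivial group stands in for P as a group of order q^0. The prime q has to
      differ from m + 1 and must not divide \<open>card (N m)\<close>, hence the bound.\<close>
    obtain q where q: "prime q" "q > max (Suc m) (card (N m))" using bigger_prime by blast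
    have "\<not> q dvd card (N m)" using q subgroup_card_pos[OF hall_subgroup[OF N]] by (auto dest: dvd_imp_le)
    moreover have "generate G (permuting {\<one>} (S <#> {\<one>})) = S <#> {\<one>}" if S: "subgroup S G" for S
    proof -
      have 1: "H <#> {\<one>} = H" if "subgroup H G" for H
        using subgroup.mem_carrier[OF that] by (force simp: set_mult_def)
      have 2: "{\<one>} <#> H = H" if "subgroup H G" for H
        using subgroup.mem_carrier[OF that] by (force simp: set_mult_def)
      have "permuting {\<one>} S = S" unfolding permuting_def
        using 1 2 generate_single_subgroup subgroup.mem_carrier[OF S] by auto
      then show ?thesis unfolding 1[OF S]
        using generate_subgroup_incl[OF order_refl S] by (auto intro: generate.incl)
    qed
    ultimately have "prime_step\<^sup>*\<^sup>* (N (Suc m) <#> {\<one>}) (N m <#> {\<one>})"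
      using prime_steps_between_halls[OF N _ r triv_subgroup q(1), where n = 0 and B = "N m"] N[of m] q(2) by simp
    moreover have "N m <#> {\<one>} = N m" for m
      using subgroup.mem_carrier[OF hall_subgroup[OF N]] by (force simp: set_mult_def)
    ultimately show ?thesis by simp
  qed
  have gen: "generate G (permuting P (S <#> P)) = S <#> P" if S: "subgroup S G" "normalizes P S" for S
  proof -
    have SP: "subgroup (S <#> P) G" by (rule set_mult_subgroup[OF S(1) P S(2)])
    have "P \<subseteq> S <#> P" by (rule subset_set_mult_right[OF S(1) subgroup.subset[OF P]])
    then have "permutizer (G\<lparr>carrier := S <#> P\<rparr>) P = S <#> P"
      using sp SP unfolding strongly_permuteral_def by blast
    then show ?thesis using permutizer_restrict[OF SP, of P] by simp
  qed
  have PN: "N m <#> P = N m" if "m < p" for m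
  proof -
    have "P \<subseteq> N m"
    proof (rule hall_subset[OF N P])
      fix q assume "prime q" "q dvd card P"
      then have "q = p" using cP p by (metis prime_dvd_power primes_dvd_imp_eq)
      then show "m < q" using that by simp
    qed
    then show ?thesis
      using set_mult_subset[OF hall_subgroup[OF N] order_refl] subset_set_mult_left[OF subgroup.subset[OF hall_subgroup[OF N]] P]
      by blast
  qed
  have step: "prime_step\<^sup>*\<^sup>* (N (Suc m) <#> P) (N m <#> P)" for m
  proof (cases "prime (Suc m)")
    case False
    \<comment> \<open>For composite m + 1 the two Hall conditions coincide, so by uniqueness the two
      groups are equal and the chain is empty.\<close>
    have "m < q \<longleftrightarrow> Suc m < q" if "prime q" for q using that False by (metis Suc_lessI Suc_lessD)
    then have "hall m (N (Suc m))" using N[of "Suc m"] unfolding hall_def by auto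
    then show ?thesis using hall_unique[OF N[of m]] by simp
  next
    case True
    consider "Suc m < p" | "Suc m = p" | "p < Suc m" by linarith
    then show ?thesis
    proof cases
      case 1 then show ?thesis using triv[OF True] PN by simp
    next
      case 2
      have "hall m (N (Suc m) <#> P)"
        by (rule hall_Suc_mult_sylow[OF N True P]) (use cP nP N 2 in auto)
      then have "N m = N (Suc m) <#> P" by (rule hall_unique[OF N])
      then show ?thesis using PN[of m] 2 by simp
    next
      case 3
      have "\<not> p dvd card (N m)" using hall_prime_dvd[OF N p] 3 by fastforce
      then show ?thesis
        using prime_steps_between_halls[OF N _ True P p cP, where B = "N m"] N[of m] 3 gen by simp
    qed
  qed
  have "prime_step\<^sup>*\<^sup>* (N (m + d) <#> P) (N m <#> P)" for m d
  proof (induction d)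
    case 0 then show ?case by simp
  next
    case (Suc d) then show ?case using step[of "m + d"] by simp
  qed
  from this[of 0 "order G"] have ch: "prime_step\<^sup>*\<^sup>* (N (order G) <#> P) (N 0 <#> P)" by simp
  have "N (order G) = {\<one>}"
  proof -
    have "card (N (order G)) = 1"
    proof (rule ccontr)
      assume "card (N (order G)) \<noteq> 1"
      then obtain q where q: "prime q" "q dvd card (N (order G))" using prime_factor_nat by blast
      then have "order G < q" using hall_prime_dvd[OF N] by blast
      moreover have "q dvd order G" using q subgroup_card_dvd_order[OF hall_subgroup[OF N]] dvd_trans by blast
      ultimately show False using order_pos by (auto dest: dvd_imp_le)
    qed
    then show ?thesis using subgroup.one_closed[OF hall_subgroup[OF N]] by (metis card_1_singletonE singletonD)
  qed
  moreover have "{\<one>} <#> P = P" using subgroup.mem_carrier[OF P] by (auto simp: set_mult_def)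
  moreover have "carrier G \<subseteq> N 0" by (rule hall_subset[OF N carrier_subgroup]) (simp add: prime_gt_0_nat)
  then have "N 0 = carrier G" using subgroup.subset[OF hall_subgroup[OF N]] by blast
  then have "N 0 <#> P = carrier G"
    using PN[of 0] prime_gt_0_nat[OF p] by simp
  ultimately show ?thesis using ch by simp
qed

section \<open>The equivalence\<close>

lemma sylow_subgroup_ex: "prime p \<Longrightarrow> \<exists>P. sylow_subgroup P G \<and> card P = p ^ multiplicity p (order G)"
  using sylow_in[OF carrier_subgroup _ multiplicity_dvd[of p]] unfolding sylow_subgroup_def order_def by blast

lemma w_supersoluble_iff:
  "w_supersoluble G \<longleftrightarrow> (\<forall>H. sylow_subgroup H G \<longrightarrow> strongly_permuteral H G)"
proof
  assume w: "w_supersoluble G"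
  have ch: "prime_step\<^sup>*\<^sup>* P (carrier G)" if "sylow_subgroup P G" for P
    using w that P_subnormal_iff unfolding w_supersoluble_def sylow_subgroup_def by blast
  have tower: "\<exists>N. hall m N" for m
  proof (rule hall_tower)
    fix p N assume pN: "prime p" "hall p N"
    obtain P where P: "sylow_subgroup P G" "card P = p ^ multiplicity p (order G)" using sylow_subgroup_ex[OF pN(1)] by blast
    then have "subgroup P G" unfolding sylow_subgroup_def by blast
    then show "\<exists>P. subgroup P G \<and> card P = p ^ multiplicity p (order G) \<and> normalizes (carrier G) (N <#> P)"
      using subnormal_sylow_normal[OF pN _ P(2) ch[OF P(1)]] P(2) by blast
  qed
  show "\<forall>H. sylow_subgroup H G \<longrightarrow> strongly_permuteral H G"
    using subnormal_sylow_strongly_permuteral[OF tower] ch unfolding sylow_subgroup_def by blast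
next
  assume sp: "\<forall>H. sylow_subgroup H G \<longrightarrow> strongly_permuteral H G"
  have nP: "normalizes (carrier G) (N <#> P)"
    if P: "sylow_subgroup P G" "prime p" "card P = p ^ multiplicity p (order G)" and N: "hall p N" for P p N
  proof -
    have Ps: "subgroup P G" using P unfolding sylow_subgroup_def by blast
    \<comment> \<open>The tower is built from strong permuterality at U = G; the smaller overgroups
      of P enter only in the construction of the chains.\<close>
    have "permutizer (G\<lparr>carrier := carrier G\<rparr>) P = carrier G"
      using sp P(1) carrier_subgroup subgroup.subset[OF Ps] unfolding strongly_permuteral_def by blast
    then have "permutizer G P = carrier G" by simp
    then show ?thesis by (rule permuteral_normal[OF P(2) N Ps P(3)])
  qed
  have tower: "\<exists>N. hall m N" for m
  proof (rule hall_tower)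
    fix p N assume pN: "prime p" "hall p N"
    obtain P where P: "sylow_subgroup P G" "card P = p ^ multiplicity p (order G)" using sylow_subgroup_ex[OF pN(1)] by blast
    then have "subgroup P G" unfolding sylow_subgroup_def by blast
    then show "\<exists>P. subgroup P G \<and> card P = p ^ multiplicity p (order G) \<and> normalizes (carrier G) (N <#> P)"
      using nP[OF P(1) pN(1) P(2) pN(2)] P(2) by blast
  qed
  show "w_supersoluble G" unfolding w_supersoluble_def
  proof (intro allI impI)
    fix P assume P: "sylow_subgroup P G"
    then obtain p where p: "subgroup P G" "prime p" "card P = p ^ multiplicity p (order G)"
      unfolding sylow_subgroup_def by blast
    have "prime_step\<^sup>*\<^sup>* P (carrier G)"
      by (rule strongly_permuteral_sylow_subnormal[OF tower p(2,1,3)]) (use sp P nP p in auto)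
    then show "P_subnormal P G" using P_subnormal_iff[OF p(1)] by blast
  qed
qed

end

theorem theorem3p1:
  fixes G :: "('a, 'b) monoid_scheme"
  assumes "group G" and "finite (carrier G)"
  shows "w_supersoluble G \<longleftrightarrow> (\<forall>H. sylow_subgroup H G \<longrightarrow> strongly_permuteral H G)"
  by (rule finite_group.w_supersoluble_iff) (simp add: finite_group_def finite_group_axioms_def assms)

end
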